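(* Consider the modulo-sum relay channel described in the context, and let $R_0=\max_{p(x_1)} I(X_1;S)$ be the capacity of the relay–destination channel $p(s\mid x_1)$. Then its capacity is $$C=\max_{p(u\mid y_1):\ I(U;Y_1)\le R_0}\ \bigl(\log_2 m-H(Z\mid U)\bigr),$$ where $(Z,Y_1,U)$ has joint law $p(z)p(y_1\mid z)p(u\mid y_1)$, and the maximization may be restricted to $U$ with $|\mathcal U|\le|\mathcal Y_1|+2$.
   Context: Modulo-sum relay channel: fix an integer $m\ge2$. Source input $X_i\in\mathbb Z_m$; noise $Z_i\in\mathbb Z_m$ i.i.d. with an arbitrary distribution $p(z)$, independent of the message; the destination receives $Y_i=X_i+Z_i \pmod m$. The relay observes $Y_{1i}$ in a finite alphabet $\mathcal Y_1$, generated memorylessly from $Z_i$ via a fixed conditional law $p(y_1\mid z)$ (so $p(y_1\mid x,y,z)=p(y_1\mid z)$). The relay sends $X_{1i}$ over a separate discrete memoryless channel with finite alphabets and transition law $p(s\mid x_1)$, independent of everything else, whose output $S_i$ is seen by the destination. An $(n,2^{nR})$ code consists of a message $W$ uniform on $\{1,\dots,2^{nR}\}$, an encoder $X^n=X^n(W)$, relay functions $X_{1i}=f_i(Y_1^{i-1})$, and a decoder $\hat W=g(Y^n,S^n)$; a rate is achievable if codes exist with $\Pr(\hat W\ne W)\to0$, and the capacity is the supremum of achievable rates. Entropies are in bits. *)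

theory Defs
  imports Complex_Main "HOL-Library.FuncSet"
begin

text \<open>Z_m is represented by {0..<m} (nat); sequences of length n by extensional
functions on {0..<n}; entropies in bits with 0 log 0 = 0.\<close>

definition plogp :: "real \<Rightarrow> real" where
  "plogp x = (if x = 0 then 0 else x * log 2 x)"

definition ent :: "('a \<Rightarrow> real) \<Rightarrow> 'a set \<Rightarrow> real" where
  "ent p A = - (\<Sum>a\<in>A. plogp (p a))"

definition is_pmf_on :: "('a \<Rightarrow> real) \<Rightarrow> 'a set \<Rightarrow> bool" where
  "is_pmf_on p A \<longleftrightarrow> (\<forall>a\<in>A. 0 \<le> p a) \<and> sum p A = 1"

definition mutual_info ::
  "('a \<Rightarrow> real) \<Rightarrow> ('a \<Rightarrow> 'b \<Rightarrow> real) \<Rightarrow> 'a set \<Rightarrow> 'b set \<Rightarrow> real" where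
  "mutual_info p W A B =
     ent p A + ent (\<lambda>b. \<Sum>a\<in>A. p a * W a b) B
     - ent (\<lambda>(a,b). p a * W a b) (A \<times> B)"

definition R0 :: "('x1::finite \<Rightarrow> 's::finite \<Rightarrow> real) \<Rightarrow> real" where
  "R0 Wr = Sup {mutual_info p Wr UNIV UNIV | p. is_pmf_on p UNIV}"

text \<open>Auxiliary U with alphabet {0..<k}, test channel Q = p(u|y1).
  Law of Y1: p(y1) = sum_z p(z) p(y1|z).\<close>
definition pY1 :: "nat \<Rightarrow> (nat \<Rightarrow> real) \<Rightarrow> (nat \<Rightarrow> 'y1 \<Rightarrow> real) \<Rightarrow> 'y1 \<Rightarrow> real" where
  "pY1 m pz W1 y1 = (\<Sum>z<m. pz z * W1 z y1)"

definition I_UY1 :: "nat \<Rightarrow> (nat \<Rightarrow> real) \<Rightarrow> (nat \<Rightarrow> 'y1::finite \<Rightarrow> real)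
    \<Rightarrow> nat \<Rightarrow> ('y1 \<Rightarrow> nat \<Rightarrow> real) \<Rightarrow> real" where
  "I_UY1 m pz W1 k Q = mutual_info (pY1 m pz W1) Q UNIV {0..<k}"

definition pZU :: "(nat \<Rightarrow> real) \<Rightarrow> (nat \<Rightarrow> 'y1::finite \<Rightarrow> real)
    \<Rightarrow> ('y1 \<Rightarrow> nat \<Rightarrow> real) \<Rightarrow> nat \<times> nat \<Rightarrow> real" where
  "pZU pz W1 Q = (\<lambda>(z,u). \<Sum>y1\<in>UNIV. pz z * W1 z y1 * Q y1 u)"

definition H_Z_given_U :: "nat \<Rightarrow> (nat \<Rightarrow> real) \<Rightarrow> (nat \<Rightarrow> 'y1::finite \<Rightarrow> real)
    \<Rightarrow> nat \<Rightarrow> ('y1 \<Rightarrow> nat \<Rightarrow> real) \<Rightarrow> real" where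
  "H_Z_given_U m pz W1 k Q =
     ent (pZU pz W1 Q) ({0..<m} \<times> {0..<k})
     - ent (\<lambda>u. \<Sum>z<m. pZU pz W1 Q (z,u)) {0..<k}"

text \<open>Average error probability of a code of length n with M messages {1..M}:
  encoder enc w i \<in> Z_m, relay functions f i (depending on y1 at times < i),
  decoder g applied to (Y^n, S^n).\<close>
definition err_prob ::
  "nat \<Rightarrow> (nat \<Rightarrow> real) \<Rightarrow> (nat \<Rightarrow> 'y1::finite \<Rightarrow> real) \<Rightarrow> ('x1 \<Rightarrow> 's::finite \<Rightarrow> real)
   \<Rightarrow> nat \<Rightarrow> nat \<Rightarrow> (nat \<Rightarrow> nat \<Rightarrow> nat) \<Rightarrow> (nat \<Rightarrow> (nat \<Rightarrow> 'y1) \<Rightarrow> 'x1)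
   \<Rightarrow> ((nat \<Rightarrow> nat) \<Rightarrow> (nat \<Rightarrow> 's) \<Rightarrow> nat) \<Rightarrow> real" where
  "err_prob m pz W1 Wr n M enc f g =
    (1 / real M) * (\<Sum>w\<in>{1..M}.
       \<Sum>z\<in>PiE {0..<n} (\<lambda>_. {0..<m}).
       \<Sum>y1\<in>PiE {0..<n} (\<lambda>_. (UNIV::'y1 set)).
       \<Sum>s\<in>PiE {0..<n} (\<lambda>_. (UNIV::'s set)).
         (\<Prod>i<n. pz (z i) * W1 (z i) (y1 i) * Wr (f i y1) (s i)) *
         (if g (\<lambda>i\<in>{0..<n}. (enc w i + z i) mod m) s \<noteq> w then 1 else 0))"

definition num_msgs :: "nat \<Rightarrow> real \<Rightarrow> nat" where
  "num_msgs n R = nat \<lceil>2 powr (real n * R)\<rceil>"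

definition achievable ::
  "nat \<Rightarrow> (nat \<Rightarrow> real) \<Rightarrow> (nat \<Rightarrow> 'y1::finite \<Rightarrow> real) \<Rightarrow> ('x1 \<Rightarrow> 's::finite \<Rightarrow> real)
   \<Rightarrow> real \<Rightarrow> bool" where
  "achievable m pz W1 Wr R \<longleftrightarrow>
     (\<exists>(enc :: nat \<Rightarrow> nat \<Rightarrow> nat \<Rightarrow> nat) (f :: nat \<Rightarrow> nat \<Rightarrow> (nat \<Rightarrow> 'y1) \<Rightarrow> 'x1)
        (g :: nat \<Rightarrow> (nat \<Rightarrow> nat) \<Rightarrow> (nat \<Rightarrow> 's) \<Rightarrow> nat).
        (\<forall>n w i. 1 \<le> w \<and> w \<le> num_msgs n R \<and> i < n \<longrightarrow> enc n w i < m) \<and>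
        (\<forall>n i y y'. (\<forall>j<i. y j = y' j) \<longrightarrow> f n i y = f n i y') \<and>
        (\<lambda>n. err_prob m pz W1 Wr n (num_msgs n R) (enc n) (f n) (g n)) \<longlonglongrightarrow> 0)"

definition capacity ::
  "nat \<Rightarrow> (nat \<Rightarrow> real) \<Rightarrow> (nat \<Rightarrow> 'y1::finite \<Rightarrow> real) \<Rightarrow> ('x1::finite \<Rightarrow> 's::finite \<Rightarrow> real)
   \<Rightarrow> real" where
  "capacity m pz W1 Wr = Sup {R. achievable m pz W1 Wr R}"

end

theory Submission
  imports Defs "HOL-Analysis.Analysis"
begin

text \<open>
  \<^bold>\<open>Converse.\<close> Fano's inequality bounds the rate by \<open>log m - H(Z\<^sup>n | S\<^sup>n) / n\<close>, and \<open>I(Y\<^sub>1\<^sup>n; S\<^sup>n) \<le> n R\<^sub>0\<close>. Peeling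
  off coordinates one at a time shows that \<open>(p(y\<^sub>1), H(Y\<^sub>1\<^sup>n | S\<^sup>n) / n)\<close> together with some number below
  \<open>H(Z\<^sup>n | S\<^sup>n) / n\<close> is a point of the convex hull of the compact set of all \<open>(v, H(v), H(K v))\<close>, where \<open>v\<close> is a
  law on the relay alphabet and \<open>K\<close> is the backward channel \<open>p(z | y\<^sub>1)\<close>. Compactness gives an optimal point,
  and Caratheodory's theorem in a hyperplane represents it by an auxiliary variable with \<open>|Y\<^sub>1| + 2\<close> values.

  \<^bold>\<open>Achievability.\<close> If \<open>I(U; Y\<^sub>1) < R\<^sub>0\<close>, the relay quantises a block of \<open>Y\<^sub>1\<close> under logarithmic loss for \<open>Z\<close> and
  sends the index through its channel in the next block, so that the receiver can predict the block of \<open>Z\<close>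
  with loss about \<open>H(Z | U)\<close> per letter. Treating blocks as letters of a memoryless channel with additive
  noise, a Feinstein-type code of rate \<open>log m - H(Z | U)\<close> exists. The boundary case \<open>I(U; Y\<^sub>1) = R\<^sub>0\<close> follows
  by erasing \<open>U\<close> with small probability, or by data processing if \<open>R\<^sub>0 = 0\<close>.
\<close>

section \<open>Entropy of finite weights\<close>

text \<open>The source input influences neither the relay nor its output. The destination therefore
  sees \<open>Z^n\<close> shifted by a codeword, with side information \<open>S^n\<close> about
  \<open>Z^n\<close>, and the whole problem is how well \<open>S^n\<close> can describe the noise.
  The maximum ranges over auxiliary alphabets of every size, a family without evident compactness.
  Recording only the triples (law of \<open>Y1\<close>, \<open>H(Y1 | U)\<close>,
  \<open>H(Z | U)\<close>) puts all alphabets into one convex hull, and the maximiser, the bound on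
  its alphabet and the converse are all read off from this set. Since \<open>hent\<close> is
  homogeneous, contributions of different values of \<open>U\<close> add up without division by
  probabilities. The third coordinate is only bounded because peeling conditions on letters of
  \<open>Y1\<close>, and a letter of \<open>Y1\<close> screens off the corresponding letter of
  \<open>Z\<close>. On the coding side the predicted loss of a long word is a sum of independent
  block losses, so one Chernoff bound does the work of joint typicality. The relay describes and
  transmits separately, which needs an index rate strictly between \<open>I(U; Y1)\<close> and
  \<open>R0\<close>; this is why equality is treated apart.\<close>

abbreviation seqs :: "nat \<Rightarrow> 'a set \<Rightarrow> (nat \<Rightarrow> 'a) set" where
  "seqs n A \<equiv> PiE {0..<n} (\<lambda>_. A)"

text \<open>The degree-one homogeneous extension of entropy: \<open>hent p A = T * ent (p / T) A\<close> with
  \<open>T = sum p A\<close>. A conditional entropy \<open>H(A | B)\<close> is the sum over \<open>b\<close> of \<open>hent\<close> of the unnormalised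
  joint laws \<open>p (\<cdot>, b)\<close>, so no conditional distributions are needed.\<close>
definition hent :: "('a \<Rightarrow> real) \<Rightarrow> 'a set \<Rightarrow> real" where
  "hent p A = plogp (sum p A) - (\<Sum>a\<in>A. plogp (p a))"

lemma plogp_eq: "plogp x = x * log 2 x"
  by (simp add: plogp_def)

text \<open>Summation of \<open>ln t \<le> t - 1\<close> at \<open>t = q a / p a\<close>. Only the
  total masses are compared, so unnormalised weights are allowed. The entropy inequalities of the
  converse all go back to this one.\<close>

lemma gibbs_inequality:
  fixes p q :: "'a \<Rightarrow> real"
  assumes "finite A" and p: "\<And>a. a \<in> A \<Longrightarrow> 0 \<le> p a" and q: "\<And>a. a \<in> A \<Longrightarrow> 0 \<le> q a"
    and pq: "\<And>a. a \<in> A \<Longrightarrow> 0 < p a \<Longrightarrow> 0 < q a" and le: "sum q A \<le> sum p A"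
  shows "(\<Sum>a\<in>A. p a * log 2 (q a)) \<le> (\<Sum>a\<in>A. p a * log 2 (p a))"
proof -
  have *: "p a * log 2 (q a) - p a * log 2 (p a) \<le> (q a - p a) / ln 2" if a: "a \<in> A" for a
  proof (cases "p a = 0")
    case True
    then show ?thesis using q[OF a] by simp
  next
    case False
    with p[OF a] have pp: "0 < p a" by simp
    with pq[OF a] have qq: "0 < q a" by simp
    have "ln (q a / p a) \<le> q a / p a - 1"
      by (rule ln_le_minus_one) (use pp qq in simp)
    then have "p a * ln (q a / p a) \<le> p a * (q a / p a - 1)"
      using pp by simp
    also have "... = q a - p a" using pp by (simp add: field_simps)
    finally have "p a * (ln (q a) - ln (p a)) / ln 2 \<le> (q a - p a) / ln 2"
      using pp qq by (simp add: ln_div divide_right_mono)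
    then show ?thesis
      by (simp add: log_def right_diff_distrib diff_divide_distrib)
  qed
  have "(\<Sum>a\<in>A. p a * log 2 (q a) - p a * log 2 (p a)) \<le> (\<Sum>a\<in>A. (q a - p a) / ln 2)"
    by (rule sum_mono) (rule *)
  also have "... = (sum q A - sum p A) / ln 2"
    by (simp add: sum_subtractf flip: sum_divide_distrib)
  also have "... \<le> 0" using le by (simp add: divide_le_0_iff)
  finally show ?thesis by (simp add: sum_subtractf)
qed

lemma mult_log_divide:
  fixes x t :: real
  assumes "0 \<le> x" "0 < x \<Longrightarrow> 0 < t"
  shows "x * log 2 (x / t) = x * log 2 x - x * log 2 t"
  using assms by (cases "x = 0") (auto simp: log_divide right_diff_distrib)

text \<open>Gibbs' inequality for \<open>x\<close> against \<open>t\<close> rescaled by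
  \<open>c\<close> to the total mass of \<open>x\<close>.\<close>

lemma log_sum_inequality:
  fixes x t :: "'a \<Rightarrow> real"
  assumes fin: "finite J" and x: "\<And>j. j \<in> J \<Longrightarrow> 0 \<le> x j" and t: "\<And>j. j \<in> J \<Longrightarrow> 0 \<le> t j"
    and xt: "\<And>j. j \<in> J \<Longrightarrow> 0 < x j \<Longrightarrow> 0 < t j"
  shows "sum x J * log 2 (sum x J / sum t J) \<le> (\<Sum>j\<in>J. x j * log 2 (x j / t j))"
proof (cases "sum x J = 0")
  case True
  then have "\<forall>j\<in>J. x j = 0" using fin x by (simp add: sum_nonneg_eq_0_iff)
  with True show ?thesis by simp
next
  case False
  with sum_nonneg[of J x] x have X: "0 < sum x J" by fastforce
  then obtain j0 where j0: "j0 \<in> J" "0 < x j0"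
    using x by (metis less_eq_real_def sum_nonpos not_less)
  have T: "0 < sum t J"
    using fin j0 xt t by (meson sum_pos2)
  define c where "c = sum x J / sum t J"
  have c: "0 < c" using X T by (simp add: c_def)
  have "(\<Sum>j\<in>J. x j * log 2 (t j * c)) \<le> (\<Sum>j\<in>J. x j * log 2 (x j))"
  proof (rule gibbs_inequality[OF fin])
    have "(\<Sum>j\<in>J. t j * c) = sum t J * c" by (simp add: sum_distrib_right)
    also have "... = sum x J" using T by (simp add: c_def)
    finally show "(\<Sum>j\<in>J. t j * c) \<le> sum x J" by simp
  qed (use x t xt c in auto)
  moreover have "x j * log 2 (t j * c) = x j * log 2 c + x j * log 2 (t j)" if "j \<in> J" for j
    using x[OF that] xt[OF that] c by (cases "x j = 0") (auto simp: log_mult algebra_simps)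
  ultimately have "(\<Sum>j\<in>J. x j * log 2 c) \<le> (\<Sum>j\<in>J. x j * log 2 (x j) - x j * log 2 (t j))"
    by (simp add: sum_subtractf sum.distrib)
  also have "... = (\<Sum>j\<in>J. x j * log 2 (x j / t j))"
    by (intro sum.cong refl) (simp add: mult_log_divide x xt)
  finally show ?thesis by (simp add: c_def sum_distrib_right)
qed

text \<open>Conditioning reduces entropy, with \<open>j\<close> as the value conditioned on. For
  each letter \<open>a\<close> the log-sum inequality over \<open>j\<close> compares
  \<open>p j a\<close> with the total mass of \<open>p j\<close>.\<close>

lemma hent_superadditive:
  fixes p :: "'j \<Rightarrow> 'a \<Rightarrow> real"
  assumes J: "finite J" and A: "finite A" and p: "\<And>j a. j \<in> J \<Longrightarrow> a \<in> A \<Longrightarrow> 0 \<le> p j a"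
  shows "(\<Sum>j\<in>J. hent (p j) A) \<le> hent (\<lambda>a. \<Sum>j\<in>J. p j a) A"
proof -
  define T where "T j = sum (p j) A" for j
  have T: "0 < T j" if "j \<in> J" "a \<in> A" "0 < p j a" for j a
    unfolding T_def using that A p by (meson sum_pos2)
  have T0: "0 \<le> T j" if "j \<in> J" for j
    unfolding T_def using that p by (simp add: sum_nonneg)
  have P0: "0 \<le> (\<Sum>j\<in>J. p j a)" if "a \<in> A" for a
    using p that by (simp add: sum_nonneg)
  have PT: "0 < sum T J" if a: "a \<in> A" and pos: "0 < (\<Sum>j\<in>J. p j a)" for a
  proof -
    obtain j where "j \<in> J" "0 < p j a"
      using pos by (metis not_less sum_nonpos)
    then show ?thesis using T[of j a] a T0 J by (meson sum_pos2)
  qed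
  have "(\<Sum>j\<in>J. p j a) * log 2 ((\<Sum>j\<in>J. p j a) / sum T J) \<le> (\<Sum>j\<in>J. p j a * log 2 (p j a / T j))"
    if "a \<in> A" for a
    by (rule log_sum_inequality[OF J]) (use that p T T0 in auto)
  then have "(\<Sum>a\<in>A. (\<Sum>j\<in>J. p j a) * log 2 ((\<Sum>j\<in>J. p j a) / sum T J))
      \<le> (\<Sum>a\<in>A. \<Sum>j\<in>J. p j a * log 2 (p j a / T j))"
    by (rule sum_mono)
  also have "... = (\<Sum>a\<in>A. \<Sum>j\<in>J. p j a * log 2 (p j a) - p j a * log 2 (T j))"
    by (intro sum.cong refl mult_log_divide) (use p T in auto)
  also have "... = (\<Sum>j\<in>J. \<Sum>a\<in>A. p j a * log 2 (p j a) - p j a * log 2 (T j))"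
    by (rule sum.swap)
  also have "... = - (\<Sum>j\<in>J. hent (p j) A)"
    by (simp add: hent_def plogp_eq sum_subtractf T_def sum_distrib_right)
  finally have 1: "(\<Sum>a\<in>A. (\<Sum>j\<in>J. p j a) * log 2 ((\<Sum>j\<in>J. p j a) / sum T J))
      \<le> - (\<Sum>j\<in>J. hent (p j) A)" .
  have "(\<Sum>a\<in>A. (\<Sum>j\<in>J. p j a) * log 2 ((\<Sum>j\<in>J. p j a) / sum T J))
     = (\<Sum>a\<in>A. (\<Sum>j\<in>J. p j a) * log 2 (\<Sum>j\<in>J. p j a) - (\<Sum>j\<in>J. p j a) * log 2 (sum T J))"
    by (intro sum.cong refl mult_log_divide) (use P0 PT in auto)
  also have "... = - hent (\<lambda>a. \<Sum>j\<in>J. p j a) A"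
  proof -
    have "(\<Sum>a\<in>A. \<Sum>j\<in>J. p j a) = sum T J"
      unfolding T_def by (rule sum.swap)
    then show ?thesis
      by (simp add: hent_def plogp_eq sum_subtractf flip: sum_distrib_right)
  qed
  finally show ?thesis using 1 by simp
qed

lemma hent_scale:
  assumes "0 \<le> c" "\<And>a. a \<in> A \<Longrightarrow> 0 \<le> p a"
  shows "hent (\<lambda>a. c * p a) A = c * hent p A"
proof -
  have *: "plogp (c * x) = c * plogp x + x * plogp c" if "0 \<le> x" for x
    using assms(1) that
    by (cases "c = 0"; cases "x = 0") (auto simp: plogp_eq log_mult algebra_simps)
  have "0 \<le> sum p A" using assms(2) by (simp add: sum_nonneg)
  then have "hent (\<lambda>a. c * p a) A
      = c * plogp (sum p A) + sum p A * plogp c - (\<Sum>a\<in>A. c * plogp (p a) + p a * plogp c)"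
    unfolding hent_def sum_distrib_left[symmetric]
    using assms(2) by (simp add: *)
  also have "... = c * hent p A"
    by (simp add: hent_def sum.distrib right_diff_distrib sum_distrib_left sum_distrib_right)
  finally show ?thesis .
qed

lemma hent_zero [simp]: "hent (\<lambda>a. 0) A = 0"
  by (simp add: hent_def plogp_eq)

lemma hent_pmf: "is_pmf_on p A \<Longrightarrow> hent p A = ent p A"
  by (simp add: hent_def ent_def is_pmf_on_def plogp_eq)

lemma hent_chain:
  assumes "finite A" "finite B"
  shows "hent p (A \<times> B) = hent (\<lambda>a. \<Sum>b\<in>B. p (a, b)) A + (\<Sum>a\<in>A. hent (\<lambda>b. p (a, b)) B)"
  using assms by (simp add: hent_def sum_subtractf sum.cartesian_product' )

lemma hent_cong: "(\<And>a. a \<in> A \<Longrightarrow> p a = q a) \<Longrightarrow> hent p A = hent q A"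
  by (simp add: hent_def)

lemma hent_reindex: "inj_on f A \<Longrightarrow> hent p (f ` A) = hent (\<lambda>a. p (f a)) A"
  by (simp add: hent_def sum.reindex comp_def)

text \<open>Every junk value \<open>log 2 0\<close> is multiplied by \<open>0\<close> here.\<close>
lemma mutual_info_eq:
  fixes p :: "'a \<Rightarrow> real" and W :: "'a \<Rightarrow> 'b \<Rightarrow> real"
  assumes "finite A" "finite B" and p: "\<And>a. a \<in> A \<Longrightarrow> 0 \<le> p a"
    and W: "\<And>a. a \<in> A \<Longrightarrow> is_pmf_on (W a) B"
  defines "q \<equiv> \<lambda>b. \<Sum>a\<in>A. p a * W a b"
  shows "mutual_info p W A B = (\<Sum>a\<in>A. \<Sum>b\<in>B. p a * W a b * (log 2 (W a b) - log 2 (q b)))"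
proof -
  have W0: "0 \<le> W a b" "sum (W a) B = 1" if "a \<in> A" "b \<in> B" for a b
    using W that by (auto simp: is_pmf_on_def)
  have W1: "sum (W a) B = 1" if "a \<in> A" for a
    using W that by (auto simp: is_pmf_on_def)
  have pw: "plogp (p a * W a b) = p a * W a b * log 2 (W a b) + p a * log 2 (p a) * W a b"
    if "a \<in> A" "b \<in> B" for a b
    using p[of a] W0[OF that] that
    by (cases "p a = 0"; cases "W a b = 0") (auto simp: plogp_eq log_mult algebra_simps)
  have "ent (\<lambda>(a,b). p a * W a b) (A \<times> B) = - (\<Sum>a\<in>A. \<Sum>b\<in>B. plogp (p a * W a b))"
    unfolding ent_def by (simp add: sum.cartesian_product')
  also have "... = - (\<Sum>a\<in>A. \<Sum>b\<in>B. p a * W a b * log 2 (W a b) + p a * log 2 (p a) * W a b)"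
    using pw by simp
  also have "... = - (\<Sum>a\<in>A. \<Sum>b\<in>B. p a * W a b * log 2 (W a b)) - (\<Sum>a\<in>A. p a * log 2 (p a) * sum (W a) B)"
    by (simp add: sum.distrib sum_distrib_left)
  also have "... = - (\<Sum>a\<in>A. \<Sum>b\<in>B. p a * W a b * log 2 (W a b)) + ent p A"
    using W1 by (simp add: ent_def plogp_eq)
  finally have 1: "ent (\<lambda>(a,b). p a * W a b) (A \<times> B)
     = - (\<Sum>a\<in>A. \<Sum>b\<in>B. p a * W a b * log 2 (W a b)) + ent p A" .
  have "ent q B = - (\<Sum>b\<in>B. \<Sum>a\<in>A. p a * W a b * log 2 (q b))"
    unfolding ent_def plogp_eq q_def by (simp add: sum_distrib_right)
  also have "(\<Sum>b\<in>B. \<Sum>a\<in>A. p a * W a b * log 2 (q b)) = (\<Sum>a\<in>A. \<Sum>b\<in>B. p a * W a b * log 2 (q b))"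
    by (rule sum.swap)
  finally show ?thesis unfolding mutual_info_def using 1
    by (simp add: q_def right_diff_distrib sum_subtractf)
qed

lemma mutual_info_hent:
  assumes "finite A" "finite B"
  shows "mutual_info p W A B = ent p A - (\<Sum>b\<in>B. hent (\<lambda>a. p a * W a b) A)"
proof -
  have "(\<Sum>(a,b)\<in>A \<times> B. plogp (p a * W a b)) = (\<Sum>a\<in>A. \<Sum>b\<in>B. plogp (p a * W a b))"
    by (simp add: sum.cartesian_product')
  also have "... = (\<Sum>b\<in>B. \<Sum>a\<in>A. plogp (p a * W a b))" by (rule sum.swap)
  finally show ?thesis
    unfolding mutual_info_def hent_def ent_def
    by (simp add: sum_subtractf split_def)
qed

section \<open>Products over sequence spaces\<close>

lemma log_prod:
  fixes f :: "'i \<Rightarrow> real"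
  assumes "finite I" "\<And>i. i \<in> I \<Longrightarrow> 0 < f i"
  shows "log 2 (prod f I) = (\<Sum>i\<in>I. log 2 (f i))"
  using assms by (simp add: log_def ln_prod sum_divide_distrib less_imp_neq[symmetric])

lemma sum_PiE_prod_eq_1:
  fixes g :: "'i \<Rightarrow> 'a \<Rightarrow> real"
  assumes "finite I" "\<And>i. i \<in> I \<Longrightarrow> sum (g i) A = 1" "finite A"
  shows "(\<Sum>x\<in>PiE I (\<lambda>_. A). \<Prod>i\<in>I. g i (x i)) = 1"
proof -
  have "(\<Prod>i\<in>I. sum (g i) A) = (\<Sum>x\<in>PiE I (\<lambda>_. A). \<Prod>i\<in>I. g i (x i))"
    using assms by (intro prod_sum_PiE) auto
  then show ?thesis using assms by simp
qed

lemma sum_PiE_prod_marginal: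
  fixes g :: "'i \<Rightarrow> 'a \<Rightarrow> real"
  assumes I: "finite I" "\<And>i. i \<in> I \<Longrightarrow> sum (g i) A = 1" "finite A" and j: "j \<in> I"
  shows "(\<Sum>x\<in>PiE I (\<lambda>_. A). (\<Prod>i\<in>I. g i (x i)) * h (x j)) = (\<Sum>a\<in>A. g j a * h a)"
proof -
  \<comment> \<open>Absorbing \<open>h\<close> into factor \<open>j\<close> keeps the summand a
    product, so the sum over words still factorises.\<close>
  define g' where "g' i a = g i a * (if i = j then h a else 1)" for i a
  have "(\<Prod>i\<in>I. g i (x i)) * h (x j) = (\<Prod>i\<in>I. g' i (x i))" for x
    using I(1) j by (simp add: g'_def prod.distrib prod.delta)
  then have "(\<Sum>x\<in>PiE I (\<lambda>_. A). (\<Prod>i\<in>I. g i (x i)) * h (x j))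
      = (\<Sum>x\<in>PiE I (\<lambda>_. A). \<Prod>i\<in>I. g' i (x i))" by simp
  also have "... = (\<Prod>i\<in>I. sum (g' i) A)"
    using I by (intro prod_sum_PiE[symmetric]) auto
  also have "... = (\<Prod>i\<in>I. if i = j then (\<Sum>a\<in>A. g j a * h a) else 1)"
    by (intro prod.cong refl) (use I in \<open>auto simp: g'_def\<close>)
  also have "... = (\<Sum>a\<in>A. g j a * h a)" using I(1) j by (simp add: prod.delta)
  finally show ?thesis .
qed

lemma sum_PiE_prod_additive:
  fixes g :: "'i \<Rightarrow> 'a \<Rightarrow> real"
  assumes I: "finite I" "\<And>i. i \<in> I \<Longrightarrow> sum (g i) A = 1" "finite A"
  shows "(\<Sum>x\<in>PiE I (\<lambda>_. A). (\<Prod>i\<in>I. g i (x i)) * (\<Sum>j\<in>I. h j (x j)))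
     = (\<Sum>j\<in>I. \<Sum>a\<in>A. g j a * h j a)"
proof -
  have "(\<Sum>x\<in>PiE I (\<lambda>_. A). (\<Prod>i\<in>I. g i (x i)) * (\<Sum>j\<in>I. h j (x j)))
     = (\<Sum>j\<in>I. \<Sum>x\<in>PiE I (\<lambda>_. A). (\<Prod>i\<in>I. g i (x i)) * h j (x j))"
    unfolding sum_distrib_left by (rule sum.swap)
  also have "... = (\<Sum>j\<in>I. \<Sum>a\<in>A. g j a * h j a)"
    by (intro sum.cong refl sum_PiE_prod_marginal) (use I in auto)
  finally show ?thesis .
qed

lemma sum_PiE_insert:
  assumes "i \<notin> I"
  shows "(\<Sum>x\<in>PiE (insert i I) (\<lambda>_. A). F x) = (\<Sum>a\<in>A. \<Sum>x\<in>PiE I (\<lambda>_. A). F (x(i := a)))"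
proof -
  have "inj_on (\<lambda>(a, x). x(i := a)) (A \<times> PiE I (\<lambda>_. A))"
    using inj_combinator[OF assms, of "\<lambda>_. A"] by simp
  then show ?thesis
    by (simp add: PiE_insert_eq sum.reindex split_def sum.cartesian_product' comp_def)
qed

section \<open>Bounds on the capacity \<open>R0\<close> of the relay channel\<close>

lemma mutual_info_le_cards:
  fixes Wr :: "'x1::finite \<Rightarrow> 's::finite \<Rightarrow> real"
  assumes p: "is_pmf_on p UNIV" and W: "\<And>x. is_pmf_on (Wr x) UNIV"
  shows "mutual_info p Wr UNIV UNIV \<le> real (CARD('x1)) + real (CARD('s))"
proof -
  have lb: "- plogp x \<le> 1" if "0 \<le> x" for x
  proof (cases "x = 0")
    case False
    with that have x: "0 < x" by simp
    \<comment> \<open>The argument \<open>1 / (2 * x)\<close> leaves the constant 1/2, which lies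
      below \<open>ln 2\<close>; with \<open>1 / x\<close> the constant would be 1, which is too
      large.\<close>
    have "ln (1 / (2 * x)) \<le> 1 / (2 * x) - 1" using x by (intro ln_le_minus_one) auto
    then have "x * (- ln 2 - ln x) \<le> x * (1 / (2 * x) - 1)"
      using x by (intro mult_left_mono) (auto simp: ln_div ln_mult)
    also have "... = 1/2 - x" using x by (simp add: field_simps)
    finally have "- (x * ln x) \<le> 1/2 - x * (1 - ln 2)" by (simp add: algebra_simps)
    also have "... \<le> 1/2" using x ln_2_less_1 by simp
    also have "... \<le> ln 2" using ln2_ge_two_thirds by simp
    finally show ?thesis by (simp add: plogp_eq log_def field_simps)
  qed (simp add: plogp_eq)
  have ub: "plogp x \<le> 0" if "0 \<le> x" "x \<le> 1" for x
    using that by (cases "x = 0") (auto simp: plogp_eq mult_le_0_iff)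
  have p0: "0 \<le> p x" "sum p UNIV = 1" and W0: "0 \<le> Wr x s" "sum (Wr x) UNIV = 1" for x s
    using p W by (auto simp: is_pmf_on_def)
  have p1: "p x \<le> 1" for x
    using member_le_sum[of x UNIV p] p0 by simp
  have W1: "Wr x s \<le> 1" for x s
    using member_le_sum[of s UNIV "Wr x"] W0 by simp
  have "ent p UNIV \<le> (\<Sum>x::'x1\<in>UNIV. 1)"
    unfolding ent_def sum_negf[symmetric] by (intro sum_mono lb p0)
  moreover have "ent (\<lambda>b. \<Sum>a\<in>UNIV. p a * Wr a b) UNIV \<le> (\<Sum>x::'s\<in>UNIV. 1)"
    unfolding ent_def sum_negf[symmetric] by (intro sum_mono lb sum_nonneg) (simp add: p0 W0)
  moreover have "0 \<le> ent (\<lambda>(a,b). p a * Wr a b) (UNIV \<times> UNIV)"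
    unfolding ent_def sum_negf[symmetric]
    by (intro sum_nonneg) (use p0 W0 p1 W1 in \<open>auto intro!: ub mult_le_one\<close>)
  ultimately show ?thesis unfolding mutual_info_def by simp
qed

text \<open>The crude bound by cardinalities makes the set under \<open>Sup\<close> bounded above,
  so that \<open>R0\<close> really is an upper bound.\<close>

lemma mutual_info_le_R0:
  fixes Wr :: "'x1::finite \<Rightarrow> 's::finite \<Rightarrow> real"
  assumes "is_pmf_on p UNIV" and "\<And>x. is_pmf_on (Wr x) UNIV"
  shows "mutual_info p Wr UNIV UNIV \<le> R0 Wr"
  unfolding R0_def
proof (rule cSup_upper)
  show "bdd_above {mutual_info p Wr UNIV UNIV | p. is_pmf_on p UNIV}"
    using mutual_info_le_cards[OF _ assms(2)] by (intro bdd_aboveI) auto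
qed (use assms in auto)

text \<open>A point mass on one input has mutual information 0.\<close>

lemma R0_nonneg:
  fixes Wr :: "'x1::finite \<Rightarrow> 's::finite \<Rightarrow> real"
  assumes "\<And>x. is_pmf_on (Wr x) UNIV"
  shows "0 \<le> R0 Wr"
proof -
  define x0 :: 'x1 where "x0 = undefined"
  define p where "p x = (if x = x0 then 1 else 0 :: real)" for x
  have p: "is_pmf_on p UNIV" by (auto simp: is_pmf_on_def p_def)
  have q: "(\<Sum>a\<in>UNIV. p a * Wr a b) = Wr x0 b" for b
    by (simp add: p_def if_distrib[of "\<lambda>x. x * _"] cong: if_cong)
  have "mutual_info p Wr UNIV UNIV = 0"
    using p assms by (subst mutual_info_eq, unfold q)
      (auto simp: is_pmf_on_def p_def intro!: sum.neutral split: if_splits)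
  then show ?thesis using mutual_info_le_R0[of p Wr, OF p] assms by simp
qed


section \<open>The relay model and its backward channel\<close>

locale modsum_relay =
  fixes m :: nat and pz :: "nat \<Rightarrow> real"
    and W1 :: "nat \<Rightarrow> 'y1::finite \<Rightarrow> real" and Wr :: "'x1::finite \<Rightarrow> 's::finite \<Rightarrow> real"
  assumes m_ge_2: "2 \<le> m" and pz_pmf: "is_pmf_on pz {0..<m}"
    and W1_pmf: "\<And>z. z < m \<Longrightarrow> is_pmf_on (W1 z) UNIV" and Wr_pmf: "\<And>x. is_pmf_on (Wr x) UNIV"
begin

abbreviation pY :: "'y1 \<Rightarrow> real" where "pY \<equiv> pY1 m pz W1"

text \<open>The backward channel \<open>p(z | y\<^sub>1)\<close>, uniform where \<open>p(y\<^sub>1) = 0\<close> so that it is always stochastic.\<close>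
definition K :: "nat \<Rightarrow> 'y1 \<Rightarrow> real" where
  "K z y = (if pY y = 0 then 1 / real m else pz z * W1 z y / pY y)"

text \<open>Push-forward of a weight on the relay alphabet through the backward channel. Being
  linear in \<open>v\<close>, it also acts on the unnormalised laws \<open>p(y1, u)\<close> with
  \<open>u\<close> fixed.\<close>

definition KK :: "('y1 \<Rightarrow> real) \<Rightarrow> nat \<Rightarrow> real" where
  "KK v z = (\<Sum>y\<in>UNIV. K z y * v y)"

lemma pz_nonneg: "z < m \<Longrightarrow> 0 \<le> pz z" and pz_sum: "sum pz {0..<m} = 1"
  using pz_pmf by (auto simp: is_pmf_on_def)

lemma W1_nonneg: "z < m \<Longrightarrow> 0 \<le> W1 z y" and W1_sum: "z < m \<Longrightarrow> sum (W1 z) UNIV = 1"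
  using W1_pmf by (auto simp: is_pmf_on_def)

lemma Wr_nonneg: "0 \<le> Wr x s" and Wr_sum: "sum (Wr x) UNIV = 1"
  using Wr_pmf by (auto simp: is_pmf_on_def)

lemma pY_nonneg: "0 \<le> pY y"
  unfolding pY1_def by (intro sum_nonneg mult_nonneg_nonneg) (auto simp: pz_nonneg W1_nonneg)

lemma pY_sum: "sum pY UNIV = 1"
proof -
  have "sum pY UNIV = (\<Sum>z<m. \<Sum>y\<in>UNIV. pz z * W1 z y)"
    unfolding pY1_def by (rule sum.swap)
  also have "... = (\<Sum>z<m. pz z)"
    by (simp add: W1_sum flip: sum_distrib_left)
  finally show ?thesis using pz_sum by (simp add: lessThan_atLeast0)
qed

lemma pY_pmf: "is_pmf_on pY UNIV"
  by (simp add: is_pmf_on_def pY_nonneg pY_sum)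

lemma K_nonneg: "z < m \<Longrightarrow> 0 \<le> K z y"
  by (simp add: K_def pz_nonneg W1_nonneg pY_nonneg)

lemma K_sum: "(\<Sum>z\<in>{0..<m}. K z y) = 1"
proof (cases "pY y = 0")
  case True
  then show ?thesis using m_ge_2 by (simp add: K_def)
next
  case False
  then have "(\<Sum>z\<in>{0..<m}. K z y) = (\<Sum>z\<in>{0..<m}. pz z * W1 z y) / pY y"
    by (simp add: K_def sum_divide_distrib)
  then show ?thesis using False by (simp add: pY1_def lessThan_atLeast0)
qed

text \<open>Bayes' rule. Where \<open>pY y = 0\<close> both sides vanish, because
  \<open>pY y\<close> is a sum of the nonnegative terms \<open>pz z * W1 z y\<close>.\<close>

lemma pY_mult_K: "z < m \<Longrightarrow> pY y * K z y = pz z * W1 z y"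
proof (cases "pY y = 0")
  case True
  assume z: "z < m"
  have "\<forall>z\<in>{..<m}. pz z * W1 z y = 0"
    using True unfolding pY1_def
    by (subst (asm) sum_nonneg_eq_0_iff) (auto simp: pz_nonneg W1_nonneg)
  then show ?thesis using True z by simp
qed (simp add: K_def)

lemma KK_nonneg: "z < m \<Longrightarrow> (\<And>y. 0 \<le> v y) \<Longrightarrow> 0 \<le> KK v z"
  unfolding KK_def by (intro sum_nonneg mult_nonneg_nonneg K_nonneg)

lemma KK_sum: "sum (KK v) {0..<m} = sum v UNIV"
proof -
  have "sum (KK v) {0..<m} = (\<Sum>y\<in>UNIV. \<Sum>z\<in>{0..<m}. K z y * v y)"
    unfolding KK_def by (rule sum.swap)
  then show ?thesis by (simp add: K_sum flip: sum_distrib_right)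
qed

lemma KK_scale: "KK (\<lambda>y. c * v y) z = c * KK v z"
  by (simp add: KK_def sum_distrib_left mult_ac)

lemma pZU_eq: "z < m \<Longrightarrow> pZU pz W1 Q (z, u) = KK (\<lambda>y. pY y * Q y u) z"
  unfolding pZU_def KK_def
  by (auto intro!: sum.cong simp flip: pY_mult_K)

text \<open>The form \<open>H(Y1) - H(Y1 | U)\<close>: the rate constraint becomes a lower bound on
  a quantity that is additive over the values \<open>u\<close>.\<close>

lemma I_UY1_hent:
  "I_UY1 m pz W1 k Q = ent pY UNIV - (\<Sum>u\<in>{0..<k}. hent (\<lambda>y. pY y * Q y u) UNIV)"
  unfolding I_UY1_def by (rule mutual_info_hent) auto

lemma H_Z_given_U_hent:
  "H_Z_given_U m pz W1 k Q = (\<Sum>u\<in>{0..<k}. hent (KK (\<lambda>y. pY y * Q y u)) {0..<m})"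
proof -
  have "ent (pZU pz W1 Q) ({0..<m} \<times> {0..<k}) = - (\<Sum>z\<in>{0..<m}. \<Sum>u\<in>{0..<k}. plogp (pZU pz W1 Q (z,u)))"
    by (simp add: ent_def sum.cartesian_product')
  also have "... = - (\<Sum>u\<in>{0..<k}. \<Sum>z\<in>{0..<m}. plogp (pZU pz W1 Q (z,u)))"
    by (subst sum.swap) simp
  finally show ?thesis
    unfolding H_Z_given_U_def hent_def ent_def
    by (simp add: sum_subtractf lessThan_atLeast0 pZU_eq)
qed

end

text \<open>Translation by \<open>c\<close> permutes the words over Z_m; the inverse adds
  \<open>m - c i mod m\<close>, where the inner \<open>mod\<close> prevents truncated subtraction.
  This symmetry gives the uniform output bound in Fano's inequality and the count of wrongly
  accepted codewords.\<close>

lemma sum_shift_mod: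
  assumes "0 < m"
  shows "(\<Sum>z\<in>PiE I (\<lambda>_. {0..<m}). F (\<lambda>i\<in>I. (c i + z i) mod m)) = (\<Sum>y\<in>PiE I (\<lambda>_. {0..<m::nat}). F y)"
proof (rule sum.reindex_bij_witness[where j = "\<lambda>z. \<lambda>i\<in>I. (c i + z i) mod m"
      and i = "\<lambda>y. \<lambda>i\<in>I. (y i + (m - c i mod m)) mod m"])
  have *: "(((a + b) mod m) + (m - a mod m)) mod m = b" if "b < m" for a b :: nat
  proof -
    have "(((a + b) mod m) + (m - a mod m)) mod m = (a mod m + b + (m - a mod m)) mod m"
      by (metis mod_add_left_eq)
    also have "a mod m + b + (m - a mod m) = b + m"
      using assms mod_less_divisor[of m a] by linarith
    finally show ?thesis using that by simp
  qed
  have **: "(a + (b + (m - a mod m)) mod m) mod m = b" if "b < m" for a b :: nat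
  proof -
    have "(a + (b + (m - a mod m)) mod m) mod m = (a mod m + (b + (m - a mod m))) mod m"
      by (metis mod_add_left_eq mod_add_right_eq)
    also have "a mod m + (b + (m - a mod m)) = b + m"
      using assms mod_less_divisor[of m a] by linarith
    finally show ?thesis using that by simp
  qed
  fix z assume z: "z \<in> PiE I (\<lambda>_. {0..<m})"
  then have zm: "z i < m" if "i \<in> I" for i using that by (auto simp: PiE_iff)
  have zu: "z i = undefined" if "i \<notin> I" for i using z that by (auto simp: PiE_iff extensional_def)
  show "(\<lambda>i\<in>I. ((\<lambda>i\<in>I. (c i + z i) mod m) i + (m - c i mod m)) mod m) = z"
    by (rule ext) (auto simp: * zm zu)
  show "(\<lambda>i\<in>I. (c i + (\<lambda>i\<in>I. (z i + (m - c i mod m)) mod m) i) mod m) = z"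
    by (rule ext) (auto simp: ** zm zu)
qed (use assms in auto)

section \<open>Single-letter region\<close>

text \<open>Prepares the compactness of \<open>region\<close>. The delicate point is 0, where
  \<open>ln_le_minus_one\<close> at \<open>1 / sqrt x\<close> bounds \<open>x * ln x\<close> in
  absolute value by \<open>2 * sqrt x\<close>.\<close>

lemma continuous_on_plogp: "continuous_on {0..} plogp"
proof -
  have 0: "((\<lambda>x. x * ln x) \<longlongrightarrow> 0) (at_right (0::real))"
  proof (rule Lim_null_comparison)
    show "((\<lambda>x. 2 * sqrt x) \<longlongrightarrow> 0) (at_right (0::real))"
      by (auto intro!: tendsto_eq_intros)
    have "norm (x * ln x) \<le> 2 * sqrt x" if "0 < x" "x < 1" for x :: real
    proof -
      have "ln (1 / sqrt x) \<le> 1 / sqrt x - 1" using that by (intro ln_le_minus_one) auto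
      then have "- ln x \<le> 2 / sqrt x - 2" using that by (simp add: ln_div ln_sqrt)
      then have "x * (- ln x) \<le> x * (2 / sqrt x)" using that by (intro mult_left_mono) auto
      also have "... = 2 * sqrt x" using that by (simp add: field_simps flip: power2_eq_square)
      finally show ?thesis using that by (simp add: abs_mult)
    qed
    then show "\<forall>\<^sub>F x in at_right 0. norm (x * ln x) \<le> 2 * sqrt (x::real)"
      unfolding eventually_at_right_field by (intro exI[of _ 1]) auto
  qed
  have "continuous_on {0..} (\<lambda>x::real. x * ln x)"
    unfolding continuous_on_def
  proof
    fix x :: real assume x: "x \<in> {0..}"
    show "((\<lambda>x. x * ln x) \<longlongrightarrow> x * ln x) (at x within {0..})"
    proof (cases "x = 0")
      case True
      have "{0..} - {0::real} = {0<..} - {0}" by auto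
      then have "at 0 within {0..} = at_right (0::real)" by (simp add: at_within_def)
      then show ?thesis using True 0 by simp
    next
      case False
      then show ?thesis using x by (auto intro!: tendsto_eq_intros)
    qed
  qed
  from continuous_on_mult[OF this continuous_on_const[of _ "inverse (ln 2)"]]
  show ?thesis by (simp add: plogp_eq[abs_def] log_def divide_inverse mult.assoc)
qed

text \<open>Normalise the weights and use convexity. If they add up to 0 then all of them vanish and
  any point of \<open>C\<close> will do, so later arguments can combine weights without asking
  whether they are positive.\<close>

lemma convex_cone_sum:
  fixes h :: "'i \<Rightarrow> 'v::real_vector"
  assumes C: "convex C" "C \<noteq> {}" and Y: "finite Y"
    and t: "\<And>y. y \<in> Y \<Longrightarrow> 0 \<le> t y" and h: "\<And>y. y \<in> Y \<Longrightarrow> h y \<in> C"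
  shows "\<exists>c\<in>C. (\<Sum>y\<in>Y. t y *\<^sub>R h y) = sum t Y *\<^sub>R c"
proof (cases "sum t Y = 0")
  case True
  then have "\<forall>y\<in>Y. t y = 0" using Y t by (simp add: sum_nonneg_eq_0_iff)
  then show ?thesis using True C(2) by auto
next
  case False
  have "(\<Sum>y\<in>Y. (t y / sum t Y) *\<^sub>R h y) \<in> C"
    by (rule convex_sum[OF Y C(1)])
      (use False t h in \<open>auto simp: sum_nonneg simp flip: sum_divide_distrib\<close>)
  moreover have "sum t Y *\<^sub>R (\<Sum>y\<in>Y. (t y / sum t Y) *\<^sub>R h y) = (\<Sum>y\<in>Y. t y *\<^sub>R h y)"
    using False by (simp add: scaleR_sum_right)
  ultimately show ?thesis by metis
qed

lemma hent_PiE_insert: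
  assumes "i \<notin> I" "finite I" "finite A"
  shows "hent a (PiE (insert i I) (\<lambda>_. A))
     = hent (\<lambda>y. \<Sum>x\<in>PiE I (\<lambda>_. A). a (x(i := y))) A
       + (\<Sum>y\<in>A. hent (\<lambda>x. a (x(i := y))) (PiE I (\<lambda>_. A)))"
proof -
  have "inj_on (\<lambda>(y, x). x(i := y)) (A \<times> PiE I (\<lambda>_. A))"
    using inj_combinator[OF assms(1), of "\<lambda>_. A"] by simp
  then have "hent a (PiE (insert i I) (\<lambda>_. A))
     = hent (\<lambda>yx. a (case yx of (y, x) \<Rightarrow> x(i := y))) (A \<times> PiE I (\<lambda>_. A))"
    by (simp add: PiE_insert_eq hent_reindex)
  also have "... = hent (\<lambda>y. \<Sum>x\<in>PiE I (\<lambda>_. A). a (x(i := y))) A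
       + (\<Sum>y\<in>A. hent (\<lambda>x. a (x(i := y))) (PiE I (\<lambda>_. A)))"
    using assms by (subst hent_chain) (auto simp: finite_PiE)
  finally show ?thesis .
qed

context modsum_relay
begin

text \<open>A point \<open>(p(y\<^sub>1), H(Y\<^sub>1 | U), H(Z | U))\<close> is realised by a finite auxiliary variable \<open>U\<close> iff it is a convex
  combination of the points \<open>psi v\<close>, where \<open>v\<close> plays the role of \<open>p(y\<^sub>1 | u)\<close>.\<close>
definition psi :: "('y1 \<Rightarrow> real) \<Rightarrow> (real ^ 'y1) \<times> real \<times> real" where
  "psi v = ((\<chi> y. v y), hent v UNIV, hent (KK v) {0..<m})"

definition region :: "((real ^ 'y1) \<times> real \<times> real) set" where
  "region = convex hull (psi ` {v. is_pmf_on v UNIV})"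

lemma psi_scale:
  assumes "0 \<le> c" "\<And>y. 0 \<le> v y"
  shows "psi (\<lambda>y. c * v y) = c *\<^sub>R psi v"
proof -
  have "KK (\<lambda>y. c * v y) = (\<lambda>z. c * KK v z)" by (rule ext) (rule KK_scale)
  moreover have "hent (\<lambda>z. c * KK v z) {0..<m} = c * hent (KK v) {0..<m}"
    by (rule hent_scale) (use assms KK_nonneg in auto)
  ultimately show ?thesis
    using assms by (auto simp: psi_def hent_scale vec_eq_iff)
qed

lemma convex_region: "convex region"
  by (simp add: region_def)

lemma region_nonempty: "region \<noteq> {}"
  using pY_pmf by (auto simp: region_def)

text \<open>By homogeneity \<open>psi v\<close> is the total mass times the image of the normalised
  weight; mass 0 forces \<open>v = 0\<close>.\<close>

lemma psi_cone:
  assumes v: "\<And>y. 0 \<le> v y"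
  shows "\<exists>h\<in>region. psi v = sum v UNIV *\<^sub>R h"
proof (cases "sum v UNIV = 0")
  case True
  then have "v = (\<lambda>y. 0 * pY y)" using v by (auto simp: sum_nonneg_eq_0_iff)
  then have "psi v = 0 *\<^sub>R psi pY" by (metis psi_scale order_refl pY_nonneg)
  then show ?thesis using True region_nonempty by auto
next
  case False
  define w where "w y = v y / sum v UNIV" for y
  have "0 \<le> sum v UNIV" using v by (simp add: sum_nonneg)
  with False have pos: "0 < sum v UNIV" by simp
  then have w: "is_pmf_on w UNIV"
    using v by (auto simp: is_pmf_on_def w_def simp flip: sum_divide_distrib)
  have "v = (\<lambda>y. sum v UNIV * w y)" using pos by (auto simp: w_def)
  then have "psi v = sum v UNIV *\<^sub>R psi w"
    using psi_scale[of "sum v UNIV" w] w pos by (simp add: is_pmf_on_def)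
  moreover have "psi w \<in> region"
    unfolding region_def by (rule hull_inc) (use w in auto)
  ultimately show ?thesis by auto
qed

text \<open>Single-letterisation: \<open>a\<close> is the law of \<open>Y\<^sub>1\<^sup>n\<close> jointly with a fixed \<open>s\<^sup>n\<close>, and peeling off one
  coordinate at a time corresponds to the auxiliary variables \<open>U\<^sub>i = (S\<^sup>n, Y\<^sub>1\<close> at the coordinates
  peeled off before\<open>)\<close>.\<close>
lemma region_single_letter:
  assumes "finite I" and "\<And>x. x \<in> PiE I (\<lambda>_. UNIV) \<Longrightarrow> 0 \<le> a x"
  shows "\<exists>c\<in>region. \<exists>g. g \<le> hent (\<lambda>z. \<Sum>x\<in>PiE I (\<lambda>_. UNIV). a x * (\<Prod>i\<in>I. K (z i) (x i))) (PiE I (\<lambda>_. {0..<m}))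
     \<and> (real (card I) * sum a (PiE I (\<lambda>_. UNIV))) *\<^sub>R c =
       ((\<chi> y. \<Sum>i\<in>I. \<Sum>x\<in>PiE I (\<lambda>_. UNIV). a x * of_bool (x i = y)), hent a (PiE I (\<lambda>_. UNIV)), g)"
  using assms
proof (induction I arbitrary: a rule: finite_induct)
  case empty
  obtain c where "c \<in> region" using region_nonempty by auto
  then show ?case
    by (intro bexI[of _ c] exI[of _ 0]) (auto simp: hent_def zero_prod_def vec_eq_iff)
next
  case (insert i J)
  let ?X = "PiE J (\<lambda>_. UNIV :: 'y1 set)" and ?Z = "PiE J (\<lambda>_. {0..<m})"
  \<comment> \<open>\<open>ay y\<close> is the law with \<open>y\<close> fixed at the new
    coordinate, \<open>T\<close> is the marginal of that coordinate, and \<open>b y\<close> and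
    \<open>bb\<close> are the noise laws belonging to \<open>ay y\<close> and \<open>a\<close>. The
    new coordinate contributes \<open>psi T\<close>, and each \<open>y\<close> contributes the
    induction hypothesis for \<open>ay y\<close>.\<close>
  define ay where "ay y x = a (x(i := y))" for y x
  define T where "T y = sum (ay y) ?X" for y
  define b where "b y z = (\<Sum>x\<in>?X. ay y x * (\<Prod>j\<in>J. K (z j) (x j)))" for y z
  define bb where "bb z = (\<Sum>x\<in>PiE (insert i J) (\<lambda>_. UNIV). a x * (\<Prod>i\<in>insert i J. K (z i) (x i)))" for z
  have fX: "finite ?X" "finite ?Z" using insert.hyps by (auto intro: finite_PiE)
  have ay0: "0 \<le> ay y x" if "x \<in> ?X" for y x
    unfolding ay_def by (rule insert.prems) (use that in \<open>auto simp: PiE_iff extensional_def\<close>)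
  have T0: "0 \<le> T y" for y unfolding T_def by (intro sum_nonneg ay0)
  have b0: "0 \<le> b y z" if "z \<in> ?Z" for y z
    unfolding b_def using that ay0
    by (intro sum_nonneg mult_nonneg_nonneg prod_nonneg K_nonneg) (auto simp: PiE_iff)
  have bsum: "sum (b y) ?Z = T y" for y
  proof -
    have "sum (b y) ?Z = (\<Sum>x\<in>?X. \<Sum>z\<in>?Z. ay y x * (\<Prod>j\<in>J. K (z j) (x j)))"
      unfolding b_def by (rule sum.swap)
    also have "... = (\<Sum>x\<in>?X. ay y x * (\<Sum>z\<in>?Z. (\<Prod>j\<in>J. K (z j) (x j))))"
      by (simp add: sum_distrib_left)
    also have "... = T y"
      using insert.hyps K_sum
      by (simp add: T_def sum_PiE_prod_eq_1[where g = "\<lambda>j z. K z (_ j)"])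
    finally show ?thesis .
  qed
  have asum: "sum a (PiE (insert i J) (\<lambda>_. UNIV)) = sum T UNIV"
    using insert.hyps by (simp add: sum_PiE_insert T_def ay_def)
  have bbins: "bb (z(i := z1)) = (\<Sum>y\<in>UNIV. K z1 y * b y z)" for z z1
  proof -
    have "bb (z(i := z1)) = (\<Sum>y\<in>UNIV. \<Sum>x\<in>?X. ay y x *
        (K z1 y * (\<Prod>j\<in>J. K ((z(i := z1)) j) ((x(i := y)) j))))"
      unfolding bb_def using insert.hyps by (simp add: sum_PiE_insert ay_def)
    also have "... = (\<Sum>y\<in>UNIV. \<Sum>x\<in>?X. ay y x * (K z1 y * (\<Prod>j\<in>J. K (z j) (x j))))"
      using insert.hyps by (intro sum.cong arg_cong2[where f = "(*)"] prod.cong refl) auto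
    also have "... = (\<Sum>y\<in>UNIV. K z1 y * b y z)"
      by (simp add: b_def sum_distrib_left mult_ac)
    finally show ?thesis .
  qed
  define P where "P y c g \<longleftrightarrow> c \<in> region \<and> g \<le> hent (b y) ?Z \<and> (real (card J) * T y) *\<^sub>R c =
       ((\<chi> y'. \<Sum>i\<in>J. \<Sum>x\<in>?X. ay y x * of_bool (x i = y')), hent (ay y) ?X, g)" for y c g
  have "\<exists>c g. P y c g" for y
    using insert.IH[of "ay y"] ay0[of _ y] unfolding P_def b_def[abs_def] T_def by fast
  then obtain c g where "\<And>y. P y (c y) (g y)" by metis
  then have c: "\<And>y. c y \<in> region" and g: "\<And>y. g y \<le> hent (b y) ?Z"
    and cg: "\<And>y. (real (card J) * T y) *\<^sub>R c y =
       ((\<chi> y'. \<Sum>i\<in>J. \<Sum>x\<in>?X. ay y x * of_bool (x i = y')), hent (ay y) ?X, g y)"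
    unfolding P_def by auto
  obtain c1 where c1: "c1 \<in> region" "psi T = sum T UNIV *\<^sub>R c1"
    using psi_cone[of T] T0 by auto
  obtain c2 where c2: "c2 \<in> region" "(\<Sum>y\<in>UNIV. (real (card J) * T y) *\<^sub>R c y) = (\<Sum>y\<in>UNIV. real (card J) * T y) *\<^sub>R c2"
    using convex_cone_sum[OF convex_region region_nonempty, of UNIV "\<lambda>y. real (card J) * T y" c] c T0 by auto
  \<comment> \<open>The new coordinate has weight 1 and the remaining ones have weight
    \<open>card J\<close>; the two points are merged by a conic combination indexed by
    \<open>bool\<close>.\<close>
  have "\<exists>c3\<in>region. (\<Sum>k\<in>UNIV. (if k then sum T UNIV else real (card J) * sum T UNIV) *\<^sub>R (if k then c1 else c2))
     = (\<Sum>k\<in>UNIV. if k then sum T UNIV else real (card J) * sum T UNIV) *\<^sub>R c3"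
    by (rule convex_cone_sum[OF convex_region region_nonempty]) (use c1 c2 T0 in \<open>auto simp: sum_nonneg\<close>)
  then obtain c3 where c3: "c3 \<in> region" "sum T UNIV *\<^sub>R c1 + (real (card J) * sum T UNIV) *\<^sub>R c2
      = (sum T UNIV + real (card J) * sum T UNIV) *\<^sub>R c3"
    by (auto simp: UNIV_bool add.commute)
  have "(real (card (insert i J)) * sum a (PiE (insert i J) (\<lambda>_. UNIV))) *\<^sub>R c3
      = sum T UNIV *\<^sub>R c1 + (real (card J) * sum T UNIV) *\<^sub>R c2"
    using insert.hyps asum c3(2) by (simp add: algebra_simps)
  also have "... = psi T + (\<Sum>y\<in>UNIV. (real (card J) * T y) *\<^sub>R c y)"
    using c1(2) c2(2) by (simp add: sum_distrib_left)
  also have "... = ((\<chi> y'. T y' + (\<Sum>y\<in>UNIV. \<Sum>i\<in>J. \<Sum>x\<in>?X. ay y x * of_bool (x i = y'))),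
      hent T UNIV + (\<Sum>y\<in>UNIV. hent (ay y) ?X), hent (KK T) {0..<m} + sum g UNIV)"
    unfolding cg psi_def by (simp add: prod_eq_iff fst_sum snd_sum vec_eq_iff)
  also have "(\<chi> y'. T y' + (\<Sum>y\<in>UNIV. \<Sum>i\<in>J. \<Sum>x\<in>?X. ay y x * of_bool (x i = y')))
     = (\<chi> y'. \<Sum>k\<in>insert i J. \<Sum>x\<in>PiE (insert i J) (\<lambda>_. UNIV). a x * of_bool (x k = y'))"
  proof -
    have "(\<Sum>x\<in>PiE (insert i J) (\<lambda>_. UNIV). a x * of_bool (x i = y')) = T y'" for y'
    proof -
      have "(\<Sum>x\<in>PiE (insert i J) (\<lambda>_. UNIV). a x * of_bool (x i = y'))
        = (\<Sum>y\<in>UNIV. T y * of_bool (y = y'))"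
        using insert.hyps by (simp add: sum_PiE_insert ay_def T_def sum_distrib_right)
      then show ?thesis by simp
    qed
    moreover have "(\<Sum>x\<in>PiE (insert i J) (\<lambda>_. UNIV). a x * of_bool (x k = y'))
        = (\<Sum>y\<in>UNIV. \<Sum>x\<in>?X. ay y x * of_bool (x k = y'))" if "k \<in> J" for k y'
      using insert.hyps that by (auto simp: sum_PiE_insert ay_def intro!: sum.cong)
    ultimately show ?thesis
      using insert.hyps by (simp add: vec_eq_iff) (subst sum.swap, simp)
  qed
  also have "hent T UNIV + (\<Sum>y\<in>UNIV. hent (ay y) ?X) = hent a (PiE (insert i J) (\<lambda>_. UNIV))"
    using insert.hyps by (simp add: hent_PiE_insert T_def[abs_def] ay_def[abs_def])
  finally have main: "(real (card (insert i J)) * sum a (PiE (insert i J) (\<lambda>_. UNIV))) *\<^sub>R c3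
     = ((\<chi> y'. \<Sum>k\<in>insert i J. \<Sum>x\<in>PiE (insert i J) (\<lambda>_. UNIV). a x * of_bool (x k = y')),
        hent a (PiE (insert i J) (\<lambda>_. UNIV)), hent (KK T) {0..<m} + sum g UNIV)" .
  \<comment> \<open>The one inequality of the induction is
    \<open>H(Z_J | Z_i) \<ge> H(Z_J | Y_i)\<close>. Given \<open>Y_i\<close>, the letter
    \<open>Z_i\<close> is independent of \<open>Z_J\<close>, so conditioning on \<open>Z_i\<close>
    mixes the laws \<open>b y\<close> with weights \<open>K z1 y\<close>, and mixing raises
    entropy.\<close>
  have "hent (KK T) {0..<m} + sum g UNIV \<le> hent bb (PiE (insert i J) (\<lambda>_. {0..<m}))"
  proof -
    have "sum g UNIV \<le> (\<Sum>y\<in>UNIV. hent (b y) ?Z)" by (intro sum_mono g)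
    also have "... = (\<Sum>y\<in>UNIV. \<Sum>z1\<in>{0..<m}. K z1 y * hent (b y) ?Z)"
      by (simp add: K_sum flip: sum_distrib_right)
    also have "... = (\<Sum>z1\<in>{0..<m}. \<Sum>y\<in>UNIV. K z1 y * hent (b y) ?Z)" by (rule sum.swap)
    also have "... = (\<Sum>z1\<in>{0..<m}. \<Sum>y\<in>UNIV. hent (\<lambda>z. K z1 y * b y z) ?Z)"
      by (intro sum.cong refl hent_scale[symmetric]) (use K_nonneg b0 in auto)
    also have "... \<le> (\<Sum>z1\<in>{0..<m}. hent (\<lambda>z. \<Sum>y\<in>UNIV. K z1 y * b y z) ?Z)"
      by (intro sum_mono hent_superadditive) (use fX K_nonneg b0 in auto)
    finally have 1: "sum g UNIV \<le> (\<Sum>z1\<in>{0..<m}. hent (\<lambda>z. bb (z(i := z1))) ?Z)"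
      by (simp add: bbins)
    have "(\<Sum>z\<in>?Z. bb (z(i := z1))) = KK T z1" for z1
    proof -
      have "(\<Sum>z\<in>?Z. bb (z(i := z1))) = (\<Sum>y\<in>UNIV. \<Sum>z\<in>?Z. K z1 y * b y z)"
        unfolding bbins by (rule sum.swap)
      then show ?thesis by (simp add: KK_def bsum flip: sum_distrib_left)
    qed
    then show ?thesis
      using insert.hyps 1 by (subst hent_PiE_insert) (auto cong: hent_cong)
  qed
  then show ?case using main c3(1) unfolding bb_def by blast
qed

end

section \<open>Information bounds for codes\<close>

context modsum_relay
begin

text \<open>This is \<open>I(Y1^n; S^n) \<le> n * R0\<close>. By Gibbs' inequality, replacing the
  law \<open>PS\<close> of \<open>S^n\<close> by the product of its marginals \<open>Qi\<close> can
  only increase the divergence, which then splits into one mutual information of the relay channel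
  for each time.\<close>

lemma relay_information_bound:
  fixes f :: "nat \<Rightarrow> (nat \<Rightarrow> 'y1) \<Rightarrow> 'x1"
  defines "PP \<equiv> \<lambda>n y. \<Prod>i\<in>{0..<n}. pY (y i)"
    and "V \<equiv> \<lambda>n y s. \<Prod>i\<in>{0..<n}. Wr (f i y) (s i)"
  shows "real n * (ent pY UNIV - R0 Wr) \<le>
    (\<Sum>s\<in>seqs n UNIV. hent (\<lambda>y. PP n y * V n y s) (seqs n UNIV))"
proof -
  let ?Y = "seqs n (UNIV :: 'y1 set)" and ?S = "seqs n (UNIV :: 's set)"
  define a where "a y s = PP n y * V n y s" for y s
  have fin: "finite ?Y" "finite ?S" by (auto intro: finite_PiE)
  have PP0: "0 \<le> PP n y" for y unfolding PP_def by (intro prod_nonneg) (simp add: pY_nonneg)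
  have V0: "0 \<le> V n y s" for y s unfolding V_def by (intro prod_nonneg) (simp add: Wr_nonneg)
  have PPsum: "sum (PP n) ?Y = 1"
    unfolding PP_def by (rule sum_PiE_prod_eq_1) (auto simp: pY_sum)
  have Vsum: "sum (V n y) ?S = 1" for y
    unfolding V_def by (rule sum_PiE_prod_eq_1) (auto simp: Wr_sum)
  have a0: "0 \<le> a y s" for y s by (simp add: a_def PP0 V0)
  define PS where "PS s = (\<Sum>y\<in>?Y. a y s)" for s
  define Qi where "Qi i t = (\<Sum>y\<in>?Y. PP n y * Wr (f i y) t)" for i t
  have PS0: "0 \<le> PS s" for s by (simp add: PS_def a0 sum_nonneg)
  have Qi0: "0 \<le> Qi i t" for i t by (simp add: Qi_def PP0 Wr_nonneg sum_nonneg)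
  have Qisum: "sum (Qi i) UNIV = 1" for i
  proof -
    have "sum (Qi i) UNIV = (\<Sum>y\<in>?Y. \<Sum>t\<in>UNIV. PP n y * Wr (f i y) t)"
      unfolding Qi_def by (rule sum.swap)
    then show ?thesis by (simp add: Wr_sum PPsum flip: sum_distrib_left)
  qed
  have Qipos: "0 < Qi i (s i)" if "y \<in> ?Y" "0 < a y s" "i < n" for y s i
  proof -
    have "0 < PP n y" "0 < V n y s" using that(2) PP0[of y] V0[of y s] unfolding a_def
      by (auto simp: zero_less_mult_iff)
    moreover have "Wr (f i y) (s i) \<noteq> 0"
    proof
      assume "Wr (f i y) (s i) = 0"
      then have "V n y s = 0" using that(3) unfolding V_def by (intro prod_zero) auto
      then show False using \<open>0 < V n y s\<close> by simp
    qed
    ultimately have "0 < PP n y * Wr (f i y) (s i)" using Wr_nonneg[of "f i y" "s i"] by simp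
    then show ?thesis unfolding Qi_def
      using fin that(1) PP0 Wr_nonneg by (intro sum_pos2[where i = y]) auto
  qed
  have PSsum: "sum PS ?S = 1"
  proof -
    have "sum PS ?S = (\<Sum>y\<in>?Y. \<Sum>s\<in>?S. a y s)" unfolding PS_def by (rule sum.swap)
    then show ?thesis by (simp add: a_def Vsum PPsum flip: sum_distrib_left)
  qed
  have gibbs: "(\<Sum>s\<in>?S. PS s * log 2 (\<Prod>i\<in>{0..<n}. Qi i (s i))) \<le> (\<Sum>s\<in>?S. PS s * log 2 (PS s))"
  proof (rule gibbs_inequality[OF fin(2)])
    show "(\<Sum>s\<in>?S. \<Prod>i\<in>{0..<n}. Qi i (s i)) \<le> sum PS ?S"
      unfolding PSsum by (subst sum_PiE_prod_eq_1) (auto simp: Qisum)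
    fix s assume "0 < PS s"
    then obtain y where "y \<in> ?Y" "0 < a y s"
      unfolding PS_def by (metis not_less sum_nonpos)
    then show "0 < (\<Prod>i\<in>{0..<n}. Qi i (s i))"
      by (intro prod_pos) (auto intro: Qipos)
  qed (auto simp: PS0 Qi0 prod_nonneg)
  have logs: "a y s * log 2 (a y s) = PP n y * log 2 (PP n y) * V n y s
      + PP n y * (V n y s * (\<Sum>i\<in>{0..<n}. log 2 (Wr (f i y) (s i))))" for y s
  proof (cases "a y s = 0")
    case True
    then show ?thesis by (auto simp: a_def)
  next
    case False
    then have nz: "PP n y \<noteq> 0" "V n y s \<noteq> 0" by (auto simp: a_def)
    then have "0 < Wr (f i y) (s i)" if "i < n" for i
      using that Wr_nonneg[of "f i y" "s i"] unfolding V_def by (force simp: prod_zero_iff)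
    then have "log 2 (V n y s) = (\<Sum>i\<in>{0..<n}. log 2 (Wr (f i y) (s i)))"
      unfolding V_def by (intro log_prod) auto
    then show ?thesis using nz PP0[of y] V0[of y s]
      by (simp add: a_def log_mult algebra_simps)
  qed
  have "hent (\<lambda>y. a y s) ?Y = PS s * log 2 (PS s) - (\<Sum>y\<in>?Y. a y s * log 2 (a y s))" for s
    by (simp add: hent_def plogp_eq PS_def)
  then have lhs: "(\<Sum>s\<in>?S. hent (\<lambda>y. a y s) ?Y)
      = (\<Sum>s\<in>?S. PS s * log 2 (PS s)) - (\<Sum>s\<in>?S. \<Sum>y\<in>?Y. a y s * log 2 (a y s))"
    by (simp add: sum_subtractf)
  have t1: "(\<Sum>s\<in>?S. \<Sum>y\<in>?Y. a y s * log 2 (a y s))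
     = (\<Sum>y\<in>?Y. PP n y * log 2 (PP n y)) + (\<Sum>y\<in>?Y. PP n y * (\<Sum>i\<in>{0..<n}. \<Sum>t\<in>UNIV. Wr (f i y) t * log 2 (Wr (f i y) t)))"
  proof -
    have "(\<Sum>s\<in>?S. \<Sum>y\<in>?Y. a y s * log 2 (a y s)) = (\<Sum>y\<in>?Y. \<Sum>s\<in>?S. a y s * log 2 (a y s))"
      by (rule sum.swap)
    also have "... = (\<Sum>y\<in>?Y. PP n y * log 2 (PP n y) * sum (V n y) ?S
        + PP n y * (\<Sum>s\<in>?S. V n y s * (\<Sum>i\<in>{0..<n}. log 2 (Wr (f i y) (s i)))))"
      unfolding logs by (simp add: sum.distrib sum_distrib_left)
    also have "... = (\<Sum>y\<in>?Y. PP n y * log 2 (PP n y)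
        + PP n y * (\<Sum>i\<in>{0..<n}. \<Sum>t\<in>UNIV. Wr (f i y) t * log 2 (Wr (f i y) t)))"
      unfolding V_def
      by (subst sum_PiE_prod_additive[where h = "\<lambda>i t. log 2 (Wr (f i _) t)"])
        (auto simp: Wr_sum sum_PiE_prod_eq_1[where g = "\<lambda>i. Wr (f i _)"])
    finally show ?thesis by (simp add: sum.distrib)
  qed
  have t2: "(\<Sum>y\<in>?Y. PP n y * log 2 (PP n y)) = - (real n * ent pY UNIV)"
  proof -
    have "(\<Sum>y\<in>?Y. PP n y * log 2 (PP n y)) = (\<Sum>y\<in>?Y. PP n y * (\<Sum>i\<in>{0..<n}. log 2 (pY (y i))))"
    proof (intro sum.cong refl)
      fix y
      show "PP n y * log 2 (PP n y) = PP n y * (\<Sum>i\<in>{0..<n}. log 2 (pY (y i)))"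
      proof (cases "PP n y = 0")
        case False
        then have "0 < pY (y i)" if "i < n" for i
          using that pY_nonneg[of "y i"] unfolding PP_def by (force simp: prod_zero_iff)
        then show ?thesis unfolding PP_def by (subst log_prod) auto
      qed simp
    qed
    also have "... = (\<Sum>i\<in>{0..<n}. \<Sum>t\<in>UNIV. pY t * log 2 (pY t))"
      unfolding PP_def by (rule sum_PiE_prod_additive) (auto simp: pY_sum)
    finally show ?thesis by (simp add: ent_def plogp_eq)
  qed
  have t3: "(\<Sum>s\<in>?S. PS s * log 2 (\<Prod>i\<in>{0..<n}. Qi i (s i)))
      = (\<Sum>y\<in>?Y. PP n y * (\<Sum>i\<in>{0..<n}. \<Sum>t\<in>UNIV. Wr (f i y) t * log 2 (Qi i t)))"
  proof -
    have "(\<Sum>s\<in>?S. PS s * log 2 (\<Prod>i\<in>{0..<n}. Qi i (s i)))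
       = (\<Sum>s\<in>?S. \<Sum>y\<in>?Y. a y s * log 2 (\<Prod>i\<in>{0..<n}. Qi i (s i)))"
      by (simp add: PS_def sum_distrib_right)
    also have "... = (\<Sum>s\<in>?S. \<Sum>y\<in>?Y. a y s * (\<Sum>i\<in>{0..<n}. log 2 (Qi i (s i))))"
    proof (intro sum.cong refl)
      fix y s assume y: "y \<in> ?Y"
      show "a y s * log 2 (\<Prod>i\<in>{0..<n}. Qi i (s i)) = a y s * (\<Sum>i\<in>{0..<n}. log 2 (Qi i (s i)))"
      proof (cases "a y s = 0")
        case False
        with a0[of y s] have "0 < a y s" by simp
        then show ?thesis by (subst log_prod) (auto intro: Qipos[OF y])
      qed simp
    qed
    also have "... = (\<Sum>y\<in>?Y. \<Sum>s\<in>?S. a y s * (\<Sum>i\<in>{0..<n}. log 2 (Qi i (s i))))" by (rule sum.swap)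
    also have "... = (\<Sum>y\<in>?Y. PP n y * (\<Sum>s\<in>?S. V n y s * (\<Sum>i\<in>{0..<n}. log 2 (Qi i (s i)))))"
      by (simp add: a_def sum_distrib_left mult.assoc)
    also have "... = (\<Sum>y\<in>?Y. PP n y * (\<Sum>i\<in>{0..<n}. \<Sum>t\<in>UNIV. Wr (f i y) t * log 2 (Qi i t)))"
      unfolding V_def
      by (subst sum_PiE_prod_additive[where h = "\<lambda>i t. log 2 (Qi i t)"]) (auto simp: Wr_sum)
    finally show ?thesis .
  qed
  have mi: "(\<Sum>y\<in>?Y. PP n y * (\<Sum>t\<in>UNIV. Wr (f i y) t * (log 2 (Wr (f i y) t) - log 2 (Qi i t)))) \<le> R0 Wr" for i
  proof -
    \<comment> \<open>The law of the relay input at time \<open>i\<close>. Grouping the words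
      \<open>y\<close> by the symbol \<open>f i y\<close> turns the average over \<open>y\<close>
      into a mutual information of \<open>Wr\<close>, which \<open>R0\<close> dominates.\<close>
    define pX where "pX x = (\<Sum>y\<in>?Y. PP n y * of_bool (f i y = x))" for x
    have grp: "(\<Sum>x\<in>UNIV. pX x * F x) = (\<Sum>y\<in>?Y. PP n y * F (f i y))" for F
    proof -
      have "(\<Sum>x\<in>UNIV. pX x * F x) = (\<Sum>y\<in>?Y. \<Sum>x\<in>UNIV. PP n y * of_bool (f i y = x) * F x)"
        unfolding pX_def sum_distrib_right by (rule sum.swap)
      also have "... = (\<Sum>y\<in>?Y. PP n y * (\<Sum>x\<in>UNIV. (if f i y = x then F x else 0)))"
        unfolding sum_distrib_left by (intro sum.cong refl) auto
      finally show ?thesis by simp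
    qed
    have pX: "is_pmf_on pX UNIV"
      using grp[of "\<lambda>_. 1"] PPsum PP0 by (auto simp: is_pmf_on_def pX_def sum_nonneg)
    have q: "(\<Sum>x\<in>UNIV. pX x * Wr x t) = Qi i t" for t
      unfolding Qi_def by (rule grp)
    have "mutual_info pX Wr UNIV UNIV = (\<Sum>x\<in>UNIV. pX x * (\<Sum>t\<in>UNIV. Wr x t * (log 2 (Wr x t) - log 2 (Qi i t))))"
      using pX Wr_pmf by (subst mutual_info_eq) (auto simp: is_pmf_on_def q sum_distrib_left mult.assoc)
    also have "... = (\<Sum>y\<in>?Y. PP n y * (\<Sum>t\<in>UNIV. Wr (f i y) t * (log 2 (Wr (f i y) t) - log 2 (Qi i t))))"
      by (rule grp)
    finally show ?thesis using mutual_info_le_R0[of pX Wr] pX Wr_pmf by simp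
  qed
  have "(\<Sum>y\<in>?Y. PP n y * (\<Sum>i\<in>{0..<n}. \<Sum>t\<in>UNIV. Wr (f i y) t * log 2 (Wr (f i y) t)))
     - (\<Sum>y\<in>?Y. PP n y * (\<Sum>i\<in>{0..<n}. \<Sum>t\<in>UNIV. Wr (f i y) t * log 2 (Qi i t)))
     = (\<Sum>y\<in>?Y. \<Sum>i\<in>{0..<n}. PP n y * (\<Sum>t\<in>UNIV. Wr (f i y) t * (log 2 (Wr (f i y) t) - log 2 (Qi i t))))"
    by (simp add: right_diff_distrib sum_subtractf sum_distrib_left)
  also have "... = (\<Sum>i\<in>{0..<n}. \<Sum>y\<in>?Y. PP n y * (\<Sum>t\<in>UNIV. Wr (f i y) t * (log 2 (Wr (f i y) t) - log 2 (Qi i t))))"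
    by (rule sum.swap)
  also have "... \<le> (\<Sum>i\<in>{0..<n}. R0 Wr)" by (intro sum_mono mi)
  finally show ?thesis
    using lhs t1 t2 t3 gibbs unfolding a_def by (simp add: right_diff_distrib)
qed

text \<open>Joint law of noise, relay observations and relay output. The message is absent because
  it only shifts the noise word that the receiver sees.\<close>

definition block_law :: "nat \<Rightarrow> (nat \<Rightarrow> (nat \<Rightarrow> 'y1) \<Rightarrow> 'x1) \<Rightarrow> (nat \<Rightarrow> nat) \<Rightarrow> (nat \<Rightarrow> 'y1) \<Rightarrow> (nat \<Rightarrow> 's) \<Rightarrow> real" where
  "block_law n f z y s = (\<Prod>i\<in>{0..<n}. pz (z i) * W1 (z i) (y i) * Wr (f i y) (s i))"

lemma block_law_eq:
  "block_law n f z y s = (\<Prod>i\<in>{0..<n}. pz (z i)) * ((\<Prod>i\<in>{0..<n}. W1 (z i) (y i)) * (\<Prod>i\<in>{0..<n}. Wr (f i y) (s i)))"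
  by (simp add: block_law_def prod.distrib mult_ac)

lemma block_law_nonneg:
  "z \<in> seqs n {0..<m} \<Longrightarrow> 0 \<le> block_law n f z y s"
  unfolding block_law_def
  by (intro prod_nonneg) (auto simp: PiE_iff pz_nonneg W1_nonneg Wr_nonneg)

lemma block_law_sum:
  "(\<Sum>z\<in>seqs n {0..<m}. \<Sum>y\<in>seqs n UNIV. \<Sum>s\<in>seqs n UNIV. block_law n f z y s) = 1"
proof -
  have "(\<Sum>s\<in>seqs n UNIV. block_law n f z y s) = (\<Prod>i\<in>{0..<n}. pz (z i)) * (\<Prod>i\<in>{0..<n}. W1 (z i) (y i))" for z y
    unfolding block_law_eq sum_distrib_left[symmetric]
    by (subst sum_PiE_prod_eq_1[where g = "\<lambda>i. Wr (f i y)"]) (auto simp: Wr_sum)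
  moreover have "(\<Sum>y\<in>seqs n UNIV. \<Prod>i\<in>{0..<n}. W1 (z i) (y i)) = 1"
    if "z \<in> seqs n {0..<m}" for z
    by (rule sum_PiE_prod_eq_1[where g = "\<lambda>i. W1 (z i)"]) (use that in \<open>auto simp: PiE_iff W1_sum\<close>)
  moreover have "(\<Sum>z\<in>seqs n {0..<m}. \<Prod>i\<in>{0..<n}. pz (z i)) = 1"
    by (rule sum_PiE_prod_eq_1) (auto simp: pz_sum)
  ultimately show ?thesis by (simp flip: sum_distrib_left)
qed

lemma err_prob_block_law:
  "err_prob m pz W1 Wr n M enc f g = (1 / real M) * (\<Sum>w\<in>{1..M}.
     \<Sum>z\<in>seqs n {0..<m}. \<Sum>y\<in>seqs n UNIV. \<Sum>s\<in>seqs n UNIV.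
       block_law n f z y s * of_bool (g (\<lambda>i\<in>{0..<n}. (enc w i + z i) mod m) s \<noteq> w))"
  unfolding err_prob_def block_law_def lessThan_atLeast0 of_bool_def ..

text \<open>With \<open>s\<close> as the earlier argument, \<open>hent (ZS_law n f s)\<close> summed
  over \<open>s\<close> is \<open>H(Z^n | S^n)\<close>.\<close>

definition ZS_law :: "nat \<Rightarrow> (nat \<Rightarrow> (nat \<Rightarrow> 'y1) \<Rightarrow> 'x1) \<Rightarrow> (nat \<Rightarrow> 's) \<Rightarrow> (nat \<Rightarrow> nat) \<Rightarrow> real" where
  "ZS_law n f s z = (\<Sum>y\<in>seqs n UNIV. block_law n f z y s)"

text \<open>Fano's inequality and \<open>H(Y\<^sup>n | S\<^sup>n) \<le> n log m\<close> in a single application of Gibbs' inequality, for each \<open>s\<close>: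
  the comparison law of \<open>(w, z)\<close> is \<open>m\<^sup>-\<^sup>n q(w | y, s)\<close>, where \<open>q\<close> puts half its mass on the decoded message.\<close>
lemma fano_bound:
  fixes enc :: "nat \<Rightarrow> nat \<Rightarrow> nat" and f :: "nat \<Rightarrow> (nat \<Rightarrow> 'y1) \<Rightarrow> 'x1"
    and g :: "(nat \<Rightarrow> nat) \<Rightarrow> (nat \<Rightarrow> 's) \<Rightarrow> nat" and n M :: nat
  assumes M: "1 \<le> M"
  defines "e \<equiv> err_prob m pz W1 Wr n M enc f g"
  shows "(1 - e) * log 2 (real M) - 1 \<le> real n * log 2 (real m)
    - (\<Sum>s\<in>seqs n UNIV. hent (ZS_law n f s) (seqs n {0..<m}))"
proof -
  let ?Z = "seqs n {0..<m}" and ?S = "seqs n (UNIV :: 's set)"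
    and ?Y = "seqs n (UNIV :: 'y1 set)" and ?L = "log 2 (real M)" and ?lm = "log 2 (real m)"
  have fin: "finite ?Z" "finite ?S" by (auto intro: finite_PiE)
  define sh where "sh w z = (\<lambda>i\<in>{0..<n}. (enc w i + z i) mod m)" for w z
  define B where "B s z = ZS_law n f s z" for s z
  have B0: "0 \<le> B s z" if "z \<in> ?Z" for s z
    unfolding B_def ZS_law_def using that by (intro sum_nonneg block_law_nonneg)
  define T where "T s = sum (B s) ?Z" for s
  have T0: "0 \<le> T s" for s unfolding T_def by (intro sum_nonneg B0)
  define q where "q w y s = 1 / (2 * real M) + (1/2) * of_bool (g y s = w)" for w y s
  have M0: "0 < real M" and m0: "0 < real m" using M m_ge_2 by auto
  have q0: "0 < q w y s" for w y s
    unfolding q_def using M0 by (intro add_pos_nonneg) auto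
  \<comment> \<open>The half on the decoded message keeps the logarithm at least \<open>- 1\<close>
    when decoding is right; the uniform half costs a further \<open>log M\<close> on an
    error.\<close>
  have qlog: "- 1 - ?L * of_bool (g y s \<noteq> w) \<le> log 2 (q w y s)" for w y s
  proof (cases "g y s = w")
    case True
    have "1/2 \<le> q w y s" using True M0 by (simp add: q_def)
    then have "log 2 (1/2) \<le> log 2 (q w y s)" using q0[of w y s] by (subst log_le_cancel_iff) auto
    then show ?thesis using True by (simp add: log_divide)
  next
    case False
    then show ?thesis using M0 by (simp add: q_def log_divide log_mult)
  qed
  define e' where "e' s = (\<Sum>w\<in>{1..M}. \<Sum>z\<in>?Z. B s z / real M * of_bool (g (sh w z) s \<noteq> w))" for s
  have step: "- T s - ?L * e' s \<le> real n * ?lm * T s - hent (B s) ?Z - T s * ?L" for s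
  proof -
    define r where "r = (\<lambda>(w,z). q w (sh w z) s * (T s / real m ^ n))"
    define p where "p = (\<lambda>(w::nat,z). B s z / real M)"
    have psum: "sum p ({1..M} \<times> ?Z) = T s"
      using M0 by (simp add: p_def T_def sum.cartesian_product' flip: sum_divide_distrib)
    \<comment> \<open>For a fixed message, translation turns the sum over noise words into a sum
      over received words. There are \<open>m ^ n\<close> of these, and for each one
      \<open>q\<close> has mass at most 1 on the messages; the mass is only 1/2 if the decoder
      outputs something outside \<open>{1..M}\<close>.\<close>
    have rsum: "sum r ({1..M} \<times> ?Z) \<le> T s"
    proof -
      have "(\<Sum>w\<in>{1..M}. \<Sum>z\<in>?Z. q w (sh w z) s) = (\<Sum>w\<in>{1..M}. \<Sum>y\<in>?Z. q w y s)"
        unfolding sh_def using m_ge_2 by (intro sum.cong refl sum_shift_mod) auto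
      also have "... = (\<Sum>y\<in>?Z. \<Sum>w\<in>{1..M}. q w y s)" by (rule sum.swap)
      also have "... \<le> (\<Sum>y\<in>?Z. 1)"
      proof (rule sum_mono)
        fix y
        have "(\<Sum>w\<in>{1..M}. q w y s) = 1/2 + (1/2) * (\<Sum>w\<in>{1..M}. of_bool (g y s = w))"
          unfolding q_def sum.distrib sum_distrib_left[symmetric] using M0 by simp
        moreover have "(\<Sum>w\<in>{1..M}. of_bool (g y s = w)) \<le> (1::real)"
          by (simp only: of_bool_def sum.delta' finite_atLeastAtMost) simp
        ultimately show "(\<Sum>w\<in>{1..M}. q w y s) \<le> 1" by simp
      qed
      also have "... = real m ^ n" by (simp add: card_PiE)
      finally have le: "(\<Sum>w\<in>{1..M}. \<Sum>z\<in>?Z. q w (sh w z) s) \<le> real m ^ n" .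
      have "sum r ({1..M} \<times> ?Z) = (\<Sum>w\<in>{1..M}. \<Sum>z\<in>?Z. q w (sh w z) s) * (T s / real m ^ n)"
        by (simp only: r_def sum.cartesian_product' sum_distrib_right prod.case)
      also have "... \<le> real m ^ n * (T s / real m ^ n)"
        using m0 T0[of s] by (intro mult_right_mono le) auto
      also have "... = T s" using m0 by simp
      finally show ?thesis .
    qed
    have g1: "(\<Sum>a\<in>{1..M} \<times> ?Z. p a * log 2 (r a)) \<le> (\<Sum>a\<in>{1..M} \<times> ?Z. p a * log 2 (p a))"
    proof (rule gibbs_inequality)
      fix a assume a: "a \<in> {1..M} \<times> ?Z" "0 < p a"
      then obtain w z where wz: "a = (w,z)" "z \<in> ?Z" "0 < B s z" using M0
        by (auto simp: p_def zero_less_divide_iff)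
      then have "0 < T s" unfolding T_def using fin B0 by (intro sum_pos2[where i = z]) auto
      then show "0 < r a" using q0 m0 by (simp add: r_def wz)
    qed (use rsum psum fin B0 q0 T0 in \<open>auto simp: p_def r_def less_imp_le\<close>)
    have "(\<Sum>a\<in>{1..M} \<times> ?Z. p a * log 2 (p a)) = (\<Sum>w\<in>{1..M}. \<Sum>z\<in>?Z. B s z / real M * log 2 (B s z / real M))"
      by (simp add: p_def sum.cartesian_product')
    also have "... = real M * (\<Sum>z\<in>?Z. B s z / real M * log 2 (B s z / real M))" by simp
    also have "... = (\<Sum>z\<in>?Z. B s z * log 2 (B s z / real M))"
      using M0 by (simp add: sum_distrib_left)
    also have "... = (\<Sum>z\<in>?Z. B s z * log 2 (B s z) - B s z * ?L)"
      by (intro sum.cong refl mult_log_divide) (use M0 B0 in auto)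
    also have "... = T s * log 2 (T s) - hent (B s) ?Z - T s * ?L"
      by (simp add: hent_def plogp_eq sum_subtractf T_def sum_distrib_right)
    finally have rhs: "(\<Sum>a\<in>{1..M} \<times> ?Z. p a * log 2 (p a)) = T s * log 2 (T s) - hent (B s) ?Z - T s * ?L" .
    have lhs: "- T s - ?L * e' s + T s * log 2 (T s) - real n * ?lm * T s \<le> (\<Sum>a\<in>{1..M} \<times> ?Z. p a * log 2 (r a))"
    proof -
      have "p a * (- 1 - ?L * of_bool (g (sh (fst a) (snd a)) s \<noteq> fst a) + log 2 (T s) - real n * ?lm) \<le> p a * log 2 (r a)"
        if a: "a \<in> {1..M} \<times> ?Z" for a
      proof -
        obtain w z where wz: "a = (w,z)" "z \<in> ?Z" using a by auto
        show ?thesis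
        proof (cases "p a = 0")
          case False
          moreover have "0 \<le> p a" using B0[OF wz(2)] by (simp add: p_def wz(1))
          ultimately have "0 < p a" by linarith
          then have "0 < B s z" using M0 by (simp add: p_def wz(1) zero_less_divide_iff)
          then have Tp: "0 < T s" unfolding T_def using fin B0 wz(2) by (intro sum_pos2[where i = z]) auto
          have "log 2 (r a) = log 2 (q w (sh w z) s) + log 2 (T s) - real n * ?lm"
            using q0[of w "sh w z" s] Tp m0 by (simp add: r_def wz(1) log_mult log_divide log_nat_power)
          then show ?thesis using qlog[of "sh w z" s w] \<open>0 < p a\<close> wz(1) by (intro mult_left_mono) auto
        qed simp
      qed
      then have "(\<Sum>a\<in>{1..M} \<times> ?Z. p a * (- 1 - ?L * of_bool (g (sh (fst a) (snd a)) s \<noteq> fst a) + log 2 (T s) - real n * ?lm))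
         \<le> (\<Sum>a\<in>{1..M} \<times> ?Z. p a * log 2 (r a))" by (rule sum_mono)
      moreover have "(\<Sum>a\<in>{1..M} \<times> ?Z. p a * (- 1 - ?L * of_bool (g (sh (fst a) (snd a)) s \<noteq> fst a) + log 2 (T s) - real n * ?lm))
        = (\<Sum>a\<in>{1..M} \<times> ?Z. p a * (- 1 + log 2 (T s) - real n * ?lm) - ?L * (p a * of_bool (g (sh (fst a) (snd a)) s \<noteq> fst a)))"
        by (intro sum.cong refl) (simp add: algebra_simps)
      moreover have "... = T s * (- 1 + log 2 (T s) - real n * ?lm) - ?L * (\<Sum>a\<in>{1..M} \<times> ?Z. p a * of_bool (g (sh (fst a) (snd a)) s \<noteq> fst a))"
        unfolding sum_subtractf sum_distrib_left[symmetric] sum_distrib_right[symmetric] psum ..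
      moreover have "(\<Sum>a\<in>{1..M} \<times> ?Z. p a * of_bool (g (sh (fst a) (snd a)) s \<noteq> fst a)) = e' s"
        by (simp add: e'_def p_def sum.cartesian_product')
      ultimately show ?thesis by (simp add: algebra_simps)
    qed
    show ?thesis using g1 rhs lhs by linarith
  qed
  have Tsum: "sum T ?S = 1"
  proof -
    have "sum T ?S = (\<Sum>z\<in>?Z. \<Sum>s\<in>?S. B s z)" unfolding T_def by (rule sum.swap)
    also have "... = (\<Sum>z\<in>?Z. \<Sum>y\<in>?Y. \<Sum>s\<in>?S. block_law n f z y s)"
      unfolding B_def ZS_law_def by (intro sum.cong refl sum.swap)
    finally show ?thesis by (simp add: block_law_sum)
  qed
  have esum: "sum e' ?S = e"
  proof -
    have "sum e' ?S = (\<Sum>w\<in>{1..M}. \<Sum>s\<in>?S. \<Sum>z\<in>?Z. B s z / real M * of_bool (g (sh w z) s \<noteq> w))"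
      unfolding e'_def by (rule sum.swap)
    also have "... = (\<Sum>w\<in>{1..M}. \<Sum>z\<in>?Z. \<Sum>s\<in>?S. B s z / real M * of_bool (g (sh w z) s \<noteq> w))"
      by (intro sum.cong refl sum.swap)
    also have "... = (\<Sum>w\<in>{1..M}. \<Sum>z\<in>?Z. \<Sum>s\<in>?S. \<Sum>y\<in>?Y. 1 / real M * (block_law n f z y s * of_bool (g (sh w z) s \<noteq> w)))"
      by (simp add: B_def ZS_law_def sum_distrib_right sum_divide_distrib)
    also have "... = (\<Sum>w\<in>{1..M}. \<Sum>z\<in>?Z. \<Sum>y\<in>?Y. \<Sum>s\<in>?S. 1 / real M * (block_law n f z y s * of_bool (g (sh w z) s \<noteq> w)))"
      by (intro sum.cong refl sum.swap)
    finally show ?thesis unfolding e_def err_prob_block_law sh_def by (simp only: sum_distrib_left)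
  qed
  have "(\<Sum>s\<in>?S. - T s - ?L * e' s) \<le> (\<Sum>s\<in>?S. real n * ?lm * T s - hent (B s) ?Z - T s * ?L)"
    by (rule sum_mono) (rule step)
  then have "- 1 - ?L * e \<le> real n * ?lm - (\<Sum>s\<in>?S. hent (B s) ?Z) - ?L"
    by (simp add: sum_subtractf sum_negf Tsum esum flip: sum_distrib_left sum_distrib_right)
  then show ?thesis unfolding B_def by (simp add: algebra_simps)
qed

end

section \<open>Optimal test channel and converse\<close>

lemma num_msgs_ge: "2 powr (real n * R) \<le> real (num_msgs n R)" "1 \<le> num_msgs n R"
proof -
  show "2 powr (real n * R) \<le> real (num_msgs n R)"
    unfolding num_msgs_def by (simp add: le_of_int_ceiling real_nat_ceiling_ge)
  moreover have "0 < 2 powr (real n * R)" by simp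
  ultimately show "1 \<le> num_msgs n R" by linarith
qed

lemma num_msgs_le: "0 \<le> R \<Longrightarrow> real (num_msgs n R) \<le> 2 * 2 powr (real n * R)"
proof -
  assume "0 \<le> R"
  then have "1 \<le> 2 powr (real n * R)" by (intro ge_one_powr_ge_zero) auto
  then show ?thesis unfolding num_msgs_def by linarith
qed

lemma continuous_on_plogp_compose:
  assumes "continuous_on S f" "\<And>x. x \<in> S \<Longrightarrow> 0 \<le> f x"
  shows "continuous_on S (\<lambda>x. plogp (f x))"
  by (rule continuous_on_compose2[OF continuous_on_plogp assms(1)]) (use assms(2) in auto)

lemma continuous_on_hent:
  assumes "\<And>a. a \<in> A \<Longrightarrow> continuous_on S (\<lambda>x. f x a)" "\<And>x a. x \<in> S \<Longrightarrow> a \<in> A \<Longrightarrow> 0 \<le> f x a"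
  shows "continuous_on S (\<lambda>x. hent (f x) A)"
  unfolding hent_def using assms
  by (intro continuous_on_diff continuous_on_sum continuous_on_plogp_compose) (auto simp: sum_nonneg)

context modsum_relay
begin

text \<open>The simplex, realised as the set \<open>S\<close> of vectors, is compact and
  \<open>psi\<close> is continuous on it; in finite dimension the convex hull of the compact image
  is compact.\<close>

lemma compact_region: "compact region"
proof -
  define S where "S = cbox 0 (\<chi> y. 1) \<inter> {x::real^'y1. (\<Sum>y\<in>UNIV. x $ y) = 1}"
  have "compact S"
    unfolding S_def by (intro compact_Int_closed compact_cbox closed_Collect_eq continuous_intros)
  have S0: "0 \<le> x $ y" if "x \<in> S" for x y using that by (auto simp: S_def mem_box_cart)
  have "psi ` {v. is_pmf_on v UNIV} = (\<lambda>x. psi (\<lambda>y. x $ y)) ` S"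
  proof (intro equalityI subsetI)
    fix w assume "w \<in> psi ` {v. is_pmf_on v UNIV}"
    then obtain v where v: "is_pmf_on v UNIV" "w = psi v" by auto
    have "v y \<le> 1" for y
      using v member_le_sum[of y UNIV v] by (auto simp: is_pmf_on_def)
    then have "(\<chi> y. v y) \<in> S" using v by (auto simp: S_def mem_box_cart is_pmf_on_def)
    moreover have "(\<lambda>y. (\<chi> y. v y) $ y) = v" by (rule ext) simp
    ultimately show "w \<in> (\<lambda>x. psi (\<lambda>y. x $ y)) ` S"
      using v(2) by (intro rev_image_eqI[of "\<chi> y. v y"]) auto
  next
    fix w assume "w \<in> (\<lambda>x. psi (\<lambda>y. x $ y)) ` S"
    then obtain x where "x \<in> S" "w = psi (\<lambda>y. x $ y)" by auto
    then show "w \<in> psi ` {v. is_pmf_on v UNIV}"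
      using S0 by (auto simp: is_pmf_on_def S_def)
  qed
  moreover have "continuous_on S (\<lambda>x. psi (\<lambda>y. x $ y))"
    unfolding psi_def KK_def[abs_def] using S0
    by (intro continuous_on_Pair continuous_on_hent continuous_intros sum_nonneg mult_nonneg_nonneg K_nonneg) auto
  ultimately show ?thesis unfolding region_def using \<open>compact S\<close>
    by (simp add: compact_convex_hull compact_continuous_image)
qed

text \<open>The vector \<open>e\<close> adds up the coordinates of the law, and all generators
  satisfy \<open>e \<bullet> x = 1\<close>. This hyperplane has dimension
  \<open>CARD('y1) + 1\<close>, so Caratheodory gives one point more than that. The weights become
  \<open>p(u)\<close>, the points become \<open>p(y1 | u)\<close>, and Bayes' rule turns them into a
  test channel.\<close>

lemma region_test_channel:
  assumes x: "((\<chi> y. pY y), a, b) \<in> region"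
  shows "\<exists>k \<le> CARD('y1) + 2. \<exists>Q. (\<forall>y. is_pmf_on (Q y) {0..<k}) \<and>
    ent pY UNIV - I_UY1 m pz W1 k Q = a \<and> H_Z_given_U m pz W1 k Q = b"
proof -
  let ?P = "psi ` {v. is_pmf_on v UNIV}"
  define e :: "(real ^ 'y1) \<times> real \<times> real" where "e = ((\<chi> y. 1), 0, 0)"
  have "e \<noteq> 0" by (auto simp: e_def zero_prod_def vec_eq_iff)
  have "?P \<subseteq> {x. e \<bullet> x = 1}"
    by (auto simp: e_def psi_def is_pmf_on_def inner_vec_def)
  then have "aff_dim ?P \<le> aff_dim {x. e \<bullet> x = 1}" by (rule aff_dim_subset)
  also have "... = int (CARD('y1)) + 1" using \<open>e \<noteq> 0\<close> by simp
  finally have dim: "aff_dim ?P \<le> int (CARD('y1)) + 1" .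
  obtain S where S: "finite S" "S \<subseteq> ?P" "int (card S) \<le> aff_dim ?P + 1" "((\<chi> y. pY y), a, b) \<in> convex hull S"
    using x unfolding region_def caratheodory_aff_dim[of ?P] by auto
  then obtain w where w: "\<And>x. x \<in> S \<Longrightarrow> 0 \<le> w x" "sum w S = 1" "(\<Sum>x\<in>S. w x *\<^sub>R x) = ((\<chi> y. pY y), a, b)"
    by (auto simp: convex_hull_finite)
  define k where "k = card S"
  obtain h where h: "bij_betw h {0..<k} S" using ex_bij_betw_nat_finite[OF S(1)] by (auto simp: k_def)
  have k: "k \<le> CARD('y1) + 2" using S(3) dim by (simp add: k_def)
  have hS: "h j \<in> S" if "j < k" for j using h that by (auto simp: bij_betw_def)
  have "k \<noteq> 0" using w(2) S(1) by (auto simp: k_def)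
  have "\<forall>j\<in>{0..<k}. \<exists>v. is_pmf_on v UNIV \<and> h j = psi v" using hS S(2) by fastforce
  then obtain v where v: "\<And>j. j < k \<Longrightarrow> is_pmf_on (v j) UNIV" "\<And>j. j < k \<Longrightarrow> h j = psi (v j)"
    by (metis atLeastLessThan_iff zero_le)
  define ww where "ww j = w (h j)" for j
  have ww0: "0 \<le> ww j" if "j < k" for j using w hS that by (simp add: ww_def)
  have "(\<Sum>j\<in>{0..<k}. ww j *\<^sub>R psi (v j)) = (\<Sum>j\<in>{0..<k}. w (h j) *\<^sub>R h j)"
    by (intro sum.cong refl) (simp add: ww_def v(2))
  also have "... = (\<Sum>x\<in>S. w x *\<^sub>R x)" by (rule sum.reindex_bij_betw[OF h])
  finally have rep: "(\<Sum>j\<in>{0..<k}. ww j *\<^sub>R psi (v j)) = ((\<chi> y. pY y), a, b)" using w(3) by simp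
  have v0: "0 \<le> v j y" if "j < k" for j y using v(1)[OF that] by (simp add: is_pmf_on_def)
  have rp: "(\<Sum>j\<in>{0..<k}. ww j * v j y) = pY y" for y
    using arg_cong[OF rep, of "\<lambda>x. fst x $ y"] by (simp add: psi_def fst_sum)
  have ra: "(\<Sum>j\<in>{0..<k}. ww j * hent (v j) UNIV) = a"
    using arg_cong[OF rep, of "\<lambda>x. fst (snd x)"] by (simp add: psi_def fst_sum snd_sum)
  have rb: "(\<Sum>j\<in>{0..<k}. ww j * hent (KK (v j)) {0..<m}) = b"
    using arg_cong[OF rep, of "\<lambda>x. snd (snd x)"] by (simp add: psi_def snd_sum)
  \<comment> \<open>On letters of probability 0 the test channel is the point mass at 0, a legal
    value of \<open>U\<close> because \<open>k \<noteq> 0\<close>.\<close>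
  define Q where "Q y j = (if pY y = 0 then of_bool (j = 0) else ww j * v j y / pY y)" for y and j :: nat
  have pQ: "pY y * Q y j = ww j * v j y" if "j < k" for y j
  proof (cases "pY y = 0")
    case True
    then have "(\<Sum>j\<in>{0..<k}. ww j * v j y) = 0" using rp by simp
    then have "ww j * v j y = 0" using that ww0 v0
      by (subst (asm) sum_nonneg_eq_0_iff) auto
    then show ?thesis using True by simp
  qed (simp add: Q_def)
  have Q: "is_pmf_on (Q y) {0..<k}" for y
    using \<open>k \<noteq> 0\<close> ww0 v0 pY_nonneg[of y] rp[of y]
    by (cases "pY y = 0")
      (auto simp: is_pmf_on_def Q_def of_bool_def sum.delta simp flip: sum_divide_distrib)
  have 1: "(\<lambda>y. pY y * Q y j) = (\<lambda>y. ww j * v j y)" if "j < k" for j using pQ[OF that] by auto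
  have "ent pY UNIV - I_UY1 m pz W1 k Q = a"
    unfolding I_UY1_hent using ra ww0 v0 by (simp add: 1 hent_scale)
  moreover have "H_Z_given_U m pz W1 k Q = b"
  proof -
    have "hent (KK (\<lambda>y. pY y * Q y j)) {0..<m} = ww j * hent (KK (v j)) {0..<m}" if j: "j < k" for j
    proof -
      have "KK (\<lambda>y. pY y * Q y j) = (\<lambda>z. ww j * KK (v j) z)" by (rule ext) (simp add: 1[OF j] KK_scale)
      moreover have "hent (\<lambda>z. ww j * KK (v j) z) {0..<m} = ww j * hent (KK (v j)) {0..<m}"
        by (rule hent_scale) (use ww0[OF j] v0[OF j] KK_nonneg in auto)
      ultimately show ?thesis by simp
    qed
    then show ?thesis unfolding H_Z_given_U_hent using rb by simp
  qed
  ultimately show ?thesis using k Q by blast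
qed

lemma optimal_point_exists:
  obtains a b where "((\<chi> y. pY y), a, b) \<in> region" "ent pY UNIV - R0 Wr \<le> a"
    "\<And>a' b'. ((\<chi> y. pY y), a', b') \<in> region \<Longrightarrow> ent pY UNIV - R0 Wr \<le> a' \<Longrightarrow> b \<le> b'"
proof -
  define C where "C = region \<inter> ({x. fst x = (\<chi> y. pY y)} \<inter> {x. ent pY UNIV - R0 Wr \<le> fst (snd x)})"
  have "compact C"
    unfolding C_def
    by (intro compact_Int_closed compact_region closed_Int closed_Collect_eq closed_Collect_le continuous_intros)
  \<comment> \<open>A constant \<open>U\<close> is feasible: then \<open>H(Y1 | U) = H(Y1)\<close>,
    and \<open>R0\<close> is nonnegative.\<close>
  moreover have "psi pY \<in> C"
    using pY_pmf R0_nonneg[of Wr] Wr_pmf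
    by (auto simp: C_def region_def psi_def hent_pmf intro!: hull_inc)
  moreover have cont: "continuous_on C (\<lambda>x. snd (snd x))" by (intro continuous_intros)
  ultimately obtain x where x: "x \<in> C" "\<And>y. y \<in> C \<Longrightarrow> snd (snd x) \<le> snd (snd y)"
    using continuous_attains_inf[of C "\<lambda>x. snd (snd x)"] cont by blast
  show ?thesis
  proof (rule that[of "fst (snd x)" "snd (snd x)"])
    show "((\<chi> y. pY y), fst (snd x), snd (snd x)) \<in> region" "ent pY UNIV - R0 Wr \<le> fst (snd x)"
      using x(1) by (cases x; auto simp: C_def)+
    show "snd (snd x) \<le> b'" if "((\<chi> y. pY y), a', b') \<in> region" "ent pY UNIV - R0 Wr \<le> a'" for a' b'
      using x(2)[of "((\<chi> y. pY y), a', b')"] that by (auto simp: C_def)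
  qed
qed

text \<open>Averages the points of \<open>region_single_letter\<close> over the values
  \<open>s\<close> of \<open>S^n\<close>; convexity keeps the average in \<open>region\<close>. Its
  first coordinate is again \<open>pY\<close>, the second is controlled by
  \<open>relay_information_bound\<close>, and the third inherits the bound by
  \<open>H(Z^n | S^n)\<close>.\<close>

lemma code_point_in_region:
  assumes n: "0 < n"
  shows "\<exists>a b. ((\<chi> y. pY y), a, b) \<in> region \<and> ent pY UNIV - R0 Wr \<le> a \<and>
    real n * b \<le> (\<Sum>s\<in>seqs n UNIV. hent (ZS_law n f s) (seqs n {0..<m}))"
proof -
  let ?I = "{0..<n}"
  let ?Z = "PiE ?I (\<lambda>_. {0..<m})" and ?S = "PiE ?I (\<lambda>_. UNIV :: 's set)"
    and ?Y = "PiE ?I (\<lambda>_. UNIV :: 'y1 set)"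
  define PP where "PP y = (\<Prod>i\<in>?I. pY (y i))" for y
  define V where "V y s = (\<Prod>i\<in>?I. Wr (f i y) (s i))" for y s
  define a where "a s y = PP y * V y s" for s y
  have a0: "0 \<le> a s y" for s y
    unfolding a_def PP_def V_def by (intro mult_nonneg_nonneg prod_nonneg) (auto simp: pY_nonneg Wr_nonneg)
  have Vsum: "sum (V y) ?S = 1" for y
    unfolding V_def by (rule sum_PiE_prod_eq_1) (auto simp: Wr_sum)
  have PPsum: "sum PP ?Y = 1"
    unfolding PP_def by (rule sum_PiE_prod_eq_1) (auto simp: pY_sum)
  have fS: "finite ?S" by (auto intro: finite_PiE)
  have ZS: "(\<Sum>y\<in>?Y. a s y * (\<Prod>i\<in>?I. K (z i) (y i))) = ZS_law n f s z" if z: "z \<in> ?Z" for z s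
  proof -
    have "PP y * (\<Prod>i\<in>?I. K (z i) (y i)) = (\<Prod>i\<in>?I. pz (z i) * W1 (z i) (y i))" for y
      unfolding PP_def prod.distrib[symmetric]
      by (intro prod.cong refl pY_mult_K) (use z in \<open>auto simp: PiE_iff\<close>)
    then have "PP y * (\<Prod>i\<in>?I. K (z i) (y i)) * V y s = block_law n f z y s" for y
      by (simp add: block_law_def V_def prod.distrib)
    then have "a s y * (\<Prod>i\<in>?I. K (z i) (y i)) = block_law n f z y s" for y
      by (simp add: a_def mult_ac)
    then show ?thesis by (simp add: ZS_law_def)
  qed
  define P where "P s c g \<longleftrightarrow> c \<in> region \<and> g \<le> hent (ZS_law n f s) ?Z \<and> (real n * sum (a s) ?Y) *\<^sub>R c =
      ((\<chi> y'. \<Sum>i\<in>?I. \<Sum>y\<in>?Y. a s y * of_bool (y i = y')), hent (a s) ?Y, g)" for s c g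
  have "\<exists>c g. P s c g" for s
  proof -
    have "hent (\<lambda>z. \<Sum>y\<in>?Y. a s y * (\<Prod>i\<in>?I. K (z i) (y i))) ?Z = hent (ZS_law n f s) ?Z"
      by (rule hent_cong) (rule ZS)
    moreover have "\<exists>c\<in>region. \<exists>g. g \<le> hent (\<lambda>z. \<Sum>y\<in>?Y. a s y * (\<Prod>i\<in>?I. K (z i) (y i))) ?Z
        \<and> (real (card ?I) * sum (a s) ?Y) *\<^sub>R c =
       ((\<chi> y'. \<Sum>i\<in>?I. \<Sum>y\<in>?Y. a s y * of_bool (y i = y')), hent (a s) ?Y, g)"
      by (rule region_single_letter) (use a0 in auto)
    ultimately obtain c g where "c \<in> region" "g \<le> hent (ZS_law n f s) ?Z"
      "(real (card ?I) * sum (a s) ?Y) *\<^sub>R c =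
       ((\<chi> y'. \<Sum>i\<in>?I. \<Sum>y\<in>?Y. a s y * of_bool (y i = y')), hent (a s) ?Y, g)" by auto
    then have "P s c g" unfolding P_def card_atLeastLessThan diff_zero by blast
    then show ?thesis by blast
  qed
  then obtain c g where cg: "\<And>s. P s (c s) (g s)" by metis
  obtain c' where c': "c' \<in> region"
    "(\<Sum>s\<in>?S. (real n * sum (a s) ?Y) *\<^sub>R c s) = (\<Sum>s\<in>?S. real n * sum (a s) ?Y) *\<^sub>R c'"
    using convex_cone_sum[OF convex_region region_nonempty fS, of "\<lambda>s. real n * sum (a s) ?Y" c] cg a0
    by (auto simp: P_def sum_nonneg)
  have as: "(\<Sum>s\<in>?S. a s y) = PP y" for y by (simp add: a_def Vsum flip: sum_distrib_left)
  have "(\<Sum>s\<in>?S. sum (a s) ?Y) = 1"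
    by (subst sum.swap) (simp add: as PPsum)
  then have "real n *\<^sub>R c' = (\<Sum>s\<in>?S. (real n * sum (a s) ?Y) *\<^sub>R c s)"
    using c'(2) by (simp flip: sum_distrib_left)
  also have "... = (\<Sum>s\<in>?S. ((\<chi> y'. \<Sum>i\<in>?I. \<Sum>y\<in>?Y. a s y * of_bool (y i = y')), hent (a s) ?Y, g s))"
    using cg by (intro sum.cong refl) (simp add: P_def)
  finally have eq: "real n *\<^sub>R c' = (\<Sum>s\<in>?S. ((\<chi> y'. \<Sum>i\<in>?I. \<Sum>y\<in>?Y. a s y * of_bool (y i = y')), hent (a s) ?Y, g s))" .
  have "fst c' $ y' = pY y'" for y'
  proof -
    have "real n * fst c' $ y' = (\<Sum>s\<in>?S. \<Sum>i\<in>?I. \<Sum>y\<in>?Y. a s y * of_bool (y i = y'))"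
      using arg_cong[OF eq, of "\<lambda>x. fst x $ y'"] by (simp add: fst_sum)
    also have "... = (\<Sum>i\<in>?I. \<Sum>s\<in>?S. \<Sum>y\<in>?Y. a s y * of_bool (y i = y'))" by (rule sum.swap)
    also have "... = (\<Sum>i\<in>?I. \<Sum>y\<in>?Y. \<Sum>s\<in>?S. a s y * of_bool (y i = y'))"
      by (intro sum.cong refl sum.swap)
    also have "... = (\<Sum>i\<in>?I. \<Sum>y\<in>?Y. PP y * of_bool (y i = y'))"
      by (simp only: as flip: sum_distrib_right)
    also have "... = (\<Sum>i\<in>?I. \<Sum>t\<in>UNIV. pY t * of_bool (t = y'))"
      unfolding PP_def by (intro sum.cong refl sum_PiE_prod_marginal) (auto simp: pY_sum)
    also have "... = real n * pY y'" by simp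
    finally show ?thesis using n by simp
  qed
  then have "fst c' = (\<chi> y. pY y)" by (simp add: vec_eq_iff)
  moreover have "ent pY UNIV - R0 Wr \<le> fst (snd c')"
  proof -
    have "real n * fst (snd c') = (\<Sum>s\<in>?S. hent (a s) ?Y)"
      using arg_cong[OF eq, of "\<lambda>x. fst (snd x)"] by (simp add: fst_sum snd_sum)
    then have "real n * (ent pY UNIV - R0 Wr) \<le> real n * fst (snd c')"
      using relay_information_bound[of n f] unfolding a_def[abs_def] PP_def V_def by simp
    then show ?thesis using n by simp
  qed
  moreover have "real n * snd (snd c') \<le> (\<Sum>s\<in>?S. hent (ZS_law n f s) ?Z)"
  proof -
    have "real n * snd (snd c') = sum g ?S"
      using arg_cong[OF eq, of "\<lambda>x. snd (snd x)"] by (simp add: snd_sum)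
    also have "... \<le> (\<Sum>s\<in>?S. hent (ZS_law n f s) ?Z)"
      using cg by (intro sum_mono) (simp add: P_def)
    finally show ?thesis .
  qed
  ultimately show ?thesis using c'(1)
    by (cases c') auto
qed

text \<open>Fano's inequality divided by \<open>n\<close>, with the entropy replaced by the point of
  \<open>code_point_in_region\<close>; the error and the term \<open>1 / n\<close> disappear in the
  limit.\<close>

lemma converse:
  assumes R: "achievable m pz W1 Wr R"
    and b: "\<And>a' b'. ((\<chi> y. pY y), a', b') \<in> region \<Longrightarrow> ent pY UNIV - R0 Wr \<le> a' \<Longrightarrow> b \<le> b'"
  shows "R \<le> log 2 (real m) - b"
proof -
  obtain enc f g where lim: "(\<lambda>n. err_prob m pz W1 Wr n (num_msgs n R) (enc n) (f n) (g n)) \<longlonglongrightarrow> 0"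
    using R unfolding achievable_def by blast
  define e where "e n = err_prob m pz W1 Wr n (num_msgs n R) (enc n) (f n) (g n)" for n
  have lim: "e \<longlonglongrightarrow> 0" using lim unfolding e_def .
  have bound: "(1 - e n) * R - 1 / real n \<le> log 2 (real m) - b" if n: "0 < n" and e: "e n < 1" for n
  proof -
    obtain a' b' where ab: "((\<chi> y. pY y), a', b') \<in> region" "ent pY UNIV - R0 Wr \<le> a'"
      "real n * b' \<le> (\<Sum>s\<in>seqs n UNIV. hent (ZS_law n (f n) s) (seqs n {0..<m}))"
      using code_point_in_region[OF n, of "f n"] by blast
    have "real n * R \<le> log 2 (real (num_msgs n R))"
      using num_msgs_ge[where n=n and R=R] by (subst le_log_iff) auto
    then have "(1 - e n) * (real n * R) \<le> (1 - e n) * log 2 (real (num_msgs n R))"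
      using e by (intro mult_left_mono) auto
    also have "... \<le> real n * log 2 (real m) - real n * b' + 1"
      using fano_bound[OF num_msgs_ge(2)[where n=n and R=R], of n "enc n" "f n" "g n"] ab(3) unfolding e_def by linarith
    also have "... \<le> real n * (log 2 (real m) - b) + 1"
      using b[OF ab(1,2)] n by (simp add: right_diff_distrib)
    finally have "real n * ((1 - e n) * R) - 1 \<le> real n * (log 2 (real m) - b)" by (simp add: algebra_simps)
    then have "(real n * ((1 - e n) * R) - 1) / real n \<le> (real n * (log 2 (real m) - b)) / real n"
      by (intro divide_right_mono) auto
    then show ?thesis using n by (simp add: diff_divide_distrib)
  qed
  have "eventually (\<lambda>n. e n < 1) sequentially" using lim by (rule order_tendstoD) simp
  then have "eventually (\<lambda>n. (1 - e n) * R - 1 / real n \<le> log 2 (real m) - b) sequentially"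
    using eventually_gt_at_top[of 0] by eventually_elim (rule bound)
  moreover have "(\<lambda>n. (1 - e n) * R - 1 / real n) \<longlonglongrightarrow> (1 - 0) * R - 0"
    by (intro tendsto_intros lim lim_1_over_n)
  ultimately show ?thesis
    by (intro tendsto_upperbound[of _ R]) auto
qed

end

section \<open>Feinstein and covering lemmas\<close>

lemma exists_ge_average:
  fixes F :: "'x \<Rightarrow> real"
  assumes "finite X" "\<And>x. x \<in> X \<Longrightarrow> 0 \<le> P x" "sum P X = 1" "r \<le> (\<Sum>x\<in>X. P x * F x)"
  shows "\<exists>x\<in>X. r \<le> F x"
proof -
  have "X \<noteq> {}" using assms(3) by auto
  then have "Max (F ` X) \<in> F ` X" using assms(1) by simp
  then obtain x where x: "Max (F ` X) = F x" "x \<in> X" by (rule imageE)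
  have "(\<Sum>x\<in>X. P x * F x) \<le> (\<Sum>x\<in>X. P x * Max (F ` X))"
    using assms by (intro sum_mono mult_left_mono) auto
  also have "... = Max (F ` X)" using assms(3) by (simp flip: sum_distrib_right)
  finally show ?thesis using assms(4) x by (intro bexI[of _ x]) auto
qed

lemma exists_le_average:
  fixes F :: "'x \<Rightarrow> real"
  assumes "finite X" "\<And>x. x \<in> X \<Longrightarrow> 0 \<le> P x" "sum P X = 1" "(\<Sum>x\<in>X. P x * F x) \<le> r"
  shows "\<exists>x\<in>X. F x \<le> r"
  using exists_ge_average[of X P "- r" "\<lambda>x. - F x"] assms by (auto simp: sum_negf)

text \<open>Codewords are added greedily; averaging over \<open>P\<close> shows that one more codeword fits as long as the
  decoding regions used so far have average probability at most \<open>M * \<beta>\<close>.\<close>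
lemma feinstein:
  fixes P :: "'x \<Rightarrow> real" and W :: "'x \<Rightarrow> 'w \<Rightarrow> real" and out :: "'x \<Rightarrow> 'w \<Rightarrow> 'o"
  assumes X: "finite X" "\<And>x. x \<in> X \<Longrightarrow> 0 \<le> P x" "sum P X = 1"
    and W: "\<And>x e. x \<in> X \<Longrightarrow> e \<in> \<Omega> \<Longrightarrow> 0 \<le> W x e"
    and good: "1 - \<eta> \<le> (\<Sum>x\<in>X. P x * (\<Sum>e\<in>\<Omega>. W x e * of_bool (out x e \<in> D x)))"
    and bad: "\<And>x'. x' \<in> X \<Longrightarrow> (\<Sum>x\<in>X. P x * (\<Sum>e\<in>\<Omega>. W x e * of_bool (out x e \<in> D x'))) \<le> \<beta>"
    and \<beta>: "0 \<le> \<beta>"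
  shows "\<exists>c g. \<forall>w\<in>{1..M::nat}. c w \<in> X \<and>
    1 - \<eta> - real M * \<beta> \<le> (\<Sum>e\<in>\<Omega>. W (c w) e * of_bool (g (out (c w) e) = w))"
proof -
  \<comment> \<open>Strengthened for the induction: \<open>g\<close> is 0 exactly on outputs not yet
    assigned, so the last conjunct bounds the average probability of the used regions, and
    \<open>g y \<le> M\<close> makes \<open>Suc M\<close> a fresh label.\<close>
  have "\<exists>c g. (\<forall>w\<in>{1..M}. c w \<in> X \<and>
      1 - \<eta> - real M * \<beta> \<le> (\<Sum>e\<in>\<Omega>. W (c w) e * of_bool (g (out (c w) e) = w)))
    \<and> (\<forall>y. g y \<le> M) \<and> (\<Sum>x\<in>X. P x * (\<Sum>e\<in>\<Omega>. W x e * of_bool (g (out x e) \<noteq> 0))) \<le> real M * \<beta>"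
  proof (induction M)
    case 0
    show ?case by (intro exI[of _ undefined] exI[of _ "\<lambda>_. 0"]) auto
  next
    case (Suc M)
    then obtain c g where cg: "\<And>w. w \<in> {1..M} \<Longrightarrow> c w \<in> X"
      "\<And>w. w \<in> {1..M} \<Longrightarrow> 1 - \<eta> - real M * \<beta> \<le> (\<Sum>e\<in>\<Omega>. W (c w) e * of_bool (g (out (c w) e) = w))"
      "\<And>y. g y \<le> M" "(\<Sum>x\<in>X. P x * (\<Sum>e\<in>\<Omega>. W x e * of_bool (g (out x e) \<noteq> 0))) \<le> real M * \<beta>"
      by blast
    have "1 - \<eta> - real M * \<beta> \<le> (\<Sum>x\<in>X. P x * (\<Sum>e\<in>\<Omega>. W x e * of_bool (out x e \<in> D x)))
       - (\<Sum>x\<in>X. P x * (\<Sum>e\<in>\<Omega>. W x e * of_bool (g (out x e) \<noteq> 0)))"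
      using good cg(4) by linarith
    also have "... = (\<Sum>x\<in>X. P x * (\<Sum>e\<in>\<Omega>. W x e * (of_bool (out x e \<in> D x) - of_bool (g (out x e) \<noteq> 0))))"
      by (simp add: right_diff_distrib sum_subtractf)
    also have "... \<le> (\<Sum>x\<in>X. P x * (\<Sum>e\<in>\<Omega>. W x e * of_bool (out x e \<in> D x \<and> g (out x e) = 0)))"
      by (intro sum_mono mult_left_mono) (use X W in auto)
    finally obtain x where x: "x \<in> X"
      "1 - \<eta> - real M * \<beta> \<le> (\<Sum>e\<in>\<Omega>. W x e * of_bool (out x e \<in> D x \<and> g (out x e) = 0))"
      using exists_ge_average[of X P "1 - \<eta> - real M * \<beta>"
          "\<lambda>x. \<Sum>e\<in>\<Omega>. W x e * of_bool (out x e \<in> D x \<and> g (out x e) = 0)"] X by blast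
    define c' where "c' = c(Suc M := x)"
    \<comment> \<open>The new codeword takes only the unassigned part of \<open>D x\<close>, which
      leaves the earlier regions intact.\<close>
    define g' where "g' y = (if y \<in> D x \<and> g y = 0 then Suc M else g y)" for y
    have c'X: "c' w \<in> X" if "w \<in> {1..Suc M}" for w
      using that cg(1) x(1) by (cases "w = Suc M") (auto simp: c'_def)
    have "1 - \<eta> - real M * \<beta> \<le> (\<Sum>e\<in>\<Omega>. W (c' w) e * of_bool (g' (out (c' w) e) = w))"
      if w: "w \<in> {1..Suc M}" for w
    proof (cases "w = Suc M")
      case True
      have "(\<Sum>e\<in>\<Omega>. W x e * of_bool (out x e \<in> D x \<and> g (out x e) = 0)) \<le> (\<Sum>e\<in>\<Omega>. W x e * of_bool (g' (out x e) = Suc M))"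
        by (intro sum_mono mult_left_mono) (use x W in \<open>auto simp: g'_def\<close>)
      then show ?thesis using x(2) True by (simp add: c'_def)
    next
      case False
      then have w': "w \<in> {1..M}" using w by auto
      have "(\<Sum>e\<in>\<Omega>. W (c w) e * of_bool (g (out (c w) e) = w)) \<le> (\<Sum>e\<in>\<Omega>. W (c w) e * of_bool (g' (out (c w) e) = w))"
        by (intro sum_mono mult_left_mono) (use cg(1)[OF w'] W w' in \<open>auto simp: g'_def\<close>)
      then show ?thesis using cg(2)[OF w'] False by (simp add: c'_def)
    qed
    then have 1: "1 - \<eta> - real (Suc M) * \<beta> \<le> (\<Sum>e\<in>\<Omega>. W (c' w) e * of_bool (g' (out (c' w) e) = w))"
      if "w \<in> {1..Suc M}" for w
      using that \<beta> by (fastforce simp: algebra_simps)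
    have "(\<Sum>x'\<in>X. P x' * (\<Sum>e\<in>\<Omega>. W x' e * of_bool (g' (out x' e) \<noteq> 0)))
      \<le> (\<Sum>x'\<in>X. P x' * (\<Sum>e\<in>\<Omega>. W x' e * (of_bool (g (out x' e) \<noteq> 0) + of_bool (out x' e \<in> D x))))"
      by (intro sum_mono mult_left_mono) (use X W in \<open>auto simp: g'_def\<close>)
    also have "... = (\<Sum>x'\<in>X. P x' * (\<Sum>e\<in>\<Omega>. W x' e * of_bool (g (out x' e) \<noteq> 0)))
       + (\<Sum>x'\<in>X. P x' * (\<Sum>e\<in>\<Omega>. W x' e * of_bool (out x' e \<in> D x)))"
      by (simp add: distrib_left sum.distrib)
    also have "... \<le> real (Suc M) * \<beta>"
      using cg(4) bad[OF x(1)] by (simp add: algebra_simps)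
    finally have 2: "(\<Sum>x'\<in>X. P x' * (\<Sum>e\<in>\<Omega>. W x' e * of_bool (g' (out x' e) \<noteq> 0))) \<le> real (Suc M) * \<beta>" .
    have "\<forall>y. g' y \<le> Suc M" using cg(3) by (auto simp: g'_def le_SucI)
    then show ?case using 1 2 c'X by blast
  qed
  then show ?thesis by blast
qed

text \<open>Convexity of \<open>exp\<close> between 0 and \<open>x\<close>, obtained from the
  tangent at \<open>t * x\<close> evaluated at both ends.\<close>

lemma exp_convex_bound:
  fixes x t :: real
  assumes "0 \<le> t" "t \<le> 1"
  shows "exp (t * x) \<le> (1 - t) + t * exp x"
proof -
  define E where "E = exp (t * x)"
  have "E * (1 - t * x) \<le> 1"
    using mult_left_mono[OF exp_ge_add_one_self[of "- (t * x)"], of E]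
    by (simp add: E_def flip: exp_add)
  moreover have "E * (1 + (x - t * x)) \<le> exp x"
    using mult_left_mono[OF exp_ge_add_one_self[of "x - t * x"], of E]
    by (simp add: E_def flip: exp_add)
  ultimately have "(1 - t) * (E * (1 - t * x)) + t * (E * (1 + (x - t * x))) \<le> (1 - t) * 1 + t * exp x"
    using assms by (intro add_mono mult_left_mono) auto
  moreover have "(1 - t) * (E * (1 - t * x)) + t * (E * (1 + (x - t * x))) = E"
    by (simp add: algebra_simps)
  ultimately show ?thesis by (simp add: E_def)
qed

text \<open>Derandomised random covering: each of the \<open>M\<close> codewords is chosen no worse than its average.\<close>
lemma covering:
  fixes w :: "'y \<Rightarrow> real" and q :: "'u \<Rightarrow> real"
  assumes Y: "finite Y" and U: "finite U" "\<And>u. u \<in> U \<Longrightarrow> 0 \<le> q u" "sum q U = 1"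
    and w: "\<And>y. y \<in> Y \<Longrightarrow> 0 \<le> w y"
  shows "\<exists>c. (\<forall>j. c j \<in> U) \<and> (\<Sum>y\<in>Y. w y * of_bool (\<forall>j<M. \<not> G y (c j)))
    \<le> (\<Sum>y\<in>Y. w y * (1 - (\<Sum>u\<in>U. q u * of_bool (G y u))) ^ M)"
  using w
proof (induction M arbitrary: w)
  case 0
  obtain u where "u \<in> U" using U(3) by (metis all_not_in_conv sum.empty zero_neq_one)
  then show ?case by (intro exI[of _ "\<lambda>_. u"]) auto
next
  case (Suc M)
  define h where "h y = (\<Sum>u\<in>U. q u * of_bool (G y u))" for y
  have h: "(\<Sum>u\<in>U. q u * of_bool (\<not> G y u)) = 1 - h y" for y
  proof -
    have "(\<Sum>u\<in>U. q u * of_bool (\<not> G y u)) = (\<Sum>u\<in>U. q u - q u * of_bool (G y u))"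
      by (intro sum.cong) auto
    then show ?thesis using U(3) by (simp add: h_def sum_subtractf)
  qed
  have "(\<Sum>u\<in>U. q u * (\<Sum>y\<in>Y. w y * of_bool (\<not> G y u) * (1 - h y) ^ M))
      = (\<Sum>u\<in>U. \<Sum>y\<in>Y. w y * (1 - h y) ^ M * (q u * of_bool (\<not> G y u)))"
    by (simp add: sum_distrib_left mult_ac)
  also have "... = (\<Sum>y\<in>Y. \<Sum>u\<in>U. w y * (1 - h y) ^ M * (q u * of_bool (\<not> G y u)))"
    by (rule sum.swap)
  also have "... = (\<Sum>y\<in>Y. w y * (1 - h y) ^ Suc M)"
    unfolding sum_distrib_left[symmetric] h by (simp add: mult_ac)
  finally obtain u where u: "u \<in> U"
    "(\<Sum>y\<in>Y. w y * of_bool (\<not> G y u) * (1 - h y) ^ M) \<le> (\<Sum>y\<in>Y. w y * (1 - h y) ^ Suc M)"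
    using exists_le_average[of U q "\<lambda>u. \<Sum>y\<in>Y. w y * of_bool (\<not> G y u) * (1 - h y) ^ M" "\<Sum>y\<in>Y. w y * (1 - h y) ^ Suc M"] U by auto
  \<comment> \<open>The remaining codewords have to cover only what \<open>u\<close> misses, so the
    induction hypothesis is applied to the weight restricted to those \<open>y\<close>.\<close>
  obtain c where c: "\<And>j. c j \<in> U" "(\<Sum>y\<in>Y. (w y * of_bool (\<not> G y u)) * of_bool (\<forall>j<M. \<not> G y (c j)))
    \<le> (\<Sum>y\<in>Y. w y * of_bool (\<not> G y u) * (1 - h y) ^ M)"
    using Suc.IH[of "\<lambda>y. w y * of_bool (\<not> G y u)"] Suc.prems unfolding h_def by auto
  define c' where "c' = case_nat u c"
  have "(\<forall>j<Suc M. \<not> G y (c' j)) \<longleftrightarrow> \<not> G y u \<and> (\<forall>j<M. \<not> G y (c j))" for y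
    unfolding c'_def by (auto simp: All_less_Suc2)
  then have "(\<Sum>y\<in>Y. w y * of_bool (\<forall>j<Suc M. \<not> G y (c' j)))
     = (\<Sum>y\<in>Y. (w y * of_bool (\<not> G y u)) * of_bool (\<forall>j<M. \<not> G y (c j)))"
    by (intro sum.cong) auto
  moreover have "c' j \<in> U" for j using c(1) u(1) by (auto simp: c'_def split: nat.split)
  ultimately show ?case using c(2) u(2) unfolding h_def by (intro exI[of _ c']) auto
qed

text \<open>Let \<open>t\<close> be the probability under \<open>Q y\<close> of the good
  \<open>u\<close>. Under \<open>q\<close> it is at least \<open>a * t\<close>, so \<open>M\<close>
  random codewords all fail with probability at most \<open>exp (- t * M * a)\<close>, and convexity
  bounds this by \<open>1 - t\<close> plus \<open>exp (- M * a)\<close>.\<close>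

lemma covering_bound:
  fixes p :: "'y \<Rightarrow> real" and q :: "'u \<Rightarrow> real" and Q :: "'y \<Rightarrow> 'u \<Rightarrow> real"
  assumes Y: "finite Y" "\<And>y. y \<in> Y \<Longrightarrow> 0 \<le> p y" "sum p Y = 1"
    and U: "finite U" "\<And>u. u \<in> U \<Longrightarrow> 0 \<le> q u" "sum q U = 1"
    and Q: "\<And>y u. y \<in> Y \<Longrightarrow> u \<in> U \<Longrightarrow> 0 \<le> Q y u" "\<And>y. y \<in> Y \<Longrightarrow> sum (Q y) U = 1"
    and a: "0 < a" "\<And>y u. y \<in> Y \<Longrightarrow> u \<in> U \<Longrightarrow> G y u \<Longrightarrow> a * Q y u \<le> q u"
  shows "\<exists>c. (\<forall>j. c j \<in> U) \<and> (\<Sum>y\<in>Y. p y * of_bool (\<forall>j<M. \<not> G y (c j)))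
    \<le> (\<Sum>y\<in>Y. \<Sum>u\<in>U. p y * Q y u * of_bool (\<not> G y u)) + exp (- (real M * a))"
proof -
  define E where "E = exp (- (real M * a))"
  have *: "(1 - (\<Sum>u\<in>U. q u * of_bool (G y u))) ^ M \<le> (\<Sum>u\<in>U. Q y u * of_bool (\<not> G y u)) + E"
    if y: "y \<in> Y" for y
  proof -
    define t where "t = (\<Sum>u\<in>U. Q y u * of_bool (G y u))"
    define h where "h = (\<Sum>u\<in>U. q u * of_bool (G y u))"
    have nt: "(\<Sum>u\<in>U. Q y u * of_bool (\<not> G y u)) = 1 - t"
    proof -
      have "(\<Sum>u\<in>U. Q y u * of_bool (\<not> G y u)) = (\<Sum>u\<in>U. Q y u - Q y u * of_bool (G y u))"
        by (intro sum.cong) auto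
      then show ?thesis using Q(2)[OF y] by (simp add: t_def sum_subtractf)
    qed
    have t0: "0 \<le> t" unfolding t_def by (intro sum_nonneg) (use Q y in auto)
    have "0 \<le> (\<Sum>u\<in>U. Q y u * of_bool (\<not> G y u))" by (intro sum_nonneg) (use Q y in auto)
    then have t1: "t \<le> 1" using nt by simp
    have "h \<le> sum q U" unfolding h_def by (intro sum_mono) (use U in auto)
    then have h1: "h \<le> 1" using U(3) by simp
    have ha: "a * t \<le> h" unfolding h_def t_def sum_distrib_left
      by (intro sum_mono) (use a y in auto)
    have "(1 - h) ^ M \<le> exp (- h) ^ M"
      using h1 exp_ge_add_one_self[of "- h"] by (intro power_mono) auto
    also have "... = exp (- (real M * h))" by (simp add: exp_of_nat_mult[symmetric])
    also have "... \<le> exp (t * (- (real M * a)))"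
      using mult_left_mono[OF ha, of "real M"] by (simp add: mult_ac)
    also have "... \<le> (1 - t) + t * exp (- (real M * a))"
      by (rule exp_convex_bound[OF t0 t1])
    also have "... \<le> (1 - t) + E" using t1 t0 by (simp add: E_def mult_left_le_one_le)
    finally show ?thesis using nt by (simp add: h_def)
  qed
  obtain c where c: "\<forall>j. c j \<in> U" "(\<Sum>y\<in>Y. p y * of_bool (\<forall>j<M. \<not> G y (c j)))
    \<le> (\<Sum>y\<in>Y. p y * (1 - (\<Sum>u\<in>U. q u * of_bool (G y u))) ^ M)"
    using covering[of Y U q p M G] Y U by blast
  note c(2)
  also have "(\<Sum>y\<in>Y. p y * (1 - (\<Sum>u\<in>U. q u * of_bool (G y u))) ^ M)
     \<le> (\<Sum>y\<in>Y. p y * ((\<Sum>u\<in>U. Q y u * of_bool (\<not> G y u)) + E))"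
    by (intro sum_mono mult_left_mono * Y(2))
  also have "... = (\<Sum>y\<in>Y. \<Sum>u\<in>U. p y * Q y u * of_bool (\<not> G y u)) + E"
    using Y(3) by (simp add: distrib_left sum.distrib sum_distrib_left mult.assoc flip: sum_distrib_right)
  finally show ?thesis using c(1) unfolding E_def by blast
qed

section \<open>Chernoff bounds for memoryless pairs\<close>

lemma chernoff_exponent:
  fixes P f :: "'w \<Rightarrow> real"
  assumes "sum P \<Omega> = 1" "(\<Sum>e\<in>\<Omega>. P e * f e) < \<theta>"
  shows "\<exists>t>0. (\<Sum>e\<in>\<Omega>. P e * exp (t * (f e - \<theta>))) < 1"
proof -
  define F where "F t = (\<Sum>e\<in>\<Omega>. P e * exp (t * (f e - \<theta>)))" for t
  \<comment> \<open>\<open>F\<close> is the exponential moment of the excess over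
    \<open>\<theta>\<close>. It equals 1 at 0, and its derivative there is the mean minus
    \<open>\<theta>\<close>, which is negative.\<close>
  have "(F has_real_derivative (\<Sum>e\<in>\<Omega>. P e * (exp (0 * (f e - \<theta>)) * (f e - \<theta>)))) (at 0)"
    unfolding F_def by (auto intro!: derivative_eq_intros sum.cong)
  moreover have "(\<Sum>e\<in>\<Omega>. P e * (exp (0 * (f e - \<theta>)) * (f e - \<theta>))) < 0"
    using assms by (simp add: right_diff_distrib sum_subtractf flip: sum_distrib_right)
  ultimately obtain d where d: "d > 0" "\<forall>h>0. h < d \<longrightarrow> F (0 + h) < F 0"
    using DERIV_neg_dec_right by blast
  then have "F (d / 2) < F 0" by (auto dest!: spec[of _ "d / 2"])
  moreover have "F 0 = 1" using assms by (simp add: F_def)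
  ultimately show ?thesis using d unfolding F_def by (intro exI[of _ "d / 2"]) auto
qed

lemma sum_PiE_prod_pairs:
  fixes F :: "'a \<Rightarrow> 'b \<Rightarrow> real"
  assumes "finite A" "finite B" "finite I"
  shows "(\<Sum>x\<in>PiE I (\<lambda>_. A). \<Sum>y\<in>PiE I (\<lambda>_. B). \<Prod>t\<in>I. F (x t) (y t)) = (\<Sum>a\<in>A. \<Sum>b\<in>B. F a b) ^ card I"
proof -
  have "(\<Sum>y\<in>PiE I (\<lambda>_. B). \<Prod>t\<in>I. F (x t) (y t)) = (\<Prod>t\<in>I. \<Sum>b\<in>B. F (x t) b)" for x
    using assms by (intro prod_sum_PiE[symmetric]) auto
  moreover have "(\<Sum>x\<in>PiE I (\<lambda>_. A). \<Prod>t\<in>I. \<Sum>b\<in>B. F (x t) b) = (\<Prod>t\<in>I. \<Sum>a\<in>A. \<Sum>b\<in>B. F a b)"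
    using assms by (intro prod_sum_PiE[symmetric]) auto
  ultimately show ?thesis by simp
qed

text \<open>Markov's inequality for the exponential moment, which multiplies over the independent
  pairs; \<open>r\<close> is the moment of a single pair.\<close>

lemma chernoff_pairs:
  fixes w f :: "'a \<Rightarrow> 'b \<Rightarrow> real"
  assumes AB: "finite A" "finite B" and w: "\<And>a b. a \<in> A \<Longrightarrow> b \<in> B \<Longrightarrow> 0 \<le> w a b"
    and sum1: "(\<Sum>a\<in>A. \<Sum>b\<in>B. w a b) = 1"
    and mean: "(\<Sum>a\<in>A. \<Sum>b\<in>B. w a b * f a b) < \<theta>"
  shows "\<exists>r. 0 \<le> r \<and> r < 1 \<and> (\<forall>l. (\<Sum>x\<in>seqs l A. \<Sum>y\<in>seqs l B.
     (\<Prod>t\<in>{0..<l}. w (x t) (y t)) * of_bool (real l * \<theta> \<le> (\<Sum>t\<in>{0..<l}. f (x t) (y t)))) \<le> r ^ l)"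
proof -
  obtain t where t: "t > 0" "(\<Sum>(a,b)\<in>A \<times> B. w a b * exp (t * (f a b - \<theta>))) < 1"
    using chernoff_exponent[of "\<lambda>(a,b). w a b" "A \<times> B" "\<lambda>(a,b). f a b" \<theta>] sum1 mean
    by (auto simp: sum.cartesian_product' split_def)
  define r where "r = (\<Sum>a\<in>A. \<Sum>b\<in>B. w a b * exp (t * (f a b - \<theta>)))"
  have "r < 1" using t(2) by (simp add: r_def sum.cartesian_product')
  moreover have "0 \<le> r" unfolding r_def by (intro sum_nonneg mult_nonneg_nonneg) (use w in auto)
  moreover have "(\<Sum>x\<in>seqs l A. \<Sum>y\<in>seqs l B.
     (\<Prod>t\<in>{0..<l}. w (x t) (y t)) * of_bool (real l * \<theta> \<le> (\<Sum>t\<in>{0..<l}. f (x t) (y t)))) \<le> r ^ l" for l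
  proof -
    have "(\<Sum>x\<in>seqs l A. \<Sum>y\<in>seqs l B.
       (\<Prod>t\<in>{0..<l}. w (x t) (y t)) * of_bool (real l * \<theta> \<le> (\<Sum>t\<in>{0..<l}. f (x t) (y t))))
      \<le> (\<Sum>x\<in>seqs l A. \<Sum>y\<in>seqs l B.
       (\<Prod>t\<in>{0..<l}. w (x t) (y t)) * exp (t * ((\<Sum>t\<in>{0..<l}. f (x t) (y t)) - real l * \<theta>)))"
      using t(1) w by (intro sum_mono mult_left_mono prod_nonneg) (auto simp: PiE_iff of_bool_def)
    also have "... = (\<Sum>x\<in>seqs l A. \<Sum>y\<in>seqs l B.
        \<Prod>i\<in>{0..<l}. w (x i) (y i) * exp (t * (f (x i) (y i) - \<theta>)))"
    proof (intro sum.cong refl)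
      fix x y
      have "t * ((\<Sum>t\<in>{0..<l}. f (x t) (y t)) - real l * \<theta>) = (\<Sum>i\<in>{0..<l}. t * (f (x i) (y i) - \<theta>))"
        by (simp add: sum_subtractf flip: sum_distrib_left)
      then show "(\<Prod>t\<in>{0..<l}. w (x t) (y t)) * exp (t * ((\<Sum>t\<in>{0..<l}. f (x t) (y t)) - real l * \<theta>))
         = (\<Prod>i\<in>{0..<l}. w (x i) (y i) * exp (t * (f (x i) (y i) - \<theta>)))"
        by (simp only: exp_sum finite_atLeastLessThan prod.distrib)
    qed
    also have "... = r ^ card {0..<l}"
      unfolding r_def using AB by (intro sum_PiE_prod_pairs) auto
    finally show ?thesis by simp
  qed
  ultimately show ?thesis by blast
qed

section \<open>Channel and source coding\<close>

lemma prod_factor_pos: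
  fixes f :: "'i \<Rightarrow> real"
  assumes "finite I" "prod f I \<noteq> 0" "i \<in> I" "0 \<le> f i"
  shows "0 < f i"
  using assms by (metis less_eq_real_def prod_zero)

text \<open>Additivity of the information density. A nonzero joint probability makes every factor
  positive, so no logarithm is taken at 0.\<close>

lemma log_prod_ratio:
  fixes p :: "'a \<Rightarrow> real" and W :: "'a \<Rightarrow> 'b \<Rightarrow> real" and l :: nat
  assumes A: "finite A" "\<And>a. a \<in> A \<Longrightarrow> 0 \<le> p a" and W: "\<And>a b. a \<in> A \<Longrightarrow> b \<in> B \<Longrightarrow> 0 \<le> W a b"
    and xy: "x \<in> seqs l A" "y \<in> seqs l B"
    and nz: "(\<Prod>t\<in>{0..<l}. p (x t) * W (x t) (y t)) \<noteq> 0"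
  defines "q \<equiv> \<lambda>b. \<Sum>a\<in>A. p a * W a b"
  shows "0 < (\<Prod>t\<in>{0..<l}. W (x t) (y t))" "0 < (\<Prod>t\<in>{0..<l}. q (y t))"
    "log 2 (\<Prod>t\<in>{0..<l}. W (x t) (y t)) - log 2 (\<Prod>t\<in>{0..<l}. q (y t))
      = (\<Sum>t\<in>{0..<l}. log 2 (W (x t) (y t)) - log 2 (q (y t)))"
proof -
  have m: "x t \<in> A" "y t \<in> B" if "t < l" for t
    using PiE_mem[OF xy(1), of t] PiE_mem[OF xy(2), of t] that by auto
  have pw: "0 < p (x t) * W (x t) (y t)" if "t < l" for t
    by (rule prod_factor_pos[OF _ nz]) (use that m A W in auto)
  then have w: "0 < W (x t) (y t)" if "t < l" for t
    using that m[OF that] A(2) by (metis mult_eq_0_iff W less_eq_real_def)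
  have q: "0 < q (y t)" if "t < l" for t
    unfolding q_def using pw[OF that] m[OF that] A W by (intro sum_pos2[of A "x t"]) auto
  show "0 < (\<Prod>t\<in>{0..<l}. W (x t) (y t))" "0 < (\<Prod>t\<in>{0..<l}. q (y t))"
    using w q by (auto intro!: prod_pos)
  have "log 2 (\<Prod>t\<in>{0..<l}. W (x t) (y t)) = (\<Sum>t\<in>{0..<l}. log 2 (W (x t) (y t)))"
    by (rule log_prod) (use w in auto)
  moreover have "log 2 (\<Prod>t\<in>{0..<l}. q (y t)) = (\<Sum>t\<in>{0..<l}. log 2 (q (y t)))"
    by (rule log_prod) (use q in auto)
  ultimately show "log 2 (\<Prod>t\<in>{0..<l}. W (x t) (y t)) - log 2 (\<Prod>t\<in>{0..<l}. q (y t))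
      = (\<Sum>t\<in>{0..<l}. log 2 (W (x t) (y t)) - log 2 (q (y t)))"
    by (simp add: sum_subtractf)
qed

text \<open>Feinstein's lemma with a threshold on the information density. The density falls below
  \<open>l * (J - \<delta>)\<close> with exponentially small probability; above this threshold the
  output law \<open>qq\<close> is at most \<open>\<beta>\<close> times \<open>V x\<close>, which
  bounds the average probability of each decoding region by \<open>\<beta>\<close>.\<close>

lemma channel_coding:
  fixes W :: "'a::finite \<Rightarrow> 'b::finite \<Rightarrow> real"
  assumes p: "is_pmf_on p UNIV" and W: "\<And>a. is_pmf_on (W a) UNIV" and \<delta>: "0 < \<delta>"
  defines "J \<equiv> mutual_info p W UNIV UNIV"
  shows "\<exists>r. 0 \<le> r \<and> r < 1 \<and> (\<forall>l M. \<exists>c g. \<forall>w\<in>{1..M::nat}.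
    1 - r ^ l - real M * 2 powr (- (real l * (J - \<delta>)))
      \<le> (\<Sum>s\<in>seqs l UNIV. (\<Prod>t\<in>{0..<l}. W (c w t) (s t)) * of_bool (g s = w)))"
proof -
  have p0: "0 \<le> p a" and ps: "sum p UNIV = 1" and W0: "0 \<le> W a b" and Ws: "sum (W a) UNIV = 1" for a b
    using p W by (auto simp: is_pmf_on_def)
  define q where "q b = (\<Sum>a\<in>UNIV. p a * W a b)" for b
  \<comment> \<open>The negated information density, so that too small a density becomes an upper
    tail; its mean \<open>- J\<close> lies below the threshold \<open>\<delta> - J\<close>.\<close>
  define f where "f a b = log 2 (q b) - log 2 (W a b)" for a b
  have mean: "(\<Sum>a\<in>UNIV. \<Sum>b\<in>UNIV. p a * W a b * f a b) = - J"
  proof -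
    have "J = (\<Sum>a\<in>UNIV. \<Sum>b\<in>UNIV. p a * W a b * (log 2 (W a b) - log 2 (q b)))"
      unfolding J_def q_def using p0 W by (intro mutual_info_eq) auto
    then show ?thesis by (simp add: f_def right_diff_distrib sum_subtractf)
  qed
  have sum1: "(\<Sum>a\<in>UNIV. \<Sum>b\<in>UNIV. p a * W a b) = 1"
    by (simp add: Ws ps flip: sum_distrib_left)
  obtain r where r: "0 \<le> r" "r < 1" "\<And>l. (\<Sum>x\<in>seqs l UNIV. \<Sum>y\<in>seqs l UNIV.
     (\<Prod>t\<in>{0..<l}. p (x t) * W (x t) (y t)) * of_bool (real l * (\<delta> - J) \<le> (\<Sum>t\<in>{0..<l}. f (x t) (y t)))) \<le> r ^ l"
    using chernoff_pairs[of UNIV UNIV "\<lambda>a b. p a * W a b" f "\<delta> - J"] p0 W0 sum1 mean \<delta> by auto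
  have "\<exists>c g. \<forall>w\<in>{1..M}. 1 - r ^ l - real M * 2 powr (- (real l * (J - \<delta>)))
      \<le> (\<Sum>s\<in>seqs l UNIV. (\<Prod>t\<in>{0..<l}. W (c w t) (s t)) * of_bool (g s = w))" for l M :: nat
  proof -
    let ?X = "seqs l (UNIV :: 'a set)" and ?S = "seqs l (UNIV :: 'b set)"
    define P where "P x = (\<Prod>t\<in>{0..<l}. p (x t))" for x
    define V where "V x s = (\<Prod>t\<in>{0..<l}. W (x t) (s t))" for x s
    define qq where "qq s = (\<Prod>t\<in>{0..<l}. q (s t))" for s
    define \<beta> where "\<beta> = 2 powr (- (real l * (J - \<delta>)))"
    define D where "D x = {s. qq s \<le> \<beta> * V x s}" for x
    have P0: "0 \<le> P x" and V0: "0 \<le> V x s" for x s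
      by (auto simp: P_def V_def intro!: prod_nonneg p0 W0)
    have Ps: "sum P ?X = 1" unfolding P_def by (rule sum_PiE_prod_eq_1) (auto simp: ps)
    have Vs: "sum (V x) ?S = 1" for x unfolding V_def by (rule sum_PiE_prod_eq_1) (auto simp: Ws)
    have PV: "P x * V x s = (\<Prod>t\<in>{0..<l}. p (x t) * W (x t) (s t))" for x s
      by (simp add: P_def V_def prod.distrib)
    have PVq: "(\<Sum>x\<in>?X. P x * V x s) = qq s" for s
      unfolding PV qq_def q_def by (rule prod_sum_PiE[symmetric]) auto
    have "(\<Sum>x\<in>?X. P x * (\<Sum>s\<in>?S. V x s * of_bool (s \<notin> D x))) \<le> r ^ l"
    proof -
      have "P x * V x s * of_bool (s \<notin> D x)
         \<le> (\<Prod>t\<in>{0..<l}. p (x t) * W (x t) (s t)) * of_bool (real l * (\<delta> - J) \<le> (\<Sum>t\<in>{0..<l}. f (x t) (s t)))"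
        if x: "x \<in> ?X" and s: "s \<in> ?S" for x s
      proof (cases "s \<notin> D x \<and> P x * V x s \<noteq> 0")
        case True
        then have nz: "(\<Prod>t\<in>{0..<l}. p (x t) * W (x t) (s t)) \<noteq> 0" using PV by simp
        note lr = log_prod_ratio[of UNIV p UNIV W, OF _ _ _ x s nz, folded q_def, folded V_def, folded qq_def]
        have V: "0 < V x s" "0 < qq s" and lg: "log 2 (V x s) - log 2 (qq s) = (\<Sum>t\<in>{0..<l}. log 2 (W (x t) (s t)) - log 2 (q (s t)))"
          using lr p0 W0 by auto
        have "\<beta> * V x s < qq s" using True by (auto simp: D_def)
        then have "log 2 (\<beta> * V x s) < log 2 (qq s)"
          using V by (subst log_less_cancel_iff) (auto simp: \<beta>_def)
        then have "- (real l * (J - \<delta>)) + log 2 (V x s) < log 2 (qq s)"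
          using V by (simp add: \<beta>_def log_mult)
        then have "real l * (\<delta> - J) \<le> - (\<Sum>t\<in>{0..<l}. log 2 (W (x t) (s t)) - log 2 (q (s t)))"
          using lg by (simp add: algebra_simps)
        also have "... = (\<Sum>t\<in>{0..<l}. f (x t) (s t))" by (simp add: f_def sum_subtractf)
        finally show ?thesis using PV True by simp
      next
        case False
        moreover have "0 \<le> (\<Prod>t\<in>{0..<l}. p (x t) * W (x t) (s t))" by (intro prod_nonneg) (auto simp: p0 W0)
        ultimately show ?thesis by auto
      qed
      then have "(\<Sum>x\<in>?X. \<Sum>s\<in>?S. P x * V x s * of_bool (s \<notin> D x)) \<le> r ^ l"
        by (intro order_trans[OF _ r(3)] sum_mono)
      then show ?thesis by (simp add: sum_distrib_left mult.assoc)
    qed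
    moreover have "(\<Sum>x\<in>?X. P x * (\<Sum>s\<in>?S. V x s * of_bool (s \<in> D x))) + (\<Sum>x\<in>?X. P x * (\<Sum>s\<in>?S. V x s * of_bool (s \<notin> D x))) = 1"
    proof -
      have "V x s * of_bool (s \<in> D x) + V x s * of_bool (s \<notin> D x) = V x s" for x s by auto
      then have "(\<Sum>x\<in>?X. P x * ((\<Sum>s\<in>?S. V x s * of_bool (s \<in> D x)) + (\<Sum>s\<in>?S. V x s * of_bool (s \<notin> D x)))) = 1"
        by (simp add: Vs Ps flip: sum.distrib)
      then show ?thesis by (simp add: distrib_left sum.distrib)
    qed
    ultimately have good: "1 - r ^ l \<le> (\<Sum>x\<in>?X. P x * (\<Sum>s\<in>?S. V x s * of_bool (s \<in> D x)))" by linarith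
    have bad: "(\<Sum>x\<in>?X. P x * (\<Sum>s\<in>?S. V x s * of_bool (s \<in> D x'))) \<le> \<beta>" for x'
    proof -
      have "(\<Sum>x\<in>?X. P x * (\<Sum>s\<in>?S. V x s * of_bool (s \<in> D x'))) = (\<Sum>x\<in>?X. \<Sum>s\<in>?S. P x * V x s * of_bool (s \<in> D x'))"
        by (simp add: sum_distrib_left mult.assoc)
      also have "... = (\<Sum>s\<in>?S. \<Sum>x\<in>?X. P x * V x s * of_bool (s \<in> D x'))" by (rule sum.swap)
      also have "... = (\<Sum>s\<in>?S. qq s * of_bool (s \<in> D x'))" unfolding sum_distrib_right[symmetric] PVq ..
      also have "... \<le> (\<Sum>s\<in>?S. \<beta> * V x' s)"
        by (intro sum_mono) (auto simp: D_def V0 \<beta>_def)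
      also have "... = \<beta>" by (simp add: Vs flip: sum_distrib_left)
      finally show ?thesis .
    qed
    have "\<exists>c g. \<forall>w\<in>{1..M}. c w \<in> ?X \<and> 1 - r ^ l - real M * \<beta> \<le> (\<Sum>s\<in>?S. V (c w) s * of_bool (g s = w))"
      using feinstein[where out = "\<lambda>x s. s" and X = ?X and P = P and W = V and \<Omega> = ?S and D = D and \<beta> = \<beta> and \<eta> = "r ^ l" and M = M]
        good bad P0 Ps V0 by (auto simp: finite_PiE \<beta>_def)
    then show ?thesis unfolding V_def \<beta>_def by blast
  qed
  then show ?thesis using r(1,2) by blast
qed

text \<open>Codewords come from the product of the marginal law \<open>q\<close>. A good pair has
  information density at most \<open>l * (J + \<delta>)\<close>, which is the comparison of
  \<open>Q\<close> and \<open>q\<close> asked for by \<open>covering_bound\<close>, and distortion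
  at most \<open>l * D\<close>. The two ways to fail are Chernoff events with bases
  \<open>r1\<close> and \<open>r2\<close>.\<close>

lemma covering_coding:
  fixes p :: "'y::finite \<Rightarrow> real" and Q d :: "'y \<Rightarrow> 'u \<Rightarrow> real"
  assumes p: "is_pmf_on p UNIV" and U: "finite U" and Q: "\<And>y. is_pmf_on (Q y) U"
    and d: "(\<Sum>y\<in>UNIV. \<Sum>u\<in>U. p y * Q y u * d y u) < D" and \<delta>: "0 < \<delta>"
  defines "J \<equiv> mutual_info p Q UNIV U"
  shows "\<exists>r1 r2. 0 \<le> r1 \<and> r1 < 1 \<and> 0 \<le> r2 \<and> r2 < 1 \<and> (\<forall>l M. \<exists>c. (\<forall>j. c j \<in> seqs l U) \<and>
    (\<Sum>y\<in>seqs l UNIV. (\<Prod>t\<in>{0..<l}. p (y t)) *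
        of_bool (\<forall>j<M. real l * D < (\<Sum>t\<in>{0..<l}. d (y t) (c j t))))
     \<le> r1 ^ l + r2 ^ l + exp (- (real M * 2 powr (- (real l * (J + \<delta>))))))"
proof -
  have p0: "0 \<le> p y" and ps: "sum p UNIV = 1" and Q0: "u \<in> U \<Longrightarrow> 0 \<le> Q y u" and Qs: "sum (Q y) U = 1" for y u
    using p Q by (auto simp: is_pmf_on_def)
  define q where "q u = (\<Sum>y\<in>UNIV. p y * Q y u)" for u
  define f where "f y u = log 2 (Q y u) - log 2 (q u)" for y u
  have mean: "(\<Sum>y\<in>UNIV. \<Sum>u\<in>U. p y * Q y u * f y u) = J"
    unfolding J_def q_def f_def using p0 Q U by (intro mutual_info_eq[symmetric]) auto
  have sum1: "(\<Sum>y\<in>UNIV. \<Sum>u\<in>U. p y * Q y u) = 1"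
    by (simp add: Qs ps flip: sum_distrib_left)
  have q0: "u \<in> U \<Longrightarrow> 0 \<le> q u" for u unfolding q_def by (intro sum_nonneg) (auto simp: p0 Q0)
  have qs: "sum q U = 1" unfolding q_def by (subst sum.swap) (rule sum1)
  obtain r1 where r1: "0 \<le> r1" "r1 < 1" "\<And>l. (\<Sum>x\<in>seqs l UNIV. \<Sum>y\<in>seqs l U.
     (\<Prod>t\<in>{0..<l}. p (x t) * Q (x t) (y t)) * of_bool (real l * (J + \<delta>) \<le> (\<Sum>t\<in>{0..<l}. f (x t) (y t)))) \<le> r1 ^ l"
    using chernoff_pairs[of UNIV U "\<lambda>a b. p a * Q a b" f "J + \<delta>"] U p0 Q0 sum1 mean \<delta> by auto
  obtain r2 where r2: "0 \<le> r2" "r2 < 1" "\<And>l. (\<Sum>x\<in>seqs l UNIV. \<Sum>y\<in>seqs l U.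
     (\<Prod>t\<in>{0..<l}. p (x t) * Q (x t) (y t)) * of_bool (real l * D \<le> (\<Sum>t\<in>{0..<l}. d (x t) (y t)))) \<le> r2 ^ l"
    using chernoff_pairs[of UNIV U "\<lambda>a b. p a * Q a b" d D] U p0 Q0 sum1 d by auto
  have "\<exists>c. (\<forall>j. c j \<in> seqs l U) \<and>
    (\<Sum>y\<in>seqs l UNIV. (\<Prod>t\<in>{0..<l}. p (y t)) *
        of_bool (\<forall>j<M. real l * D < (\<Sum>t\<in>{0..<l}. d (y t) (c j t))))
     \<le> r1 ^ l + r2 ^ l + exp (- (real M * 2 powr (- (real l * (J + \<delta>)))))" for l M :: nat
  proof -
    let ?Y = "seqs l (UNIV :: 'y set)" and ?U = "seqs l U"
    define P where "P y = (\<Prod>t\<in>{0..<l}. p (y t))" for y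
    define V where "V y u = (\<Prod>t\<in>{0..<l}. Q (y t) (u t))" for y u
    define qq where "qq u = (\<Prod>t\<in>{0..<l}. q (u t))" for u
    define a where "a = 2 powr (- (real l * (J + \<delta>)))"
    define G where "G y u \<longleftrightarrow> a * V y u \<le> qq u \<and> (\<Sum>t\<in>{0..<l}. d (y t) (u t)) \<le> real l * D" for y u
    have P0: "0 \<le> P y" for y by (auto simp: P_def intro!: prod_nonneg p0)
    have V0: "0 \<le> V y u" "0 \<le> qq u" if "u \<in> ?U" for y u
      using that by (auto simp: V_def qq_def PiE_iff intro!: prod_nonneg Q0 q0)
    have Ps: "sum P ?Y = 1" unfolding P_def by (rule sum_PiE_prod_eq_1) (auto simp: ps)
    have Vs: "sum (V y) ?U = 1" for y unfolding V_def by (rule sum_PiE_prod_eq_1) (auto simp: Qs U)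
    have qqs: "sum qq ?U = 1" unfolding qq_def by (rule sum_PiE_prod_eq_1) (auto simp: qs U)
    have PV: "P y * V y u = (\<Prod>t\<in>{0..<l}. p (y t) * Q (y t) (u t))" for y u
      by (simp add: P_def V_def prod.distrib)
    obtain c where c: "\<forall>j. c j \<in> ?U" "(\<Sum>y\<in>?Y. P y * of_bool (\<forall>j<M. \<not> G y (c j)))
        \<le> (\<Sum>y\<in>?Y. \<Sum>u\<in>?U. P y * V y u * of_bool (\<not> G y u)) + exp (- (real M * a))"
      using covering_bound[of ?Y P ?U qq V a G M] P0 Ps V0 Vs qqs U
      by (auto simp: finite_PiE a_def G_def)
    have "(\<Sum>y\<in>?Y. \<Sum>u\<in>?U. P y * V y u * of_bool (\<not> G y u)) \<le>
       (\<Sum>y\<in>?Y. \<Sum>u\<in>?U. (\<Prod>t\<in>{0..<l}. p (y t) * Q (y t) (u t)) * of_bool (real l * (J + \<delta>) \<le> (\<Sum>t\<in>{0..<l}. f (y t) (u t)))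
         + (\<Prod>t\<in>{0..<l}. p (y t) * Q (y t) (u t)) * of_bool (real l * D \<le> (\<Sum>t\<in>{0..<l}. d (y t) (u t))))"
    proof (intro sum_mono)
      fix y u assume y: "y \<in> ?Y" and u: "u \<in> ?U"
      show "P y * V y u * of_bool (\<not> G y u) \<le>
        (\<Prod>t\<in>{0..<l}. p (y t) * Q (y t) (u t)) * of_bool (real l * (J + \<delta>) \<le> (\<Sum>t\<in>{0..<l}. f (y t) (u t)))
         + (\<Prod>t\<in>{0..<l}. p (y t) * Q (y t) (u t)) * of_bool (real l * D \<le> (\<Sum>t\<in>{0..<l}. d (y t) (u t)))"
      proof (cases "\<not> G y u \<and> P y * V y u \<noteq> 0")
        case True
        then have nz: "(\<Prod>t\<in>{0..<l}. p (y t) * Q (y t) (u t)) \<noteq> 0" using PV by simp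
        note lr = log_prod_ratio[of UNIV p U Q, OF _ _ _ y u nz, folded q_def, folded V_def, folded qq_def]
        have V: "0 < V y u" "0 < qq u" and lg: "log 2 (V y u) - log 2 (qq u) = (\<Sum>t\<in>{0..<l}. f (y t) (u t))"
          using lr p0 Q0 unfolding f_def by auto
        have "real l * (J + \<delta>) \<le> (\<Sum>t\<in>{0..<l}. f (y t) (u t)) \<or> real l * D \<le> (\<Sum>t\<in>{0..<l}. d (y t) (u t))"
        proof (cases "a * V y u \<le> qq u")
          case True': True
          then show ?thesis using True by (auto simp: G_def)
        next
          case False
          then have "log 2 (qq u) < log 2 (a * V y u)"
            using V by (subst log_less_cancel_iff) (auto simp: a_def)
          then have "log 2 (qq u) < - (real l * (J + \<delta>)) + log 2 (V y u)"
            using V by (simp add: a_def log_mult)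
          then show ?thesis using lg by simp
        qed
        moreover have "0 \<le> P y * V y u" using P0 V0[OF u] by simp
        ultimately show ?thesis using PV[of y u] by auto
      next
        case False
        moreover have "0 \<le> P y * V y u" using P0 V0[OF u] by simp
        ultimately show ?thesis using PV[of y u] by auto
      qed
    qed
    also have "... \<le> r1 ^ l + r2 ^ l"
      unfolding sum.distrib by (intro add_mono r1(3) r2(3))
    finally have bad: "(\<Sum>y\<in>?Y. \<Sum>u\<in>?U. P y * V y u * of_bool (\<not> G y u)) \<le> r1 ^ l + r2 ^ l" .
    have "(\<Sum>y\<in>?Y. P y * of_bool (\<forall>j<M. real l * D < (\<Sum>t\<in>{0..<l}. d (y t) (c j t))))
        \<le> (\<Sum>y\<in>?Y. P y * of_bool (\<forall>j<M. \<not> G y (c j)))"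
      by (intro sum_mono mult_left_mono P0) (auto simp: G_def of_bool_def)
    then have "(\<Sum>y\<in>?Y. P y * of_bool (\<forall>j<M. real l * D < (\<Sum>t\<in>{0..<l}. d (y t) (c j t))))
        \<le> r1 ^ l + r2 ^ l + exp (- (real M * a))" using c(2) bad by linarith
    then show ?thesis using c(1) unfolding P_def a_def by blast
  qed
  then show ?thesis using r1(1,2) r2(1,2) by blast
qed

section \<open>Block predictors\<close>

context modsum_relay
begin

text \<open>\<open>\<phi>\<close> maps a block of \<open>l\<close> relay observations to a block of relay inputs, and \<open>\<pi> s t\<close> is the
  receiver's prediction of \<open>Z\<^sub>t\<close> from the resulting block \<open>s\<close>. Its expected logarithmic loss is at most \<open>h\<close>
  bits per letter; the inner sum over \<open>z\<close> is the expectation given \<open>Y\<^sub>1\<close>.\<close>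
definition block_predictor :: "real \<Rightarrow> nat \<Rightarrow> ((nat \<Rightarrow> 'y1) \<Rightarrow> nat \<Rightarrow> 'x1) \<Rightarrow> ((nat \<Rightarrow> 's) \<Rightarrow> nat \<Rightarrow> nat \<Rightarrow> real) \<Rightarrow> bool" where
  "block_predictor h l \<phi> \<pi> \<longleftrightarrow> 0 < l \<and> (\<forall>s t. \<forall>z<m. 0 < \<pi> s t z) \<and> (\<forall>s t. (\<Sum>z\<in>{0..<m}. \<pi> s t z) = 1) \<and>
    (\<Sum>y\<in>seqs l UNIV. \<Sum>s\<in>seqs l UNIV.
      (\<Prod>t\<in>{0..<l}. pY (y t)) * (\<Prod>t\<in>{0..<l}. Wr (\<phi> y t) (s t)) *
      (\<Sum>t\<in>{0..<l}. \<Sum>z\<in>{0..<m}. K z (y t) * (- log 2 (\<pi> s t z)))) \<le> real l * h"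

text \<open>The posterior of \<open>Z\<close> may vanish on some letters, where logarithmic loss is
  infinite. Mixing in the uniform law with weight \<open>\<kappa>\<close> makes every letter
  positive; since \<open>1 - \<kappa> = 2 powr (- \<epsilon>)\<close>, this costs at most
  \<open>\<epsilon>\<close> per unit of mass.\<close>

lemma smoothed_law:
  assumes v: "\<And>y. 0 \<le> v y" and \<epsilon>: "0 < \<epsilon>"
  shows "\<exists>\<rho>. (\<forall>z<m. 0 < \<rho> z) \<and> (\<Sum>z\<in>{0..<m}. \<rho> z) = 1 \<and>
    (\<Sum>z\<in>{0..<m}. KK v z * (- log 2 (\<rho> z))) \<le> hent (KK v) {0..<m} + \<epsilon> * sum v UNIV"
proof (cases "sum v UNIV = 0")
  case True
  then have "v = (\<lambda>y. 0)" using v by (auto simp: sum_nonneg_eq_0_iff)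
  then have "KK v = (\<lambda>z. 0)" by (auto simp: KK_def)
  then show ?thesis using m_ge_2 True by (intro exI[of _ "\<lambda>_. 1 / real m"]) auto
next
  case False
  define q where "q = sum v UNIV"
  have "0 \<le> q" unfolding q_def using v by (simp add: sum_nonneg)
  with False have q: "0 < q" by (simp add: q_def)
  define \<kappa> where "\<kappa> = 1 - 2 powr (- \<epsilon>)"
  have "2 powr (- \<epsilon>) < 2 powr 0" using \<epsilon> by (subst powr_less_cancel_iff) auto
  then have \<kappa>: "0 < \<kappa>" "1 - \<kappa> = 2 powr (- \<epsilon>)" by (auto simp: \<kappa>_def)
  define \<rho> where "\<rho> z = (1 - \<kappa>) * (KK v z / q) + \<kappa> / real m" for z
  have m0: "0 < real m" using m_ge_2 by simp
  have K0: "0 \<le> KK v z" if "z < m" for z using KK_nonneg[OF that] v by simp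
  have "0 < \<rho> z" if "z < m" for z
    unfolding \<rho>_def \<kappa>(2) using K0[OF that] q \<kappa>(1) m0 by (intro add_nonneg_pos) auto
  moreover have "(\<Sum>z\<in>{0..<m}. \<rho> z) = 1"
    unfolding \<rho>_def sum.distrib sum_distrib_left[symmetric] sum_divide_distrib[symmetric] KK_sum
    using q m0 by (simp add: q_def)
  moreover have "(\<Sum>z\<in>{0..<m}. KK v z * (- log 2 (\<rho> z))) \<le> hent (KK v) {0..<m} + \<epsilon> * q"
  proof -
    have "KK v z * (- log 2 (\<rho> z)) \<le> KK v z * \<epsilon> - KK v z * log 2 (KK v z) + KK v z * log 2 q"
      if z: "z \<in> {0..<m}" for z
    proof (cases "KK v z = 0")
      case False
      then have kp: "0 < KK v z" using K0[of z] z by auto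
      have "(1 - \<kappa>) * (KK v z / q) \<le> \<rho> z" unfolding \<rho>_def using \<kappa> m0 by simp
      moreover have pos: "0 < (1 - \<kappa>) * (KK v z / q)" unfolding \<kappa>(2) using kp q by simp
      ultimately have "log 2 ((1 - \<kappa>) * (KK v z / q)) \<le> log 2 (\<rho> z)"
        by (subst log_le_cancel_iff) auto
      moreover have "log 2 ((1 - \<kappa>) * (KK v z / q)) = - \<epsilon> + log 2 (KK v z) - log 2 q"
        unfolding \<kappa>(2) using kp q by (simp add: log_mult log_divide)
      ultimately have "- log 2 (\<rho> z) \<le> \<epsilon> - log 2 (KK v z) + log 2 q" by simp
      then have "KK v z * (- log 2 (\<rho> z)) \<le> KK v z * (\<epsilon> - log 2 (KK v z) + log 2 q)"
        using kp by (intro mult_left_mono) auto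
      then show ?thesis by (simp add: algebra_simps)
    qed simp
    then have "(\<Sum>z\<in>{0..<m}. KK v z * (- log 2 (\<rho> z)))
      \<le> (\<Sum>z\<in>{0..<m}. KK v z * \<epsilon> - KK v z * log 2 (KK v z) + KK v z * log 2 q)" by (rule sum_mono)
    also have "... = hent (KK v) {0..<m} + \<epsilon> * q"
      unfolding sum.distrib sum_subtractf sum_distrib_right[symmetric] hent_def plogp_eq KK_sum q_def
      by simp
    finally show ?thesis .
  qed
  ultimately show ?thesis unfolding q_def by blast
qed

lemma I_UY1_nonneg:
  assumes Q: "\<And>y. is_pmf_on (Q y) {0..<k}"
  shows "0 \<le> I_UY1 m pz W1 k Q"
proof -
  have "(\<Sum>u\<in>{0..<k}. pY y * Q y u) = pY y" for y
    using Q[of y] by (simp add: is_pmf_on_def flip: sum_distrib_left)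
  then have "hent (\<lambda>y. \<Sum>u\<in>{0..<k}. pY y * Q y u) UNIV = ent pY UNIV"
    using pY_pmf by (simp add: hent_pmf)
  moreover have "(\<Sum>u\<in>{0..<k}. hent (\<lambda>y. pY y * Q y u) UNIV) \<le> hent (\<lambda>y. \<Sum>u\<in>{0..<k}. pY y * Q y u) UNIV"
    using Q by (intro hent_superadditive) (auto simp: is_pmf_on_def pY_nonneg)
  ultimately show ?thesis by (simp add: I_UY1_hent)
qed

text \<open>Source coding of \<open>Y\<^sub>1\<close> under the distortion \<open>d(y, u) = - \<Sum>\<^sub>z p(z | y) log \<rho>\<^sub>u(z)\<close>, followed by channel
  coding of the index. Measuring distortion by logarithmic loss avoids a Markov lemma for \<open>Z\<close>.\<close>
lemma block_predictor_exists:
  assumes Q: "\<And>y. is_pmf_on (Q y) {0..<k}" and less: "I_UY1 m pz W1 k Q < R0 Wr" and \<epsilon>: "0 < \<epsilon>"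
  shows "\<exists>l \<phi> \<pi>. block_predictor (H_Z_given_U m pz W1 k Q + \<epsilon>) l \<phi> \<pi>"
proof -
  define H where "H = H_Z_given_U m pz W1 k Q"
  define J where "J = I_UY1 m pz W1 k Q"
  have J0: "0 \<le> J" unfolding J_def by (rule I_UY1_nonneg[OF Q])
  have "\<exists>p. is_pmf_on p UNIV \<and> J < mutual_info p Wr UNIV UNIV"
  proof (rule ccontr)
    assume "\<not> ?thesis"
    then have le: "mutual_info p Wr UNIV UNIV \<le> J" if "is_pmf_on p UNIV" for p using that by (auto simp: not_less)
    have "is_pmf_on (\<lambda>x::'x1. 1 / real CARD('x1)) UNIV" by (auto simp: is_pmf_on_def)
    then have "R0 Wr \<le> J" unfolding R0_def by (intro cSup_least) (use le in auto)
    then show False using less by (simp add: J_def)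
  qed
  then obtain p where p: "is_pmf_on p UNIV" "J < mutual_info p Wr UNIV UNIV" by blast
  \<comment> \<open>A quarter of the gap: covering needs a rate above \<open>J + \<delta>\<close>,
    the channel code a rate below \<open>J + 3 * \<delta>\<close>, and the index rate is placed at
    \<open>J + 2 * \<delta>\<close>.\<close>
  define \<delta> where "\<delta> = (mutual_info p Wr UNIV UNIV - J) / 4"
  have \<delta>: "0 < \<delta>" and Ip: "mutual_info p Wr UNIV UNIV = J + 4 * \<delta>" using p(2) by (auto simp: \<delta>_def field_simps)
  define v where "v u y = pY y * Q y u" for u y
  have v0: "0 \<le> v u y" if "u < k" for u y using Q[of y] that by (auto simp: v_def is_pmf_on_def pY_nonneg)
  \<comment> \<open>A positive law \<open>\<rho>\<close> is chosen also for \<open>u\<close> outside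
    the alphabet: beyond position \<open>l\<close> a codeword has an arbitrary value, while
    \<open>block_predictor\<close> asks for positivity at every \<open>t\<close>.\<close>
  define good where "good u \<rho> \<longleftrightarrow> (\<forall>z<m. 0 < \<rho> z) \<and> (\<Sum>z\<in>{0..<m}. \<rho> z) = 1 \<and>
    (u < k \<longrightarrow> (\<Sum>z\<in>{0..<m}. KK (v u) z * (- log 2 (\<rho> z))) \<le> hent (KK (v u)) {0..<m} + (\<epsilon> / 4) * sum (v u) UNIV)"
    for u and \<rho> :: "nat \<Rightarrow> real"
  have "\<exists>\<rho>. good u \<rho>" for u
  proof (cases "u < k")
    case True
    then show ?thesis unfolding good_def using smoothed_law[of "v u" "\<epsilon> / 4"] v0 \<epsilon> by auto
  next
    case False
    then show ?thesis unfolding good_def using m_ge_2 by (intro exI[of _ "\<lambda>_. 1 / real m"]) auto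
  qed
  then obtain \<rho> where "\<And>u. good u (\<rho> u)" by metis
  then have \<rho>: "\<And>u z. z < m \<Longrightarrow> 0 < \<rho> u z" "\<And>u. (\<Sum>z\<in>{0..<m}. \<rho> u z) = 1"
    "\<And>u. u < k \<Longrightarrow> (\<Sum>z\<in>{0..<m}. KK (v u) z * (- log 2 (\<rho> u z))) \<le> hent (KK (v u)) {0..<m} + (\<epsilon> / 4) * sum (v u) UNIV"
    by (auto simp: good_def)
  define d where "d y u = (\<Sum>z\<in>{0..<m}. K z y * (- log 2 (\<rho> u z)))" for y u
  have d0: "0 \<le> d y u" for y u
    unfolding d_def
  proof (intro sum_nonneg mult_nonneg_nonneg)
    fix z assume z: "z \<in> {0..<m}"
    then show "0 \<le> K z y" by (simp add: K_nonneg)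
    have "\<rho> u z \<le> (\<Sum>z\<in>{0..<m}. \<rho> u z)" using z \<rho>(1) by (intro member_le_sum) (auto simp: less_imp_le)
    then show "0 \<le> - log 2 (\<rho> u z)" using \<rho>(1)[of z u] \<rho>(2)[of u] z by simp
  qed
  \<comment> \<open>A crude bound on the distortion, which prices the two rare events: an uncovered
    block and a wrongly decoded index.\<close>
  define dm where "dm = (\<Sum>y\<in>UNIV. \<Sum>u\<in>{0..<k}. d y u)"
  have dm: "d y u \<le> dm" if "u < k" for y u
  proof -
    have "d y u \<le> (\<Sum>u\<in>{0..<k}. d y u)" using that d0 by (intro member_le_sum) auto
    also have "... \<le> dm" unfolding dm_def
      by (rule member_le_sum[where f = "\<lambda>y. \<Sum>u\<in>{0..<k}. d y u"]) (auto intro: sum_nonneg d0)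
    finally show ?thesis .
  qed
  have dm0: "0 \<le> dm" unfolding dm_def by (intro sum_nonneg d0)
  have "(\<Sum>y\<in>UNIV. \<Sum>u\<in>{0..<k}. pY y * Q y u * d y u) = (\<Sum>u\<in>{0..<k}. \<Sum>z\<in>{0..<m}. KK (v u) z * (- log 2 (\<rho> u z)))"
  proof -
    have "(\<Sum>y\<in>UNIV. \<Sum>u\<in>{0..<k}. pY y * Q y u * d y u) = (\<Sum>u\<in>{0..<k}. \<Sum>y\<in>UNIV. v u y * d y u)"
      unfolding v_def by (rule sum.swap)
    also have "... = (\<Sum>u\<in>{0..<k}. \<Sum>y\<in>UNIV. \<Sum>z\<in>{0..<m}. K z y * v u y * (- log 2 (\<rho> u z)))"
      unfolding d_def by (simp add: sum_distrib_left mult_ac)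
    also have "... = (\<Sum>u\<in>{0..<k}. \<Sum>z\<in>{0..<m}. \<Sum>y\<in>UNIV. K z y * v u y * (- log 2 (\<rho> u z)))"
      by (intro sum.cong refl sum.swap)
    finally show ?thesis unfolding KK_def sum_distrib_right .
  qed
  also have "... \<le> (\<Sum>u\<in>{0..<k}. hent (KK (v u)) {0..<m} + (\<epsilon> / 4) * sum (v u) UNIV)"
    by (intro sum_mono \<rho>(3)) auto
  also have "... = H + (\<epsilon> / 4) * (\<Sum>u\<in>{0..<k}. sum (v u) UNIV)"
    unfolding H_def H_Z_given_U_hent v_def[abs_def] sum.distrib sum_distrib_left ..
  also have "(\<Sum>u\<in>{0..<k}. sum (v u) UNIV) = 1"
    unfolding v_def using Q by (subst sum.swap) (simp add: is_pmf_on_def pY_sum flip: sum_distrib_left)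
  finally have "(\<Sum>y\<in>UNIV. \<Sum>u\<in>{0..<k}. pY y * Q y u * d y u) < H + \<epsilon> / 2" using \<epsilon> by simp
  from covering_coding[OF pY_pmf _ Q this \<delta>]
  obtain r1 r2 where r12: "0 \<le> r1" "r1 < 1" "0 \<le> r2" "r2 < 1" and
    cov: "\<And>l M. \<exists>c. (\<forall>j. c j \<in> seqs l {0..<k}) \<and>
    (\<Sum>y\<in>seqs l UNIV. (\<Prod>t\<in>{0..<l}. pY (y t)) *
        of_bool (\<forall>j<M. real l * (H + \<epsilon> / 2) < (\<Sum>t\<in>{0..<l}. d (y t) (c j t))))
     \<le> r1 ^ l + r2 ^ l + exp (- (real M * 2 powr (- (real l * (J + \<delta>)))))"
    unfolding J_def I_UY1_def by auto
  have Ip': "J + 4 * \<delta> - \<delta> = J + 3 * \<delta>" by simp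
  from channel_coding[of p Wr \<delta>, OF p(1) Wr_pmf \<delta>]
  obtain r where r: "0 \<le> r" "r < 1" and chan: "\<And>l M. \<exists>c g. \<forall>w\<in>{1..M::nat}.
    1 - r ^ l - real M * 2 powr (- (real l * (J + 3 * \<delta>)))
      \<le> (\<Sum>s\<in>seqs l UNIV. (\<Prod>t\<in>{0..<l}. Wr (c w t) (s t)) * of_bool (g s = w))"
    unfolding Ip Ip' by blast
  \<comment> \<open>Index decoding error plus probability of an uncovered block. At index rate
    \<open>J + 2 * \<delta>\<close> the distance to either neighbouring rate is
    \<open>\<delta>\<close>, whence the powers of \<open>2 powr \<delta>\<close>.\<close>
  define e where "e l = r ^ l + 2 * (2 powr (- \<delta>)) ^ l + (r1 ^ l + r2 ^ l + exp (- ((2 powr \<delta>) ^ l)))" for l :: nat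
  have "2 powr (- \<delta>) < 2 powr 0" using \<delta> by (subst powr_less_cancel_iff) auto
  then have lim1: "(\<lambda>l. (2 powr (- \<delta>)) ^ l) \<longlonglongrightarrow> 0" by (intro LIMSEQ_realpow_zero) auto
  have lim2: "(\<lambda>l. exp (- ((2 powr \<delta>) ^ l))) \<longlonglongrightarrow> 0"
  proof (rule tendsto_sandwich[OF _ _ tendsto_const lim1])
    have "exp (- ((2 powr \<delta>) ^ l)) \<le> (2 powr (- \<delta>)) ^ l" for l :: nat
    proof -
      have "(2 powr \<delta>) ^ l \<le> exp ((2 powr \<delta>) ^ l)"
        using exp_ge_add_one_self[of "(2 powr \<delta>) ^ l"] by linarith
      then have "inverse (exp ((2 powr \<delta>) ^ l)) \<le> inverse ((2 powr \<delta>) ^ l)"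
        by (intro le_imp_inverse_le) auto
      then show ?thesis by (simp add: exp_minus powr_minus power_inverse)
    qed
    then show "eventually (\<lambda>l. exp (- ((2 powr \<delta>) ^ l)) \<le> (2 powr (- \<delta>)) ^ l) sequentially" by simp
  qed simp
  have "e \<longlonglongrightarrow> 0 + 2 * 0 + (0 + 0 + 0)"
    unfolding e_def
    by (intro tendsto_add tendsto_mult tendsto_const lim1 lim2 LIMSEQ_realpow_zero r r12)
  then have "e \<longlonglongrightarrow> 0" by simp
  then have "(\<lambda>l. dm * e l) \<longlonglongrightarrow> dm * 0" by (intro tendsto_intros)
  then have "eventually (\<lambda>l. dm * e l < \<epsilon> / 2) sequentially"
    using \<epsilon> by (intro order_tendstoD(2)[of _ "dm * 0"]) auto
  then have "eventually (\<lambda>l. dm * e l < \<epsilon> / 2 \<and> 0 < l) sequentially"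
    using eventually_gt_at_top[of 0] by eventually_elim auto
  then obtain l where l: "0 < l" "dm * e l < \<epsilon> / 2"
    by (auto simp: eventually_sequentially)
  define M where "M = nat \<lceil>2 powr (real l * (J + 2 * \<delta>))\<rceil>"
  have M1: "2 powr (real l * (J + 2 * \<delta>)) \<le> real M" unfolding M_def by (simp add: real_nat_ceiling_ge)
  have "0 < real M" using M1 by (smt (verit) powr_gt_zero)
  then have Mpos: "0 < M" by simp
  have "1 \<le> 2 powr (real l * (J + 2 * \<delta>))" using J0 \<delta> by (intro ge_one_powr_ge_zero) auto
  then have M2: "real M \<le> 2 * 2 powr (real l * (J + 2 * \<delta>))" unfolding M_def by linarith
  obtain c where c: "\<And>j. c j \<in> seqs l {0..<k}"
    "(\<Sum>y\<in>seqs l UNIV. (\<Prod>t\<in>{0..<l}. pY (y t)) *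
        of_bool (\<forall>j<M. real l * (H + \<epsilon> / 2) < (\<Sum>t\<in>{0..<l}. d (y t) (c j t))))
     \<le> r1 ^ l + r2 ^ l + exp (- (real M * 2 powr (- (real l * (J + \<delta>)))))"
    using cov[of l M] by blast
  obtain x g where xg: "\<And>w. w \<in> {1..M} \<Longrightarrow> 1 - r ^ l - real M * 2 powr (- (real l * (J + 3 * \<delta>)))
      \<le> (\<Sum>s\<in>seqs l UNIV. (\<Prod>t\<in>{0..<l}. Wr (x w t) (s t)) * of_bool (g s = w))"
    using chan[of M l] by blast
  let ?Y = "seqs l (UNIV :: 'y1 set)" and ?S = "seqs l (UNIV :: 's set)"
  define bad where "bad y \<longleftrightarrow> (\<forall>j<M. real l * (H + \<epsilon> / 2) < (\<Sum>t\<in>{0..<l}. d (y t) (c j t)))" for y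
  define j where "j y = (if bad y then 0 else SOME j. j < M \<and> (\<Sum>t\<in>{0..<l}. d (y t) (c j t)) \<le> real l * (H + \<epsilon> / 2))" for y
  have jM: "j y < M" and jd: "\<not> bad y \<Longrightarrow> (\<Sum>t\<in>{0..<l}. d (y t) (c (j y) t)) \<le> real l * (H + \<epsilon> / 2)" for y
  proof -
    have *: "j y < M \<and> (\<Sum>t\<in>{0..<l}. d (y t) (c (j y) t)) \<le> real l * (H + \<epsilon> / 2)" if nb: "\<not> bad y"
    proof -
      have "\<exists>j. j < M \<and> (\<Sum>t\<in>{0..<l}. d (y t) (c j t)) \<le> real l * (H + \<epsilon> / 2)"
        using nb by (auto simp: bad_def not_less)
      from someI_ex[OF this] show ?thesis using nb by (simp add: j_def)
    qed
    show "j y < M" using * Mpos by (cases "bad y") (auto simp: j_def)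
    show "\<not> bad y \<Longrightarrow> (\<Sum>t\<in>{0..<l}. d (y t) (c (j y) t)) \<le> real l * (H + \<epsilon> / 2)" using * by blast
  qed
  \<comment> \<open>Covering counts codewords from 0 and the channel code counts messages from 1,
    hence \<open>Suc\<close> here and \<open>g s - 1\<close> in the predictor.\<close>
  define \<phi> where "\<phi> y = x (Suc (j y))" for y
  define \<pi> where "\<pi> s t z = \<rho> (c (g s - 1) t) z" for s t z
  define PP where "PP y = (\<Prod>t\<in>{0..<l}. pY (y t))" for y
  define V where "V y s = (\<Prod>t\<in>{0..<l}. Wr (\<phi> y t) (s t))" for y s
  have PP0: "0 \<le> PP y" for y unfolding PP_def by (intro prod_nonneg) (simp add: pY_nonneg)
  have V0: "0 \<le> V y s" for y s unfolding V_def by (intro prod_nonneg) (simp add: Wr_nonneg)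
  have PPs: "sum PP ?Y = 1" unfolding PP_def by (rule sum_PiE_prod_eq_1) (auto simp: pY_sum)
  have Vs: "sum (V y) ?S = 1" for y unfolding V_def by (rule sum_PiE_prod_eq_1) (auto simp: Wr_sum)
  have cd: "(\<Sum>t\<in>{0..<l}. d (y t) (c i t)) \<le> real l * dm" for y i
  proof -
    have "(\<Sum>t\<in>{0..<l}. d (y t) (c i t)) \<le> (\<Sum>t\<in>{0..<l}. dm)"
      using PiE_mem[OF c(1)[of i]] by (intro sum_mono dm) auto
    then show ?thesis by simp
  qed
  have cd0: "0 \<le> (\<Sum>t\<in>{0..<l}. d (y t) (c i t))" for y i by (intro sum_nonneg d0)
  define e1 where "e1 = r ^ l + 2 * (2 powr (- \<delta>)) ^ l"
  have err: "(\<Sum>s\<in>?S. V y s * of_bool (g s \<noteq> Suc (j y))) \<le> e1" for y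
  proof -
    have "(\<Sum>s\<in>?S. V y s * of_bool (g s \<noteq> Suc (j y))) = (\<Sum>s\<in>?S. V y s - V y s * of_bool (g s = Suc (j y)))"
      by (intro sum.cong) auto
    also have "... = 1 - (\<Sum>s\<in>?S. V y s * of_bool (g s = Suc (j y)))" by (simp add: sum_subtractf Vs)
    also have "... \<le> r ^ l + real M * 2 powr (- (real l * (J + 3 * \<delta>)))"
      using xg[of "Suc (j y)"] jM[of y] unfolding V_def \<phi>_def by auto
    also have "real M * 2 powr (- (real l * (J + 3 * \<delta>))) \<le> 2 * 2 powr (real l * (J + 2 * \<delta>)) * 2 powr (- (real l * (J + 3 * \<delta>)))"
      by (intro mult_right_mono M2) auto
    also have "... = 2 * 2 powr (real l * (- \<delta>))"
      by (simp add: algebra_simps flip: powr_add)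
    also have "... = 2 * (2 powr (- \<delta>)) ^ l"
      by (simp add: powr_powr mult.commute flip: powr_realpow)
    finally show ?thesis unfolding e1_def by simp
  qed
  have uncov: "(\<Sum>y\<in>?Y. PP y * of_bool (bad y)) \<le> r1 ^ l + r2 ^ l + exp (- ((2 powr \<delta>) ^ l))"
  proof -
    have "(2 powr \<delta>) ^ l = 2 powr (real l * (J + 2 * \<delta>)) * 2 powr (- (real l * (J + \<delta>)))"
      by (simp add: powr_powr algebra_simps flip: powr_add powr_realpow)
    also have "... \<le> real M * 2 powr (- (real l * (J + \<delta>)))" by (intro mult_right_mono M1) auto
    finally show ?thesis using c(2) unfolding PP_def bad_def by (smt (verit) exp_le_cancel_iff)
  qed
  have inner: "(\<Sum>s\<in>?S. V y s * (\<Sum>t\<in>{0..<l}. d (y t) (c (g s - 1) t)))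
      \<le> real l * (H + \<epsilon> / 2) + real l * dm * of_bool (bad y) + real l * dm * e1" for y
  proof -
    have "(\<Sum>s\<in>?S. V y s * (\<Sum>t\<in>{0..<l}. d (y t) (c (g s - 1) t)))
      \<le> (\<Sum>s\<in>?S. V y s * (\<Sum>t\<in>{0..<l}. d (y t) (c (j y) t)) + real l * dm * (V y s * of_bool (g s \<noteq> Suc (j y))))"
    proof (rule sum_mono)
      fix s
      have "(\<Sum>t\<in>{0..<l}. d (y t) (c (g s - 1) t)) \<le> (\<Sum>t\<in>{0..<l}. d (y t) (c (j y) t)) + real l * dm * of_bool (g s \<noteq> Suc (j y))"
        using cd[of y "g s - 1"] cd0[of y "j y"] by auto
      from mult_left_mono[OF this V0[of y s]]
      show "V y s * (\<Sum>t\<in>{0..<l}. d (y t) (c (g s - 1) t))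
       \<le> V y s * (\<Sum>t\<in>{0..<l}. d (y t) (c (j y) t)) + real l * dm * (V y s * of_bool (g s \<noteq> Suc (j y)))"
        by (simp add: algebra_simps)
    qed
    also have "... = (\<Sum>t\<in>{0..<l}. d (y t) (c (j y) t)) + real l * dm * (\<Sum>s\<in>?S. V y s * of_bool (g s \<noteq> Suc (j y)))"
      unfolding sum.distrib sum_distrib_left[symmetric] sum_distrib_right[symmetric] Vs by simp
    also have "... \<le> (real l * (H + \<epsilon> / 2) + real l * dm * of_bool (bad y)) + real l * dm * e1"
    proof (intro add_mono mult_left_mono err)
      \<comment> \<open>On a bad block the loss is bounded by \<open>l * dm\<close> alone, so the
        other summand must be known to be nonnegative.\<close>
      have H0: "bad y \<Longrightarrow> 0 \<le> real l * (H + \<epsilon> / 2)"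
      proof -
        have "0 \<le> (\<Sum>y\<in>UNIV. \<Sum>u\<in>{0..<k}. pY y * Q y u * d y u)"
          using Q d0 pY_nonneg by (intro sum_nonneg mult_nonneg_nonneg) (auto simp: is_pmf_on_def)
        then show ?thesis using \<open>_ < H + \<epsilon> / 2\<close> by simp
      qed
      show "(\<Sum>t\<in>{0..<l}. d (y t) (c (j y) t)) \<le> real l * (H + \<epsilon> / 2) + real l * dm * of_bool (bad y)"
        using jd[of y] cd[of y "j y"] H0 by (cases "bad y") auto
    qed (use dm0 in auto)
    finally show ?thesis .
  qed
  have "(\<Sum>y\<in>?Y. \<Sum>s\<in>?S. PP y * V y s * (\<Sum>t\<in>{0..<l}. \<Sum>z\<in>{0..<m}. K z (y t) * (- log 2 (\<pi> s t z))))
     = (\<Sum>y\<in>?Y. PP y * (\<Sum>s\<in>?S. V y s * (\<Sum>t\<in>{0..<l}. d (y t) (c (g s - 1) t))))"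
    unfolding \<pi>_def d_def by (simp only: sum_distrib_left[of "PP _"] mult.assoc)
  also have "... \<le> (\<Sum>y\<in>?Y. PP y * (real l * (H + \<epsilon> / 2) + real l * dm * of_bool (bad y) + real l * dm * e1))"
    by (intro sum_mono mult_left_mono inner PP0)
  also have "... = real l * (H + \<epsilon> / 2) + real l * dm * (\<Sum>y\<in>?Y. PP y * of_bool (bad y)) + real l * dm * e1"
  proof -
    have "(\<Sum>y\<in>?Y. PP y * (real l * (H + \<epsilon> / 2) + real l * dm * of_bool (bad y) + real l * dm * e1))
      = (\<Sum>y\<in>?Y. PP y * (real l * (H + \<epsilon> / 2)) + real l * dm * (PP y * of_bool (bad y)) + PP y * (real l * dm * e1))"
      by (intro sum.cong refl) (simp add: algebra_simps)
    then show ?thesis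
      unfolding sum.distrib sum_distrib_left[symmetric] sum_distrib_right[symmetric] PPs by simp
  qed
  also have "... \<le> real l * (H + \<epsilon> / 2) + real l * dm * (r1 ^ l + r2 ^ l + exp (- ((2 powr \<delta>) ^ l))) + real l * dm * e1"
    using uncov dm0 by (intro add_mono mult_left_mono order_refl) auto
  also have "... = real l * (H + \<epsilon> / 2 + dm * e l)"
    unfolding e_def e1_def by (simp add: algebra_simps)
  also have "... \<le> real l * (H + \<epsilon>)"
    using l by (intro mult_left_mono) auto
  finally have "block_predictor (H + \<epsilon>) l \<phi> \<pi>"
    unfolding block_predictor_def PP_def V_def using l(1) \<rho>(1,2) by (auto simp: \<pi>_def)
  then show ?thesis unfolding H_def by blast
qed

text \<open>For a relay channel of capacity 0: the relay sends a constant, and the receiver predicts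
  from the smoothed law of \<open>Z\<close> alone, in blocks of length 1.\<close>

lemma trivial_block_predictor:
  assumes \<epsilon>: "0 < \<epsilon>"
  shows "\<exists>l \<phi> \<pi>. block_predictor (hent (KK pY) {0..<m} + \<epsilon>) l \<phi> \<pi>"
proof -
  obtain \<rho> where \<rho>: "\<And>z. z < m \<Longrightarrow> 0 < \<rho> z" "(\<Sum>z\<in>{0..<m}. \<rho> z) = 1"
    "(\<Sum>z\<in>{0..<m}. KK pY z * (- log 2 (\<rho> z))) \<le> hent (KK pY) {0..<m} + \<epsilon>"
    using smoothed_law[of pY \<epsilon>] pY_nonneg pY_sum \<epsilon> by auto
  define F where "F y = (\<Sum>z\<in>{0..<m}. K z y * (- log 2 (\<rho> z)))" for y
  have F: "(\<Sum>y\<in>UNIV. pY y * F y) = (\<Sum>z\<in>{0..<m}. KK pY z * (- log 2 (\<rho> z)))"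
  proof -
    have "(\<Sum>y\<in>UNIV. pY y * F y) = (\<Sum>y\<in>UNIV. \<Sum>z\<in>{0..<m}. K z y * pY y * (- log 2 (\<rho> z)))"
      unfolding F_def by (simp add: sum_distrib_left mult_ac)
    also have "... = (\<Sum>z\<in>{0..<m}. \<Sum>y\<in>UNIV. K z y * pY y * (- log 2 (\<rho> z)))" by (rule sum.swap)
    finally show ?thesis unfolding KK_def sum_distrib_right .
  qed
  have "(\<Sum>y\<in>PiE {0..<1::nat} (\<lambda>_. UNIV). \<Sum>s\<in>PiE {0..<1::nat} (\<lambda>_. UNIV).
      (\<Prod>t\<in>{0..<1}. pY (y t)) * (\<Prod>t\<in>{0..<1}. Wr undefined (s t)) * (\<Sum>t\<in>{0..<1}. F (y t)))
     = (\<Sum>y\<in>PiE {0..<1::nat} (\<lambda>_. UNIV). (\<Prod>t\<in>{0..<1}. pY (y t)) * (\<Sum>t\<in>{0..<1}. F (y t)) *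
         (\<Sum>s\<in>PiE {0..<1::nat} (\<lambda>_. UNIV). \<Prod>t\<in>{0..<1}. Wr undefined (s t)))"
    by (simp only: sum_distrib_left mult_ac)
  also have "... = (\<Sum>y\<in>PiE {0..<1::nat} (\<lambda>_. UNIV). (\<Prod>t\<in>{0..<1}. pY (y t)) * (\<Sum>t\<in>{0..<1}. F (y t)))"
    by (subst sum_PiE_prod_eq_1[where g = "\<lambda>_. Wr undefined"]) (auto simp: Wr_sum)
  also have "... = (\<Sum>t\<in>{0..<1::nat}. \<Sum>y\<in>UNIV. pY y * F y)"
    by (rule sum_PiE_prod_additive) (auto simp: pY_sum)
  also have "... \<le> real 1 * (hent (KK pY) {0..<m} + \<epsilon>)" using F \<rho>(3) by simp
  finally have "block_predictor (hent (KK pY) {0..<m} + \<epsilon>) 1 (\<lambda>_ _. undefined) (\<lambda>_ _. \<rho>)"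
    unfolding block_predictor_def F_def using \<rho>(1,2) by auto
  then show ?thesis by blast
qed

end

section \<open>Block structure\<close>

lemma prod_blocks:
  fixes h :: "nat \<Rightarrow> 'a::comm_monoid_mult"
  shows "prod h {k..<k + B * l} = (\<Prod>b\<in>{0..<B}. \<Prod>t\<in>{0..<l}. h (k + b * l + t))"
proof (induction B)
  case (Suc B)
  have "prod h {k..<k + Suc B * l} = prod h {k..<k + B * l} * prod h {k + B * l..<k + B * l + l}"
    by (subst prod.atLeastLessThan_concat) (auto simp: add_ac)
  also have "prod h {k + B * l..<k + B * l + l} = (\<Prod>t\<in>{0..<l}. h (k + B * l + t))"
    using prod.shift_bounds_nat_ivl[of h 0 "k + B * l" l] by (simp add: add_ac)
  finally show ?case using Suc by simp
qed simp

text \<open>Disjoint blocks of a product law are independent, and the coordinates in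
  \<open>rest\<close> sum out to 1; the bijection cuts a word into its blocks and
  \<open>rest\<close>. The offset \<open>k\<close> will be 0 for noise and observations and
  \<open>l\<close> for the relay output, which lags by one block.\<close>

lemma sum_PiE_blocks:
  fixes g :: "nat \<Rightarrow> 'a \<Rightarrow> real" and F :: "nat \<Rightarrow> (nat \<Rightarrow> 'a) \<Rightarrow> real"
  assumes l: "0 < l" and n: "k + B * l \<le> n" and A: "finite A" and g: "\<And>i. i < n \<Longrightarrow> sum (g i) A = 1"
  shows "(\<Sum>x\<in>seqs n A. (\<Prod>i\<in>{0..<n}. g i (x i)) * (\<Prod>b\<in>{0..<B}. F b (\<lambda>t\<in>{0..<l}. x (k + b * l + t))))
    = (\<Prod>b\<in>{0..<B}. \<Sum>x\<in>seqs l A. (\<Prod>t\<in>{0..<l}. g (k + b * l + t) (x t)) * F b x)"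
proof -
  define blk where "blk = {k..<k + B * l}"
  define rest where "rest = {0..<n} - blk"
  let ?G = "PiE {0..<B} (\<lambda>_. seqs l A)" and ?R = "PiE rest (\<lambda>_. A)"
  have fin: "finite ?G" "finite ?R" "finite rest" using A by (auto intro!: finite_PiE simp: rest_def)
  have blk: "blk \<subseteq> {0..<n}" using n by (auto simp: blk_def)
  have idx: "k + b * l + t \<in> blk" "(k + b * l + t - k) div l = b" "(k + b * l + t - k) mod l = t"
    if "b < B" "t < l" for b t
  proof -
    have "b * l + t < Suc b * l" using that by simp
    also have "... \<le> B * l" using that by (intro mult_right_mono) auto
    finally show "k + b * l + t \<in> blk" by (simp add: blk_def)
    show "(k + b * l + t - k) div l = b" "(k + b * l + t - k) mod l = t"
      using that by (auto simp: add.assoc)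
  qed
  have inv: "(i - k) div l < B" "(i - k) mod l < l" "k + (i - k) div l * l + (i - k) mod l = i" if "i \<in> blk" for i
    using that l by (auto simp: blk_def less_mult_imp_div_less)
  have split: "(\<Prod>i\<in>{0..<n}. h i) = (\<Prod>b\<in>{0..<B}. \<Prod>t\<in>{0..<l}. h (k + b * l + t)) * (\<Prod>i\<in>rest. h i)" for h :: "nat \<Rightarrow> real"
  proof -
    have "(\<Prod>i\<in>{0..<n}. h i) = (\<Prod>i\<in>rest. h i) * (\<Prod>i\<in>blk. h i)"
      unfolding rest_def by (rule prod.subset_diff[OF blk]) simp
    then show ?thesis unfolding blk_def prod_blocks by (simp add: mult.commute)
  qed
  have "(\<Prod>b\<in>{0..<B}. \<Sum>x\<in>seqs l A. (\<Prod>t\<in>{0..<l}. g (k + b * l + t) (x t)) * F b x)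
     = (\<Sum>y\<in>?G. \<Prod>b\<in>{0..<B}. (\<Prod>t\<in>{0..<l}. g (k + b * l + t) (y b t)) * F b (y b))"
    using A by (intro prod_sum_PiE) (auto intro: finite_PiE)
  also have "... = (\<Sum>y\<in>?G. \<Prod>b\<in>{0..<B}. (\<Prod>t\<in>{0..<l}. g (k + b * l + t) (y b t)) * F b (y b)) * (\<Sum>r\<in>?R. \<Prod>i\<in>rest. g i (r i))"
    using fin A g by (subst sum_PiE_prod_eq_1) (auto simp: rest_def)
  also have "... = (\<Sum>(y,r)\<in>?G \<times> ?R. (\<Prod>b\<in>{0..<B}. (\<Prod>t\<in>{0..<l}. g (k + b * l + t) (y b t)) * F b (y b)) * (\<Prod>i\<in>rest. g i (r i)))"
    by (simp add: sum_product sum.cartesian_product)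
  also have "... = (\<Sum>x\<in>seqs n A. (\<Prod>i\<in>{0..<n}. g i (x i)) * (\<Prod>b\<in>{0..<B}. F b (\<lambda>t\<in>{0..<l}. x (k + b * l + t))))"
  proof (rule sum.reindex_bij_witness[symmetric, where
        j = "\<lambda>x. (\<lambda>b\<in>{0..<B}. \<lambda>t\<in>{0..<l}. x (k + b * l + t), restrict x rest)" and
        i = "\<lambda>(y,r). \<lambda>i\<in>{0..<n}. if i \<in> blk then y ((i - k) div l) ((i - k) mod l) else r i"])
    fix x assume x: "x \<in> seqs n A"
    have xu: "x i = undefined" if "\<not> i < n" for i using x that by (auto simp: PiE_iff extensional_def)
    have xA: "x i \<in> A" if "i < n" for i using x that by (auto simp: PiE_iff)
    show "(case (\<lambda>b\<in>{0..<B}. \<lambda>t\<in>{0..<l}. x (k + b * l + t), restrict x rest) of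
          (y, r) \<Rightarrow> \<lambda>i\<in>{0..<n}. if i \<in> blk then y ((i - k) div l) ((i - k) mod l) else r i) = x"
      using inv by (auto simp: fun_eq_iff xu rest_def)
    have "x (k + b * l + t) \<in> A" if "b < B" "t < l" for b t
      using idx(1)[OF that] blk by (intro xA) auto
    then show "(\<lambda>b\<in>{0..<B}. \<lambda>t\<in>{0..<l}. x (k + b * l + t), restrict x rest) \<in> ?G \<times> ?R"
      using xA by (auto simp: rest_def)
    show "(case (\<lambda>b\<in>{0..<B}. \<lambda>t\<in>{0..<l}. x (k + b * l + t), restrict x rest) of (y, r) \<Rightarrow>
        (\<Prod>b\<in>{0..<B}. (\<Prod>t\<in>{0..<l}. g (k + b * l + t) (y b t)) * F b (y b)) * (\<Prod>i\<in>rest. g i (r i)))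
      = (\<Prod>i\<in>{0..<n}. g i (x i)) * (\<Prod>b\<in>{0..<B}. F b (\<lambda>t\<in>{0..<l}. x (k + b * l + t)))"
      unfolding split[of "\<lambda>i. g i (x i)"] by (simp add: prod.distrib)
  next
    fix yr assume "yr \<in> ?G \<times> ?R"
    then obtain y r where yr: "yr = (y,r)" "y \<in> ?G" "r \<in> ?R" by auto
    have yA: "y b \<in> seqs l A" if "b < B" for b using yr(2) that by (auto simp: PiE_iff)
    have yu: "y b = undefined" if "\<not> b < B" for b using yr(2) that by (auto simp: PiE_iff extensional_def)
    have yt: "y b t \<in> A" if "b < B" "t < l" for b t using yA[OF that(1)] that(2) by (auto simp: PiE_iff)
    have ytu: "y b t = undefined" if "b < B" "\<not> t < l" for b t using yA[OF that(1)] that(2) by (auto simp: PiE_iff extensional_def)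
    have rA: "r i \<in> A" if "i \<in> rest" for i using yr(3) that by (auto simp: PiE_iff)
    have ru: "r i = undefined" if "i \<notin> rest" for i using yr(3) that by (auto simp: PiE_iff extensional_def)
    define x where "x = (\<lambda>i\<in>{0..<n}. if i \<in> blk then y ((i - k) div l) ((i - k) mod l) else r i)"
    have xb: "x (k + b * l + t) = y b t" if "b < B" "t < l" for b t
      using idx[OF that] blk by (auto simp: x_def)
    have "(\<lambda>b\<in>{0..<B}. \<lambda>t\<in>{0..<l}. x (k + b * l + t)) = y"
    proof (rule ext)+
      fix b t
      show "(\<lambda>b\<in>{0..<B}. \<lambda>t\<in>{0..<l}. x (k + b * l + t)) b t = y b t"
        by (cases "b < B"; cases "t < l") (auto simp: xb yu ytu)
    qed
    moreover have "restrict x rest = r" by (rule ext) (auto simp: x_def rest_def ru)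
    ultimately show "(\<lambda>b\<in>{0..<B}. \<lambda>t\<in>{0..<l}. (case yr of (y, r) \<Rightarrow> \<lambda>i\<in>{0..<n}. if i \<in> blk then y ((i - k) div l) ((i - k) mod l) else r i) (k + b * l + t),
         restrict (case yr of (y, r) \<Rightarrow> \<lambda>i\<in>{0..<n}. if i \<in> blk then y ((i - k) div l) ((i - k) mod l) else r i) rest) = yr"
      unfolding yr(1) x_def by simp
    show "(case yr of (y, r) \<Rightarrow> \<lambda>i\<in>{0..<n}. if i \<in> blk then y ((i - k) div l) ((i - k) mod l) else r i) \<in> seqs n A"
      unfolding yr(1) using inv yt rA by (auto simp: rest_def)
  qed
  finally show ?thesis by simp
qed

context modsum_relay
begin

text \<open>The relay sends \<open>\<phi>\<close> of the previous block; it has nothing to send in the first block.\<close>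
definition relay_blocks :: "nat \<Rightarrow> ((nat \<Rightarrow> 'y1) \<Rightarrow> nat \<Rightarrow> 'x1) \<Rightarrow> nat \<Rightarrow> (nat \<Rightarrow> 'y1) \<Rightarrow> 'x1" where
  "relay_blocks l \<phi> i y = (if i < l then undefined else \<phi> (\<lambda>t\<in>{0..<l}. y ((i div l - 1) * l + t)) (i mod l))"

text \<open>Time \<open>i\<close> lies at or after \<open>i div l * l\<close>, where the block that
  the relay is describing has ended.\<close>

lemma relay_blocks_causal:
  assumes "\<forall>j<i. y j = y' j"
  shows "relay_blocks l \<phi> i y = relay_blocks l \<phi> i y'"
proof (cases "i < l")
  case False
  have "(i div l - 1) * l + t < i" if "t < l" for t
  proof -
    have "1 \<le> i div l" using False that by (simp add: div_greater_zero_iff Suc_le_eq)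
    then have "(i div l - 1) * l + l = i div l * l" by (metis add_mult_distrib le_add_diff_inverse2 nat_mult_1)
    moreover have "i div l * l \<le> i" by simp
    ultimately show ?thesis using that by linarith
  qed
  then have "(\<lambda>t\<in>{0..<l}. y ((i div l - 1) * l + t)) = (\<lambda>t\<in>{0..<l}. y' ((i div l - 1) * l + t))"
    using assms by (auto simp: fun_eq_iff)
  then show ?thesis using False by (simp add: relay_blocks_def)
qed (simp add: relay_blocks_def)

text \<open>Noise block \<open>b\<close> is paired with relay output block \<open>b + 1\<close>,
  which depends on the observations only through block \<open>b\<close>. The pairs are therefore
  independent copies of a single block; summing out \<open>s\<close>, then \<open>y\<close>, then
  \<open>z\<close> makes this explicit.\<close>

lemma block_law_expectation:
  assumes l: "0 < l" and n: "l + B * l \<le> n"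
  shows "(\<Sum>z\<in>seqs n {0..<m}. \<Sum>y\<in>seqs n UNIV. \<Sum>s\<in>seqs n UNIV.
      block_law n (relay_blocks l \<phi>) z y s *
      (\<Prod>b\<in>{0..<B}. E (\<lambda>t\<in>{0..<l}. z (b * l + t)) (\<lambda>t\<in>{0..<l}. s (l + b * l + t))))
    = (\<Sum>z\<in>seqs l {0..<m}. \<Sum>y\<in>seqs l UNIV. \<Sum>s\<in>seqs l UNIV.
      block_law l (\<lambda>t y. \<phi> y t) z y s * E z s) ^ B"
proof -
  let ?zb = "\<lambda>z b. \<lambda>t\<in>{0..<l}. z (b * l + t) :: nat" and ?yb = "\<lambda>y b. \<lambda>t\<in>{0..<l}. y (b * l + t) :: 'y1"
  define T1 where "T1 z y = (\<Sum>s\<in>seqs l UNIV. (\<Prod>t\<in>{0..<l}. Wr (\<phi> y t) (s t)) * E z s)" for z y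
  define T2 where "T2 z = (\<Sum>y\<in>seqs l UNIV. (\<Prod>t\<in>{0..<l}. W1 (z t) (y t)) * T1 z y)" for z
  have s: "(\<Sum>s\<in>seqs n UNIV. block_law n (relay_blocks l \<phi>) z y s *
      (\<Prod>b\<in>{0..<B}. E (?zb z b) (\<lambda>t\<in>{0..<l}. s (l + b * l + t))))
    = (\<Prod>i\<in>{0..<n}. pz (z i)) * ((\<Prod>i\<in>{0..<n}. W1 (z i) (y i)) * (\<Prod>b\<in>{0..<B}. T1 (?zb z b) (?yb y b)))" for z y
  proof -
    have "(\<Sum>s\<in>seqs n UNIV. (\<Prod>i\<in>{0..<n}. Wr (relay_blocks l \<phi> i y) (s i)) *
        (\<Prod>b\<in>{0..<B}. E (?zb z b) (\<lambda>t\<in>{0..<l}. s (l + b * l + t))))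
      = (\<Prod>b\<in>{0..<B}. \<Sum>s\<in>seqs l UNIV. (\<Prod>t\<in>{0..<l}. Wr (relay_blocks l \<phi> (l + b * l + t) y) (s t)) * E (?zb z b) s)"
      using l n by (intro sum_PiE_blocks) (auto simp: Wr_sum)
    also have "... = (\<Prod>b\<in>{0..<B}. T1 (?zb z b) (?yb y b))"
      unfolding T1_def using l
      by (intro prod.cong sum.cong refl arg_cong2[where f = "(*)"]) (auto simp: relay_blocks_def add.assoc)
    finally have "(\<Sum>s\<in>seqs n UNIV. (\<Prod>i\<in>{0..<n}. Wr (relay_blocks l \<phi> i y) (s i)) *
        (\<Prod>b\<in>{0..<B}. E (?zb z b) (\<lambda>t\<in>{0..<l}. s (l + b * l + t)))) = (\<Prod>b\<in>{0..<B}. T1 (?zb z b) (?yb y b))" .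
    then show ?thesis unfolding block_law_eq mult.assoc by (simp only: sum_distrib_left[symmetric])
  qed
  have y: "(\<Sum>y\<in>seqs n UNIV. (\<Prod>i\<in>{0..<n}. pz (z i)) * ((\<Prod>i\<in>{0..<n}. W1 (z i) (y i)) * (\<Prod>b\<in>{0..<B}. T1 (?zb z b) (?yb y b))))
    = (\<Prod>i\<in>{0..<n}. pz (z i)) * (\<Prod>b\<in>{0..<B}. T2 (?zb z b))" if z: "z \<in> seqs n {0..<m}" for z
  proof -
    have "(\<Sum>y\<in>seqs n UNIV. (\<Prod>i\<in>{0..<n}. W1 (z i) (y i)) * (\<Prod>b\<in>{0..<B}. T1 (?zb z b) (\<lambda>t\<in>{0..<l}. y (0 + b * l + t))))
      = (\<Prod>b\<in>{0..<B}. \<Sum>y\<in>seqs l UNIV. (\<Prod>t\<in>{0..<l}. W1 (z (0 + b * l + t)) (y t)) * T1 (?zb z b) y)"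
      using l n z by (intro sum_PiE_blocks) (auto simp: PiE_iff W1_sum)
    also have "... = (\<Prod>b\<in>{0..<B}. T2 (?zb z b))"
      unfolding T2_def by (intro prod.cong sum.cong refl arg_cong2[where f = "(*)"]) auto
    finally show ?thesis unfolding sum_distrib_left[symmetric] by simp
  qed
  have "(\<Sum>z\<in>seqs n {0..<m}. (\<Prod>i\<in>{0..<n}. pz (z i)) * (\<Prod>b\<in>{0..<B}. T2 (\<lambda>t\<in>{0..<l}. z (0 + b * l + t))))
    = (\<Prod>b\<in>{0..<B}. \<Sum>z\<in>seqs l {0..<m}. (\<Prod>t\<in>{0..<l}. pz (z t)) * T2 z)"
    using l n by (intro sum_PiE_blocks) (auto simp: pz_sum)
  moreover have "(\<Prod>t\<in>{0..<l}. pz (z t)) * T2 z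
     = (\<Sum>y\<in>seqs l UNIV. \<Sum>s\<in>seqs l UNIV. block_law l (\<lambda>t y. \<phi> y t) z y s * E z s)" for z
    unfolding T2_def T1_def block_law_eq sum_distrib_left by (simp only: mult.assoc)
  ultimately show ?thesis using y by (simp add: s)
qed

text \<open>Writing the block law as \<open>p(y) p(s | y) p(z | y)\<close> turns the loss at the
  actual noise into the conditional expectation used in \<open>block_predictor\<close>.\<close>

lemma block_predictor_expectation:
  assumes bp: "block_predictor h l \<phi> \<pi>"
  shows "(\<Sum>z\<in>seqs l {0..<m}. \<Sum>y\<in>seqs l UNIV. \<Sum>s\<in>seqs l UNIV.
      block_law l (\<lambda>t y. \<phi> y t) z y s * (\<Sum>t\<in>{0..<l}. - log 2 (\<pi> s t (z t)))) \<le> real l * h"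
proof -
  let ?Z = "seqs l {0..<m}" and ?Y = "seqs l (UNIV :: 'y1 set)" and ?S = "seqs l (UNIV :: 's set)"
  have bl: "block_law l (\<lambda>t y. \<phi> y t) z y s = (\<Prod>t\<in>{0..<l}. pY (y t)) * (\<Prod>t\<in>{0..<l}. Wr (\<phi> y t) (s t)) * (\<Prod>t\<in>{0..<l}. K (z t) (y t))"
    if "z \<in> ?Z" for z y s
  proof -
    have "(\<Prod>t\<in>{0..<l}. pz (z t) * W1 (z t) (y t)) = (\<Prod>t\<in>{0..<l}. pY (y t) * K (z t) (y t))"
      using that by (intro prod.cong refl) (auto simp: pY_mult_K PiE_iff)
    then show ?thesis by (simp add: block_law_def prod.distrib mult_ac)
  qed
  have "(\<Sum>z\<in>?Z. \<Sum>y\<in>?Y. \<Sum>s\<in>?S. block_law l (\<lambda>t y. \<phi> y t) z y s * (\<Sum>t\<in>{0..<l}. - log 2 (\<pi> s t (z t))))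
    = (\<Sum>z\<in>?Z. \<Sum>y\<in>?Y. \<Sum>s\<in>?S. (\<Prod>t\<in>{0..<l}. pY (y t)) * (\<Prod>t\<in>{0..<l}. Wr (\<phi> y t) (s t)) *
        ((\<Prod>t\<in>{0..<l}. K (z t) (y t)) * (\<Sum>t\<in>{0..<l}. - log 2 (\<pi> s t (z t)))))"
    by (intro sum.cong refl) (simp add: bl)
  also have "... = (\<Sum>y\<in>?Y. \<Sum>z\<in>?Z. \<Sum>s\<in>?S. (\<Prod>t\<in>{0..<l}. pY (y t)) * (\<Prod>t\<in>{0..<l}. Wr (\<phi> y t) (s t)) *
        ((\<Prod>t\<in>{0..<l}. K (z t) (y t)) * (\<Sum>t\<in>{0..<l}. - log 2 (\<pi> s t (z t)))))" by (rule sum.swap)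
  also have "... = (\<Sum>y\<in>?Y. \<Sum>s\<in>?S. \<Sum>z\<in>?Z. (\<Prod>t\<in>{0..<l}. pY (y t)) * (\<Prod>t\<in>{0..<l}. Wr (\<phi> y t) (s t)) *
        ((\<Prod>t\<in>{0..<l}. K (z t) (y t)) * (\<Sum>t\<in>{0..<l}. - log 2 (\<pi> s t (z t)))))"
    by (intro sum.cong refl sum.swap)
  also have "... = (\<Sum>y\<in>?Y. \<Sum>s\<in>?S. (\<Prod>t\<in>{0..<l}. pY (y t)) * (\<Prod>t\<in>{0..<l}. Wr (\<phi> y t) (s t)) *
        (\<Sum>z\<in>?Z. (\<Prod>t\<in>{0..<l}. K (z t) (y t)) * (\<Sum>t\<in>{0..<l}. - log 2 (\<pi> s t (z t)))))"
    by (simp only: sum_distrib_left)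
  also have "... = (\<Sum>y\<in>?Y. \<Sum>s\<in>?S. (\<Prod>t\<in>{0..<l}. pY (y t)) * (\<Prod>t\<in>{0..<l}. Wr (\<phi> y t) (s t)) *
        (\<Sum>t\<in>{0..<l}. \<Sum>z\<in>{0..<m}. K z (y t) * (- log 2 (\<pi> s t z))))"
  proof (intro sum.cong refl arg_cong2[where f = "(*)"])
    fix y s
    show "(\<Sum>z\<in>?Z. (\<Prod>t\<in>{0..<l}. K (z t) (y t)) * (\<Sum>t\<in>{0..<l}. - log 2 (\<pi> s t (z t))))
      = (\<Sum>t\<in>{0..<l}. \<Sum>z\<in>{0..<m}. K z (y t) * (- log 2 (\<pi> s t z)))"
      by (rule sum_PiE_prod_additive[where g = "\<lambda>t z. K z (y t)" and h = "\<lambda>t z. - log 2 (\<pi> s t z)"]) (auto simp: K_sum)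
  qed
  also have "... \<le> real l * h" using bp by (simp add: block_predictor_def)
  finally show ?thesis .
qed

end

section \<open>Block codes\<close>

context modsum_relay
begin

text \<open>Only one message is left. Such rates do occur, since
  \<open>log m - H(Z | U) - \<epsilon>\<close> can be negative, and rate 0 shows that the set of
  achievable rates is nonempty.\<close>

lemma achievable_nonpos_rate:
  assumes "R \<le> 0"
  shows "achievable m pz W1 Wr R"
proof -
  have "num_msgs n R = 1" for n
  proof -
    have "real n * R \<le> 0" using assms by (simp add: mult_nonneg_nonpos)
    then have "2 powr (real n * R) \<le> 2 powr 0" by (intro powr_mono) auto
    then have "\<lceil>2 powr (real n * R)\<rceil> = 1" by (intro ceiling_unique) auto
    then show ?thesis by (simp add: num_msgs_def)
  qed
  then have "err_prob m pz W1 Wr n (num_msgs n R) (\<lambda>_ _. 0) (\<lambda>_ _. undefined) (\<lambda>_ _. 1) = 0" for n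
    by (simp add: err_prob_def)
  then show ?thesis unfolding achievable_def using m_ge_2
    by (intro exI[of _ "\<lambda>_ _ _. 0"] exI[of _ "\<lambda>_ _ _. undefined"] exI[of _ "\<lambda>_ _ _. 1"]) auto
qed

text \<open>Codewords are uniform, so a wrong codeword is accepted with probability \<open>m\<^sup>-\<^sup>n\<close> times the number of
  noise words of small predicted loss, and there are few of those because \<open>2\<close> to the minus loss is a
  probability.\<close>
lemma block_code_exists:
  assumes bp: "block_predictor h l \<phi> \<pi>" and \<theta>: "real l * h < \<theta>"
  shows "\<exists>r. 0 \<le> r \<and> r < 1 \<and> (\<forall>n B M. l + B * l \<le> n \<longrightarrow> 1 \<le> M \<longrightarrow> (\<exists>enc g.
    (\<forall>w\<in>{1..M}. \<forall>i<n. enc w i < m) \<and>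
    err_prob m pz W1 Wr n M enc (relay_blocks l \<phi>) g \<le> r ^ B + real M * (2 powr \<theta> / real m ^ l) ^ B))"
proof -
  have l: "0 < l" and \<pi>0: "\<And>s t z. z < m \<Longrightarrow> 0 < \<pi> s t z" and \<pi>1: "\<And>s t. (\<Sum>z\<in>{0..<m}. \<pi> s t z) = 1"
    using bp by (auto simp: block_predictor_def)
  have m0: "0 < m" using m_ge_2 by simp
  define loss where "loss z s = (\<Sum>t\<in>{0..<l}. - log 2 (\<pi> s t (z t)))" for z s
  let ?Zl = "seqs l {0..<m}" and ?Yl = "seqs l (UNIV :: 'y1 set)" and ?Sl = "seqs l (UNIV :: 's set)"
  define \<mu>l where "\<mu>l = (\<lambda>(z,y,s). block_law l (\<lambda>t y. \<phi> y t) z y s)"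
  have "(\<Sum>e\<in>?Zl \<times> ?Yl \<times> ?Sl. \<mu>l e * (case e of (z,y,s) \<Rightarrow> loss z s)) \<le> real l * h"
    using block_predictor_expectation[OF bp] by (simp add: \<mu>l_def loss_def sum.cartesian_product')
  then obtain \<tau> where \<tau>: "0 < \<tau>" "(\<Sum>e\<in>?Zl \<times> ?Yl \<times> ?Sl. \<mu>l e * exp (\<tau> * ((case e of (z,y,s) \<Rightarrow> loss z s) - \<theta>))) < 1"
    using chernoff_exponent[of \<mu>l "?Zl \<times> ?Yl \<times> ?Sl" "\<lambda>e. case e of (z,y,s) \<Rightarrow> loss z s" \<theta>] \<theta> block_law_sum[of l "\<lambda>t y. \<phi> y t"]
    by (auto simp: \<mu>l_def sum.cartesian_product')
  define r where "r = (\<Sum>z\<in>?Zl. \<Sum>y\<in>?Yl. \<Sum>s\<in>?Sl. block_law l (\<lambda>t y. \<phi> y t) z y s * exp (\<tau> * (loss z s - \<theta>)))"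
  have r1: "r < 1" using \<tau>(2) by (simp add: r_def \<mu>l_def sum.cartesian_product')
  have r0: "0 \<le> r" unfolding r_def
    by (intro sum_nonneg mult_nonneg_nonneg block_law_nonneg) auto
  have "\<exists>enc g. (\<forall>w\<in>{1..M}. \<forall>i<n. enc w i < m) \<and>
      err_prob m pz W1 Wr n M enc (relay_blocks l \<phi>) g \<le> r ^ B + real M * (2 powr \<theta> / real m ^ l) ^ B"
    if n: "l + B * l \<le> n" and M: "1 \<le> M" for n B M :: nat
  proof -
    let ?Z = "seqs n {0..<m}" and ?Y = "seqs n (UNIV :: 'y1 set)" and ?S = "seqs n (UNIV :: 's set)"
    let ?f = "relay_blocks l \<phi>"
    let ?\<Omega> = "?Z \<times> ?Y \<times> ?S"
    define zb where "zb z b = (\<lambda>t\<in>{0..<l}. z (b * l + t) :: nat)" for z b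
    define sb where "sb s b = (\<lambda>t\<in>{0..<l}. s (l + b * l + t) :: 's)" for s b
    define \<mu> where "\<mu> = (\<lambda>(z,y,s). block_law n ?f z y s)"
    define L where "L z s = (\<Sum>b\<in>{0..<B}. loss (zb z b) (sb s b))" for z s
    define out where "out x = (\<lambda>(z, y :: nat \<Rightarrow> 'y1, s :: nat \<Rightarrow> 's). (\<lambda>i\<in>{0..<n}. (x i + z i) mod m, s))" for x :: "nat \<Rightarrow> nat"
    \<comment> \<open>Subtracting the codeword from the received word gives a candidate noise word;
      \<open>x\<close> is accepted if the predicted loss of the candidate is at most
      \<open>B * \<theta>\<close>.\<close>
    define D where "D x = {(v, s). L (\<lambda>i\<in>{0..<n}. (v i + (m - x i)) mod m) s \<le> real B * \<theta>}" for x :: "nat \<Rightarrow> nat"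
    define \<beta> where "\<beta> = (2 powr \<theta> / real m ^ l) ^ B"
    have \<mu>0: "0 \<le> \<mu> e" if "e \<in> ?\<Omega>" for e
      using that by (auto simp: \<mu>_def intro: block_law_nonneg)
    have \<mu>1: "sum \<mu> ?\<Omega> = 1"
      using block_law_sum[of n ?f] by (simp add: \<mu>_def sum.cartesian_product')
    have fin: "finite ?Z" "finite ?\<Omega>" by (intro finite_cartesian_product finite_PiE; simp)+
    have card: "real (card ?Z) = real m ^ n" by (simp add: card_PiE)
    have zbm: "zb z b t < m" if "z \<in> ?Z" "b < B" "t < l" for z b t
    proof -
      have "b * l + t < Suc b * l" using that by simp
      also have "... \<le> B * l" using that by (intro mult_right_mono) auto
      finally show ?thesis using that n by (auto simp: zb_def PiE_iff)
    qed
    have typical: "(\<Sum>e\<in>?\<Omega>. \<mu> e * of_bool (\<not> (case e of (z,y,s) \<Rightarrow> L z s \<le> real B * \<theta>))) \<le> r ^ B"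
    proof -
      have "(\<Sum>e\<in>?\<Omega>. \<mu> e * of_bool (\<not> (case e of (z,y,s) \<Rightarrow> L z s \<le> real B * \<theta>)))
        \<le> (\<Sum>e\<in>?\<Omega>. \<mu> e * (case e of (z,y,s) \<Rightarrow> exp (\<tau> * (L z s - real B * \<theta>))))"
        using \<tau>(1) by (intro sum_mono mult_left_mono \<mu>0) (auto simp: of_bool_def)
      also have "... = (\<Sum>z\<in>?Z. \<Sum>y\<in>?Y. \<Sum>s\<in>?S. block_law n ?f z y s * (\<Prod>b\<in>{0..<B}. exp (\<tau> * (loss (zb z b) (sb s b) - \<theta>))))"
      proof -
        have "exp (\<tau> * (L z s - real B * \<theta>)) = (\<Prod>b\<in>{0..<B}. exp (\<tau> * (loss (zb z b) (sb s b) - \<theta>)))" for z s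
        proof -
          have "\<tau> * (L z s - real B * \<theta>) = (\<Sum>b\<in>{0..<B}. \<tau> * (loss (zb z b) (sb s b) - \<theta>))"
            by (simp add: L_def sum_subtractf flip: sum_distrib_left)
          then show ?thesis by (simp only: exp_sum finite_atLeastLessThan)
        qed
        then show ?thesis by (simp add: \<mu>_def sum.cartesian_product')
      qed
      also have "... = r ^ B"
        unfolding zb_def sb_def r_def by (rule block_law_expectation[OF l n])
      finally show ?thesis .
    qed
    have typical': "1 - r ^ B \<le> (\<Sum>e\<in>?\<Omega>. \<mu> e * of_bool (case e of (z,y,s) \<Rightarrow> L z s \<le> real B * \<theta>))"
    proof -
      have "(\<Sum>e\<in>?\<Omega>. \<mu> e * of_bool (case e of (z,y,s) \<Rightarrow> L z s \<le> real B * \<theta>))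
         = (\<Sum>e\<in>?\<Omega>. \<mu> e - \<mu> e * of_bool (\<not> (case e of (z,y,s) \<Rightarrow> L z s \<le> real B * \<theta>)))"
        by (intro sum.cong refl) auto
      then show ?thesis using typical \<mu>1 by (simp add: sum_subtractf)
    qed
    have out_D: "out x e \<in> D x \<longleftrightarrow> (case e of (z,y,s) \<Rightarrow> L z s \<le> real B * \<theta>)" if x: "x \<in> ?Z" and e: "e \<in> ?\<Omega>" for x e
    proof -
      obtain z y s where zys: "e = (z,y,s)" "z \<in> ?Z" using e by auto
      have "((x i + z i) mod m + (m - x i)) mod m = z i" if "i < n" for i
      proof -
        have xi: "x i < m" "z i < m" using x zys(2) that by (auto simp: PiE_iff)
        have "((x i + z i) mod m + (m - x i)) mod m = (x i + z i + (m - x i)) mod m" by (rule mod_add_left_eq)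
        also have "x i + z i + (m - x i) = z i + m" using xi by simp
        finally show ?thesis using xi by simp
      qed
      moreover have "z i = undefined" if "\<not> i < n" for i using zys(2) that by (auto simp: PiE_iff extensional_def)
      ultimately have "(\<lambda>i\<in>{0..<n}. ((\<lambda>i\<in>{0..<n}. (x i + z i) mod m) i + (m - x i)) mod m) = z"
        by (auto simp: fun_eq_iff)
      then show ?thesis by (simp add: zys(1) out_def D_def)
    qed
    have count: "(1 / real m ^ n) * (\<Sum>z\<in>?Z. of_bool (L z s \<le> real B * \<theta>)) \<le> \<beta>" for s
    proof -
      have "(1 / real m ^ n) * (\<Sum>z\<in>?Z. of_bool (L z s \<le> real B * \<theta>))
         \<le> (1 / real m ^ n) * (\<Sum>z\<in>?Z. 2 powr (real B * \<theta>) * (\<Prod>b\<in>{0..<B}. \<Prod>t\<in>{0..<l}. \<pi> (sb s b) t (zb z b t)))"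
      proof (intro mult_left_mono sum_mono)
        fix z assume z: "z \<in> ?Z"
        have pp: "0 < \<pi> (sb s b) t (zb z b t)" if "b < B" "t < l" for b t using \<pi>0 zbm[OF z that] by simp
        have "2 powr (- L z s) = (\<Prod>b\<in>{0..<B}. \<Prod>t\<in>{0..<l}. \<pi> (sb s b) t (zb z b t))"
        proof -
          have "log 2 (\<Prod>b\<in>{0..<B}. \<Prod>t\<in>{0..<l}. \<pi> (sb s b) t (zb z b t)) = (\<Sum>b\<in>{0..<B}. log 2 (\<Prod>t\<in>{0..<l}. \<pi> (sb s b) t (zb z b t)))"
            using pp by (intro log_prod) (auto intro!: prod_pos)
          also have "... = (\<Sum>b\<in>{0..<B}. \<Sum>t\<in>{0..<l}. log 2 (\<pi> (sb s b) t (zb z b t)))"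
            using pp by (intro sum.cong refl log_prod) auto
          also have "... = - L z s" by (simp add: L_def loss_def sum_negf)
          finally have eq: "- L z s = log 2 (\<Prod>b\<in>{0..<B}. \<Prod>t\<in>{0..<l}. \<pi> (sb s b) t (zb z b t))" by simp
          have "0 < (\<Prod>b\<in>{0..<B}. \<Prod>t\<in>{0..<l}. \<pi> (sb s b) t (zb z b t))" using pp by (intro prod_pos) auto
          then show ?thesis unfolding eq by (intro powr_log_cancel) auto
        qed
        moreover have "of_bool (L z s \<le> real B * \<theta>) \<le> 2 powr (real B * \<theta>) * 2 powr (- L z s)"
          by (auto simp: of_bool_def ge_one_powr_ge_zero simp flip: powr_add)
        ultimately show "of_bool (L z s \<le> real B * \<theta>)
           \<le> 2 powr (real B * \<theta>) * (\<Prod>b\<in>{0..<B}. \<Prod>t\<in>{0..<l}. \<pi> (sb s b) t (zb z b t))" by simp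
      qed simp
      \<comment> \<open>The normalisation \<open>1 / m ^ n\<close> is spread over the positions as a
        uniform law, so that the positions outside the \<open>B\<close> blocks sum out to 1.\<close>
      also have "... = 2 powr (real B * \<theta>) * (\<Sum>z\<in>?Z. (\<Prod>i\<in>{0..<n}. 1 / real m) *
          (\<Prod>b\<in>{0..<B}. \<Prod>t\<in>{0..<l}. \<pi> (sb s b) t ((\<lambda>t\<in>{0..<l}. z (0 + b * l + t)) t)))"
        unfolding zb_def by (simp add: sum_distrib_left mult_ac power_divide)
      also have "(\<Sum>z\<in>?Z. (\<Prod>i\<in>{0..<n}. 1 / real m) *
          (\<Prod>b\<in>{0..<B}. \<Prod>t\<in>{0..<l}. \<pi> (sb s b) t ((\<lambda>t\<in>{0..<l}. z (0 + b * l + t)) t)))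
        = (\<Prod>b\<in>{0..<B}. \<Sum>z\<in>?Zl. (\<Prod>t\<in>{0..<l}. 1 / real m) * (\<Prod>t\<in>{0..<l}. \<pi> (sb s b) t (z t)))"
        using l n m0 by (intro sum_PiE_blocks[where g = "\<lambda>_ _. 1 / real m" and F = "\<lambda>b z. \<Prod>t\<in>{0..<l}. \<pi> (sb s b) t (z t)"]) auto
      also have "... = (\<Prod>b\<in>{0..<B}. (1 / real m) ^ l)"
        unfolding sum_distrib_left[symmetric]
        by (intro prod.cong refl, subst sum_PiE_prod_eq_1) (auto simp: \<pi>1)
      also have "2 powr (real B * \<theta>) * ... = \<beta>"
        by (simp add: \<beta>_def power_divide powr_power mult.commute flip: power_mult)
      finally show ?thesis .
    qed
    have bad: "(\<Sum>x\<in>?Z. 1 / real m ^ n * (\<Sum>e\<in>?\<Omega>. \<mu> e * of_bool (out x e \<in> D x'))) \<le> \<beta>" if x': "x' \<in> ?Z" for x'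
    proof -
      have "(\<Sum>x\<in>?Z. 1 / real m ^ n * (\<Sum>e\<in>?\<Omega>. \<mu> e * of_bool (out x e \<in> D x')))
        = (\<Sum>x\<in>?Z. \<Sum>e\<in>?\<Omega>. \<mu> e * (1 / real m ^ n * of_bool (out x e \<in> D x')))"
        by (simp add: sum_distrib_left mult_ac)
      also have "... = (\<Sum>e\<in>?\<Omega>. \<Sum>x\<in>?Z. \<mu> e * (1 / real m ^ n * of_bool (out x e \<in> D x')))" by (rule sum.swap)
      also have "... = (\<Sum>e\<in>?\<Omega>. \<mu> e * (1 / real m ^ n * (\<Sum>x\<in>?Z. of_bool (out x e \<in> D x'))))"
        by (simp only: sum_distrib_left)
      also have "... \<le> (\<Sum>e\<in>?\<Omega>. \<mu> e * \<beta>)"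
      proof (intro sum_mono mult_left_mono \<mu>0)
        fix e assume "e \<in> ?\<Omega>"
        then obtain z y s where zys: "e = (z,y,s)" "z \<in> ?Z" by auto
        \<comment> \<open>As \<open>x\<close> runs through all words, so does the candidate noise
          \<open>z + x - x'\<close>; a uniform codeword thus makes it uniform.\<close>
        define c where "c i = z i + (m - x' i)" for i
        have "out x e \<in> D x' \<longleftrightarrow> L (\<lambda>i\<in>{0..<n}. (c i + x i) mod m) s \<le> real B * \<theta>" for x
        proof -
          have "((x i + z i) mod m + (m - x' i)) mod m = (c i + x i) mod m" for i
            unfolding c_def mod_add_left_eq by (simp add: add_ac)
          then have "(\<lambda>i\<in>{0..<n}. ((\<lambda>i\<in>{0..<n}. (x i + z i) mod m) i + (m - x' i)) mod m) = (\<lambda>i\<in>{0..<n}. (c i + x i) mod m)"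
            by (auto simp: fun_eq_iff)
          then show ?thesis by (simp add: zys(1) out_def D_def)
        qed
        then have "(\<Sum>x\<in>?Z. of_bool (out x e \<in> D x') :: real) = (\<Sum>x\<in>?Z. of_bool (L (\<lambda>i\<in>{0..<n}. (c i + x i) mod m) s \<le> real B * \<theta>))" by simp
        also have "... = (\<Sum>z\<in>?Z. of_bool (L z s \<le> real B * \<theta>) :: real)"
          by (rule sum_shift_mod[OF m0])
        finally show "1 / real m ^ n * (\<Sum>x\<in>?Z. of_bool (out x e \<in> D x')) \<le> \<beta>" using count[of s] by simp
      qed
      also have "... = \<beta>" using \<mu>1 by (simp flip: sum_distrib_right)
      finally show ?thesis .
    qed
    have good: "1 - r ^ B \<le> (\<Sum>x\<in>?Z. 1 / real m ^ n * (\<Sum>e\<in>?\<Omega>. \<mu> e * of_bool (out x e \<in> D x)))"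
    proof -
      have "(\<Sum>x\<in>?Z. 1 / real m ^ n * (\<Sum>e\<in>?\<Omega>. \<mu> e * of_bool (out x e \<in> D x)))
        = (\<Sum>x\<in>?Z. 1 / real m ^ n * (\<Sum>e\<in>?\<Omega>. \<mu> e * of_bool (case e of (z,y,s) \<Rightarrow> L z s \<le> real B * \<theta>)))"
        by (intro sum.cong refl arg_cong2[where f = "(*)"]) (simp add: out_D)
      also have "... = (\<Sum>e\<in>?\<Omega>. \<mu> e * of_bool (case e of (z,y,s) \<Rightarrow> L z s \<le> real B * \<theta>))"
        unfolding sum_constant card using m0 by simp
      finally show ?thesis using typical' by simp
    qed
    have "\<exists>c g. \<forall>w\<in>{1..M}. c w \<in> ?Z \<and> 1 - r ^ B - real M * \<beta> \<le> (\<Sum>e\<in>?\<Omega>. \<mu> e * of_bool (g (out (c w) e) = w))"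
    proof (rule feinstein[where P = "\<lambda>_. 1 / real m ^ n" and W = "\<lambda>_. \<mu>" and D = D])
      show "(\<Sum>x\<in>?Z. 1 / real m ^ n) = 1" unfolding sum_constant card using m0 by simp
      show "0 \<le> \<beta>" by (simp add: \<beta>_def)
    qed (use fin \<mu>0 good bad in auto)
    then obtain c g where cg: "\<And>w. w \<in> {1..M} \<Longrightarrow> c w \<in> ?Z"
      "\<And>w. w \<in> {1..M} \<Longrightarrow> 1 - r ^ B - real M * \<beta> \<le> (\<Sum>e\<in>?\<Omega>. \<mu> e * of_bool (g (out (c w) e) = w))"
      by blast
    have err: "(\<Sum>z\<in>?Z. \<Sum>y\<in>?Y. \<Sum>s\<in>?S. block_law n ?f z y s * of_bool (curry g (\<lambda>i\<in>{0..<n}. (c w i + z i) mod m) s \<noteq> w)) \<le> r ^ B + real M * \<beta>"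
      if w: "w \<in> {1..M}" for w
    proof -
      have "(\<Sum>z\<in>?Z. \<Sum>y\<in>?Y. \<Sum>s\<in>?S. block_law n ?f z y s * of_bool (curry g (\<lambda>i\<in>{0..<n}. (c w i + z i) mod m) s \<noteq> w))
        = (\<Sum>e\<in>?\<Omega>. \<mu> e * of_bool (g (out (c w) e) \<noteq> w))"
        by (simp add: \<mu>_def out_def sum.cartesian_product')
      also have "... = (\<Sum>e\<in>?\<Omega>. \<mu> e - \<mu> e * of_bool (g (out (c w) e) = w))"
        by (intro sum.cong refl) auto
      also have "... \<le> r ^ B + real M * \<beta>" using cg(2)[OF w] \<mu>1 by (simp add: sum_subtractf)
      finally show ?thesis .
    qed
    have "err_prob m pz W1 Wr n M c ?f (curry g) \<le> (1 / real M) * (\<Sum>w\<in>{1..M}. r ^ B + real M * \<beta>)"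
      unfolding err_prob_block_law by (intro mult_left_mono sum_mono err) auto
    also have "... = r ^ B + real M * \<beta>" using M by simp
    finally show ?thesis using cg(1) unfolding \<beta>_def by (intro exI[of _ c] exI[of _ "curry g"]) (auto simp: PiE_iff)
  qed
  then show ?thesis using r0 r1 by blast
qed

lemma err_prob_nonneg: "0 \<le> err_prob m pz W1 Wr n M enc f g"
  unfolding err_prob_block_law
  by (intro mult_nonneg_nonneg sum_nonneg block_law_nonneg) auto

text \<open>The delay of the relay and the incomplete last block cost fewer than
  \<open>2 * l\<close> letters, which changes the number of messages per \<open>B n\<close> blocks
  only by a constant factor.\<close>

lemma block_predictor_achievable:
  assumes bp: "block_predictor h l \<phi> \<pi>" and R: "R < log 2 (real m) - h"
  shows "achievable m pz W1 Wr R"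
proof (cases "R \<le> 0")
  case True
  then show ?thesis by (rule achievable_nonpos_rate)
next
  case False
  then have R0: "0 \<le> R" by simp
  have l: "0 < l" using bp by (simp add: block_predictor_def)
  have m0: "0 < real m" using m_ge_2 by simp
  \<comment> \<open>Half of the gap: \<open>\<theta>\<close> stays above \<open>l * h\<close>, and
    each block still gains a factor \<open>2 powr (- l * \<gamma>)\<close> against wrong
    codewords.\<close>
  define \<gamma> where "\<gamma> = (log 2 (real m) - h - R) / 2"
  have \<gamma>: "0 < \<gamma>" using R by (simp add: \<gamma>_def)
  define \<theta> where "\<theta> = real l * (log 2 (real m) - R - \<gamma>)"
  have "h < log 2 (real m) - R - \<gamma>" using R by (simp add: \<gamma>_def field_simps)
  then have "real l * h < \<theta>" using l by (simp add: \<theta>_def)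
  from block_code_exists[OF bp this] obtain r where r: "0 \<le> r" "r < 1"
    and code: "\<And>n B M. l + B * l \<le> n \<Longrightarrow> 1 \<le> M \<Longrightarrow> \<exists>enc g. (\<forall>w\<in>{1..M}. \<forall>i<n. enc w i < m) \<and>
      err_prob m pz W1 Wr n M enc (relay_blocks l \<phi>) g \<le> r ^ B + real M * (2 powr \<theta> / real m ^ l) ^ B"
    by blast
  define B where "B n = n div l - 1" for n
  define \<beta> where "\<beta> = 2 powr (real l * (- R - \<gamma>))"
  have \<beta>: "2 powr \<theta> / real m ^ l = \<beta>"
  proof -
    have "real m ^ l = 2 powr (real l * log 2 (real m))"
      using m0 by (simp add: powr_realpow powr_powr[symmetric] mult.commute[of "real l"])
    then show ?thesis
      by (simp add: \<theta>_def \<beta>_def algebra_simps flip: powr_diff)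
  qed
  \<comment> \<open>The factor 2 comes from the ceiling in \<open>num_msgs\<close>, the power from
    \<open>n < (B n + 2) * l\<close>.\<close>
  define C where "C = 2 * 2 powr (2 * real l * R)"
  define \<rho> where "\<rho> = 2 powr (- (real l * \<gamma>))"
  define P where "P n enc g \<longleftrightarrow> (\<forall>w\<in>{1..num_msgs n R}. \<forall>i<n. enc w i < m) \<and>
    (l \<le> n \<longrightarrow> err_prob m pz W1 Wr n (num_msgs n R) enc (relay_blocks l \<phi>) g \<le> r ^ B n + C * \<rho> ^ B n)" for n enc g
  have "\<exists>enc g. P n enc g" for n
  proof (cases "l \<le> n")
    case True
    then have d: "1 \<le> n div l" using l by (simp add: div_greater_zero_iff Suc_le_eq)
    then have "l + B n * l = n div l * l"
      unfolding B_def by (metis add.commute add_mult_distrib le_add_diff_inverse2 nat_mult_1)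
    also have "... \<le> n" by simp
    finally have n: "l + B n * l \<le> n" .
    have "n < Suc (n div l) * l" using l by (metis dividend_less_times_div mult.commute mult_Suc_right)
    also have "Suc (n div l) = B n + 2" using d by (simp add: B_def)
    finally have "real n \<le> real ((B n + 2) * l)" by (simp only: of_nat_le_iff less_imp_le)
    then have "real n * R \<le> real ((B n + 2) * l) * R" using R0 by (rule mult_right_mono)
    then have "2 powr (real n * R) \<le> 2 powr (real ((B n + 2) * l) * R)" by (intro powr_mono) auto
    then have M: "real (num_msgs n R) \<le> 2 * 2 powr (real ((B n + 2) * l) * R)"
      using num_msgs_le[OF R0, of n] by linarith
    have "real (num_msgs n R) * \<beta> ^ B n \<le> 2 * 2 powr (real ((B n + 2) * l) * R) * \<beta> ^ B n"
      by (intro mult_right_mono M) (simp add: \<beta>_def)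
    also have "2 * 2 powr (real ((B n + 2) * l) * R) * \<beta> ^ B n
       = 2 * 2 powr (real ((B n + 2) * l) * R) * 2 powr (real (B n) * (real l * (- R - \<gamma>)))"
      by (simp add: \<beta>_def powr_power mult.commute)
    also have "... = 2 * (2 powr (2 * real l * R) * 2 powr (real (B n) * (- (real l * \<gamma>))))"
      unfolding mult.assoc powr_add[symmetric] by (simp add: algebra_simps)
    also have "... = C * \<rho> ^ B n"
      by (simp add: C_def \<rho>_def powr_power mult.commute)
    finally have "real (num_msgs n R) * \<beta> ^ B n \<le> C * \<rho> ^ B n" .
    moreover have "1 \<le> num_msgs n R"
      by (rule num_msgs_ge(2))
    ultimately show ?thesis
      using code[OF n, of "num_msgs n R"] unfolding \<beta> P_def by (meson add_left_mono order_trans)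
  next
    case False
    then show ?thesis unfolding P_def using m_ge_2 by (intro exI[of _ "\<lambda>_ _. 0"]) auto
  qed
  then obtain enc g where P: "\<And>n. P n (enc n) (g n)" by metis
  have Blim: "filterlim B at_top sequentially"
    unfolding filterlim_at_top
  proof
    fix Z
    have "Z \<le> B n" if "Suc Z * l \<le> n" for n
    proof -
      have "Suc Z \<le> n div l" using div_le_mono[OF that, of l] l by simp
      then show ?thesis by (simp add: B_def)
    qed
    then show "eventually (\<lambda>n. Z \<le> B n) sequentially"
      unfolding eventually_sequentially by blast
  qed
  have "2 powr (- (real l * \<gamma>)) < 2 powr 0" using l \<gamma> by (subst powr_less_cancel_iff) auto
  then have \<rho>: "0 \<le> \<rho>" "\<rho> < 1" by (auto simp: \<rho>_def)
  have "(\<lambda>n. r ^ B n + C * \<rho> ^ B n) \<longlonglongrightarrow> 0 + C * 0"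
    by (intro tendsto_add tendsto_mult tendsto_const
        filterlim_compose[OF LIMSEQ_realpow_zero[OF r] Blim] filterlim_compose[OF LIMSEQ_realpow_zero[OF \<rho>] Blim])
  then have lim: "(\<lambda>n. r ^ B n + C * \<rho> ^ B n) \<longlonglongrightarrow> 0" by simp
  have "(\<lambda>n. err_prob m pz W1 Wr n (num_msgs n R) (enc n) (relay_blocks l \<phi>) (g n)) \<longlonglongrightarrow> 0"
  proof (rule tendsto_sandwich[OF _ _ tendsto_const lim])
    show "eventually (\<lambda>n. err_prob m pz W1 Wr n (num_msgs n R) (enc n) (relay_blocks l \<phi>) (g n) \<le> r ^ B n + C * \<rho> ^ B n) sequentially"
      using eventually_ge_at_top[of l] by eventually_elim (use P in \<open>auto simp: P_def\<close>)
  qed (simp add: err_prob_nonneg)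
  moreover have "\<forall>n w i. 1 \<le> w \<and> w \<le> num_msgs n R \<and> i < n \<longrightarrow> enc n w i < m"
    using P by (auto simp: P_def)
  ultimately show ?thesis
    unfolding achievable_def
    by (intro exI[of _ enc] exI[of _ "\<lambda>_. relay_blocks l \<phi>"] exI[of _ g] conjI)
      (auto intro: relay_blocks_causal)
qed

end

section \<open>Capacity\<close>

text \<open>Mutual information as the relative entropy of the joint weight \<open>w\<close> from the
  product of its marginals \<open>P\<close> and \<open>T\<close>.\<close>

lemma sum_divergence_eq:
  fixes w :: "'u \<Rightarrow> 'a \<Rightarrow> real"
  assumes fin: "finite U" "finite A" and w: "\<And>u a. u \<in> U \<Longrightarrow> a \<in> A \<Longrightarrow> 0 \<le> w u a"
    and P: "\<And>a. a \<in> A \<Longrightarrow> P a = (\<Sum>u\<in>U. w u a)"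
    and T: "\<And>u. u \<in> U \<Longrightarrow> T u = sum (w u) A"
  shows "(\<Sum>u\<in>U. \<Sum>a\<in>A. w u a * log 2 (w u a / (P a * T u))) = ent P A - (\<Sum>u\<in>U. hent (w u) A)"
proof -
  have "w u a * log 2 (w u a / (P a * T u)) = w u a * log 2 (w u a) - w u a * log 2 (P a) - w u a * log 2 (T u)"
    if u: "u \<in> U" and a: "a \<in> A" for u a
  proof (cases "w u a = 0")
    case False
    then have pos: "0 < w u a" using w[OF u a] by simp
    have "0 < P a" unfolding P[OF a] using fin w u a pos by (intro sum_pos2[of U u]) auto
    moreover have "0 < T u" unfolding T[OF u] using fin w u a pos by (intro sum_pos2[of A a]) auto
    ultimately show ?thesis using pos by (simp add: log_divide log_mult algebra_simps)
  qed simp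
  then have "(\<Sum>u\<in>U. \<Sum>a\<in>A. w u a * log 2 (w u a / (P a * T u)))
    = (\<Sum>u\<in>U. \<Sum>a\<in>A. w u a * log 2 (w u a)) - (\<Sum>u\<in>U. \<Sum>a\<in>A. w u a * log 2 (P a)) - (\<Sum>u\<in>U. \<Sum>a\<in>A. w u a * log 2 (T u))"
    by (simp add: sum_subtractf)
  also have "(\<Sum>u\<in>U. \<Sum>a\<in>A. w u a * log 2 (P a)) = (\<Sum>a\<in>A. \<Sum>u\<in>U. w u a * log 2 (P a))" by (rule sum.swap)
  also have "... = - ent P A" by (simp add: ent_def plogp_eq P flip: sum_distrib_right)
  also have "(\<Sum>u\<in>U. \<Sum>a\<in>A. w u a * log 2 (T u)) = (\<Sum>u\<in>U. T u * log 2 (T u))"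
    by (simp add: T flip: sum_distrib_right)
  finally show ?thesis by (simp add: hent_def plogp_eq sum_subtractf T)
qed

context modsum_relay
begin

text \<open>\<open>I(Z; U) \<le> I(Y1; U)\<close>, by the log-sum inequality over \<open>y\<close>
  with weights \<open>K z y\<close> for each pair of \<open>u\<close> and \<open>z\<close>. For
  \<open>R0 = 0\<close> it shows that no feasible \<open>U\<close> lowers the entropy of
  \<open>Z\<close>.\<close>

lemma data_processing:
  assumes Q: "\<And>y. is_pmf_on (Q y) {0..<k}"
  shows "hent (KK pY) {0..<m} - H_Z_given_U m pz W1 k Q \<le> I_UY1 m pz W1 k Q"
proof -
  define v where "v u y = pY y * Q y u" for u y
  define T where "T u = sum (v u) UNIV" for u
  have v0: "0 \<le> v u y" if "u < k" for u y using Q[of y] that by (auto simp: v_def is_pmf_on_def pY_nonneg)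
  have vs: "pY y = (\<Sum>u\<in>{0..<k}. v u y)" for y
    using Q[of y] by (simp add: v_def is_pmf_on_def flip: sum_distrib_left)
  have Ks: "KK pY z = (\<Sum>u\<in>{0..<k}. KK (v u) z)" for z
  proof -
    have "KK pY z = (\<Sum>y\<in>UNIV. \<Sum>u\<in>{0..<k}. K z y * v u y)"
      unfolding KK_def by (intro sum.cong refl) (simp add: vs flip: sum_distrib_left)
    also have "... = (\<Sum>u\<in>{0..<k}. \<Sum>y\<in>UNIV. K z y * v u y)" by (rule sum.swap)
    finally show ?thesis by (simp add: KK_def)
  qed
  have pos: "0 < pY y * T u" if "u < k" "0 < v u y" for u y
  proof -
    have "0 < pY y" using that(2) pY_nonneg[of y] by (cases "pY y = 0") (auto simp: v_def)
    moreover have "0 < T u" unfolding T_def using that v0 by (intro sum_pos2[of UNIV y]) auto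
    ultimately show ?thesis by simp
  qed
  have T0: "0 \<le> T u" if "u < k" for u unfolding T_def using v0[OF that] by (simp add: sum_nonneg)
  have letter: "KK (v u) z * log 2 (KK (v u) z / (KK pY z * T u)) \<le> (\<Sum>y\<in>UNIV. K z y * (v u y * log 2 (v u y / (pY y * T u))))"
    if u: "u < k" and z: "z < m" for u z
  proof -
    have "(\<Sum>y\<in>UNIV. K z y * v u y) * log 2 ((\<Sum>y\<in>UNIV. K z y * v u y) / (\<Sum>y\<in>UNIV. K z y * (pY y * T u)))
      \<le> (\<Sum>y\<in>UNIV. K z y * v u y * log 2 (K z y * v u y / (K z y * (pY y * T u))))"
    proof (rule log_sum_inequality)
      fix y
      show "0 \<le> K z y * v u y" using K_nonneg[OF z] v0[OF u] by simp
      show "0 \<le> K z y * (pY y * T u)" using K_nonneg[OF z] pY_nonneg T0[OF u] by simp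
      assume "0 < K z y * v u y"
      then have "0 < K z y" "0 < v u y"
        using K_nonneg[OF z, of y] v0[OF u, of y] by (auto simp: zero_less_mult_iff)
      then show "0 < K z y * (pY y * T u)" using pos[OF u] by simp
    qed simp
    also have "... = (\<Sum>y\<in>UNIV. K z y * (v u y * log 2 (v u y / (pY y * T u))))"
      by (intro sum.cong refl) auto
    finally show ?thesis unfolding KK_def by (simp add: sum_distrib_right mult.assoc)
  qed
  have "ent (KK pY) {0..<m} - (\<Sum>u\<in>{0..<k}. hent (KK (v u)) {0..<m})
     = (\<Sum>u\<in>{0..<k}. \<Sum>z\<in>{0..<m}. KK (v u) z * log 2 (KK (v u) z / (KK pY z * T u)))"
    by (rule sum_divergence_eq[symmetric]) (use KK_nonneg v0 Ks in \<open>auto simp: KK_sum T_def\<close>)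
  also have "... \<le> (\<Sum>u\<in>{0..<k}. \<Sum>z\<in>{0..<m}. \<Sum>y\<in>UNIV. K z y * (v u y * log 2 (v u y / (pY y * T u))))"
    by (intro sum_mono letter) auto
  also have "... = (\<Sum>u\<in>{0..<k}. \<Sum>y\<in>UNIV. \<Sum>z\<in>{0..<m}. K z y * (v u y * log 2 (v u y / (pY y * T u))))"
    by (intro sum.cong refl sum.swap)
  also have "... = (\<Sum>u\<in>{0..<k}. \<Sum>y\<in>UNIV. v u y * log 2 (v u y / (pY y * T u)))"
    by (simp only: sum_distrib_right[symmetric] K_sum mult_1)
  also have "... = ent pY UNIV - (\<Sum>u\<in>{0..<k}. hent (v u) UNIV)"
    by (rule sum_divergence_eq) (use v0 vs in \<open>auto simp: T_def\<close>)
  finally have "ent (KK pY) {0..<m} - (\<Sum>u\<in>{0..<k}. hent (KK (v u)) {0..<m}) \<le> ent pY UNIV - (\<Sum>u\<in>{0..<k}. hent (v u) UNIV)" .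
  moreover have "hent (KK pY) {0..<m} = ent (KK pY) {0..<m}"
    by (rule hent_pmf) (auto simp: is_pmf_on_def KK_sum pY_sum KK_nonneg pY_nonneg)
  ultimately show ?thesis unfolding I_UY1_hent H_Z_given_U_hent v_def by simp
qed

text \<open>Erasing \<open>U\<close> with probability \<open>c\<close> makes the rate constraint strict.\<close>
lemma erased_test_channel:
  fixes Q :: "'y1 \<Rightarrow> nat \<Rightarrow> real" and y :: 'y1
  assumes Q: "\<And>y. is_pmf_on (Q y) {0..<k}" and c: "0 \<le> c" "c \<le> 1"
  defines "Q' \<equiv> \<lambda>y u. if u < k then (1 - c) * Q y u else c"
  shows "is_pmf_on (Q' y) {0..<Suc k}"
    "I_UY1 m pz W1 (Suc k) Q' = (1 - c) * I_UY1 m pz W1 k Q"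
    "H_Z_given_U m pz W1 (Suc k) Q' = (1 - c) * H_Z_given_U m pz W1 k Q + c * hent (KK pY) {0..<m}"
proof -
  have Qs: "sum (Q y) {0..<k} = 1" "\<And>u. u < k \<Longrightarrow> 0 \<le> Q y u" for y
    using Q[of y] by (auto simp: is_pmf_on_def)
  show "is_pmf_on (Q' y) {0..<Suc k}"
    using Qs c by (auto simp: is_pmf_on_def Q'_def simp flip: sum_distrib_left)
  have 1: "(\<lambda>y. pY y * Q' y u) = (\<lambda>y. (1 - c) * (pY y * Q y u))" if "u < k" for u
    using that by (auto simp: Q'_def)
  have 2: "(\<lambda>y. pY y * Q' y k) = (\<lambda>y. c * pY y)" by (auto simp: Q'_def)
  have "hent (\<lambda>y. pY y * Q' y u) UNIV = (1 - c) * hent (\<lambda>y. pY y * Q y u) UNIV" if "u < k" for u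
    unfolding 1[OF that] by (rule hent_scale) (use c pY_nonneg Qs(2) that in auto)
  moreover have "hent (\<lambda>y. pY y * Q' y k) UNIV = c * ent pY UNIV"
    unfolding 2 hent_pmf[OF pY_pmf, symmetric] by (rule hent_scale) (use c pY_nonneg in auto)
  ultimately have "(\<Sum>u\<in>{0..<Suc k}. hent (\<lambda>y. pY y * Q' y u) UNIV)
      = (1 - c) * (\<Sum>u\<in>{0..<k}. hent (\<lambda>y. pY y * Q y u) UNIV) + c * ent pY UNIV"
    by (simp add: sum_distrib_left)
  then show "I_UY1 m pz W1 (Suc k) Q' = (1 - c) * I_UY1 m pz W1 k Q"
    unfolding I_UY1_hent by (simp only:) (simp add: algebra_simps)
  have "hent (KK (\<lambda>y. pY y * Q' y u)) {0..<m} = (1 - c) * hent (KK (\<lambda>y. pY y * Q y u)) {0..<m}" if "u < k" for u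
  proof -
    have "KK (\<lambda>y. pY y * Q' y u) = (\<lambda>z. (1 - c) * KK (\<lambda>y. pY y * Q y u) z)"
      unfolding 1[OF that] by (rule ext) (rule KK_scale)
    then show ?thesis
      by (simp only:) (rule hent_scale, use c pY_nonneg Qs(2) that in \<open>auto intro!: KK_nonneg\<close>)
  qed
  moreover have "hent (KK (\<lambda>y. pY y * Q' y k)) {0..<m} = c * hent (KK pY) {0..<m}"
  proof -
    have "KK (\<lambda>y. pY y * Q' y k) = (\<lambda>z. c * KK pY z)" unfolding 2 by (rule ext) (rule KK_scale)
    then show ?thesis
      by (simp only:) (rule hent_scale, use c pY_nonneg in \<open>auto intro!: KK_nonneg\<close>)
  qed
  ultimately show "H_Z_given_U m pz W1 (Suc k) Q' = (1 - c) * H_Z_given_U m pz W1 k Q + c * hent (KK pY) {0..<m}"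
    unfolding H_Z_given_U_hent by (simp add: sum_distrib_left)
qed

lemma achievability:
  assumes Q: "\<And>y. is_pmf_on (Q y) {0..<k}" and le: "I_UY1 m pz W1 k Q \<le> R0 Wr" and \<epsilon>: "0 < \<epsilon>"
  shows "achievable m pz W1 Wr (log 2 (real m) - H_Z_given_U m pz W1 k Q - \<epsilon>)"
proof -
  define H where "H = H_Z_given_U m pz W1 k Q"
  define Hz where "Hz = hent (KK pY) {0..<m}"
  have "\<exists>h l \<phi> \<pi>. block_predictor h l \<phi> \<pi> \<and> h < H + \<epsilon>"
  proof (cases "R0 Wr = 0")
    case True
    then have "Hz \<le> H" using data_processing[of Q k, OF Q] le by (simp add: H_def Hz_def)
    moreover obtain l \<phi> \<pi> where "block_predictor (Hz + \<epsilon> / 2) l \<phi> \<pi>"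
      using trivial_block_predictor[of "\<epsilon> / 2"] \<epsilon> by (auto simp: Hz_def)
    ultimately show ?thesis using \<epsilon> by (intro exI[of _ "Hz + \<epsilon> / 2"]) auto
  next
    case False
    then have R0: "0 < R0 Wr" using R0_nonneg[of Wr] Wr_pmf by fastforce
    define d where "d = 1 + \<bar>Hz - H\<bar>"
    have d: "0 < d" "\<bar>Hz - H\<bar> \<le> d" by (auto simp: d_def)
    \<comment> \<open>Small enough that erasure changes \<open>H(Z | U)\<close> by at most
      \<open>\<epsilon> / 4\<close>; the summand 1 in \<open>d\<close> keeps the quotient meaningful
      when \<open>Hz = H\<close>.\<close>
    define c where "c = min (1/2) (\<epsilon> / (4 * d))"
    have c: "0 < c" "c \<le> 1" using \<epsilon> d by (auto simp: c_def)
    have "c * \<bar>Hz - H\<bar> \<le> \<epsilon> / (4 * d) * d"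
      using c(1) d by (intro mult_mono) (auto simp: c_def)
    then have c3: "c * \<bar>Hz - H\<bar> \<le> \<epsilon> / 4" using d by simp
    define Q' where "Q' = (\<lambda>y u. if u < k then (1 - c) * Q y u else c)"
    note er = erased_test_channel[of Q k, OF Q less_imp_le[OF c(1)] c(2), folded Q'_def]
    have er1: "is_pmf_on (Q' y) {0..<Suc k}" for y using er(1) unfolding Q'_def .
    \<comment> \<open>Erasure shrinks a positive information strictly; if the information is 0,
      strictness comes from \<open>R0 > 0\<close>.\<close>
    have "(1 - c) * I_UY1 m pz W1 k Q < R0 Wr"
    proof (cases "I_UY1 m pz W1 k Q = 0")
      case False
      then have "0 < I_UY1 m pz W1 k Q" using I_UY1_nonneg[of Q k, OF Q] by simp
      then have "(1 - c) * I_UY1 m pz W1 k Q < I_UY1 m pz W1 k Q" using c by simp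
      then show ?thesis using le by simp
    qed (use R0 in simp)
    then obtain l \<phi> \<pi> where "block_predictor ((1 - c) * H + c * Hz + \<epsilon> / 4) l \<phi> \<pi>"
      using block_predictor_exists[of Q' "Suc k", OF er1, of "\<epsilon> / 4"] \<epsilon> unfolding er(2,3) H_def Hz_def by auto
    moreover have "(1 - c) * H + c * Hz + \<epsilon> / 4 < H + \<epsilon>"
    proof -
      have "c * (Hz - H) \<le> c * \<bar>Hz - H\<bar>" using c by (intro mult_left_mono) auto
      then show ?thesis using c3 \<epsilon> by (simp add: algebra_simps)
    qed
    ultimately show ?thesis by blast
  qed
  then obtain h l \<phi> \<pi> where bp: "block_predictor h l \<phi> \<pi>" and h: "h < H + \<epsilon>" by blast
  show ?thesis by (rule block_predictor_achievable[OF bp]) (use h in \<open>simp add: H_def\<close>)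
qed

end

theorem theorem2:
  fixes m :: nat
    and pz :: "nat \<Rightarrow> real"
    and W1 :: "nat \<Rightarrow> 'y1::finite \<Rightarrow> real"
    and Wr :: "'x1::finite \<Rightarrow> 's::finite \<Rightarrow> real"
  assumes "m \<ge> 2"
    and "is_pmf_on pz {0..<m}"
    and "\<forall>z<m. is_pmf_on (W1 z) UNIV"
    and "\<forall>x1. is_pmf_on (Wr x1) UNIV"
  shows "(\<exists>k \<le> card (UNIV :: 'y1 set) + 2. \<exists>Q :: 'y1 \<Rightarrow> nat \<Rightarrow> real.
            (\<forall>y1. is_pmf_on (Q y1) {0..<k}) \<and> I_UY1 m pz W1 k Q \<le> R0 Wr \<and>
            capacity m pz W1 Wr = log 2 (real m) - H_Z_given_U m pz W1 k Q)
       \<and> (\<forall>k (Q :: 'y1 \<Rightarrow> nat \<Rightarrow> real).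
            (\<forall>y1. is_pmf_on (Q y1) {0..<k}) \<and> I_UY1 m pz W1 k Q \<le> R0 Wr \<longrightarrow>
            log 2 (real m) - H_Z_given_U m pz W1 k Q \<le> capacity m pz W1 Wr)"
proof -
  interpret modsum_relay m pz W1 Wr
    using assms by unfold_locales auto
  obtain a b where ab: "((\<chi> y. pY y), a, b) \<in> region" "ent pY UNIV - R0 Wr \<le> a"
    and opt: "\<And>a' b'. ((\<chi> y. pY y), a', b') \<in> region \<Longrightarrow> ent pY UNIV - R0 Wr \<le> a' \<Longrightarrow> b \<le> b'"
    using optimal_point_exists by blast
  have conv: "R \<le> log 2 (real m) - b" if "achievable m pz W1 Wr R" for R
    by (rule converse[OF that opt])
  then have bdd: "bdd_above {R. achievable m pz W1 Wr R}" by (intro bdd_aboveI) auto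
  have upper: "capacity m pz W1 Wr \<le> log 2 (real m) - b"
    unfolding capacity_def
    by (rule cSup_least) (use conv achievable_nonpos_rate[of 0] in auto)
  have lower: "log 2 (real m) - H_Z_given_U m pz W1 k Q \<le> capacity m pz W1 Wr"
    if "\<forall>y1. is_pmf_on (Q y1) {0..<k}" "I_UY1 m pz W1 k Q \<le> R0 Wr" for k Q
  proof (rule field_le_epsilon)
    fix \<epsilon> :: real assume "0 < \<epsilon>"
    then have "achievable m pz W1 Wr (log 2 (real m) - H_Z_given_U m pz W1 k Q - \<epsilon>)"
      using achievability that by blast
    then have "log 2 (real m) - H_Z_given_U m pz W1 k Q - \<epsilon> \<le> capacity m pz W1 Wr"
      unfolding capacity_def by (intro cSup_upper bdd) auto
    then show "log 2 (real m) - H_Z_given_U m pz W1 k Q \<le> capacity m pz W1 Wr + \<epsilon>" by simp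
  qed
  \<comment> \<open>The optimal point has a representation by a test channel on a small alphabet; it
    is feasible, so the achievability bound at this channel meets the converse.\<close>
  obtain k Q where kQ: "k \<le> CARD('y1) + 2" "\<forall>y. is_pmf_on (Q y) {0..<k}"
    "ent pY UNIV - I_UY1 m pz W1 k Q = a" "H_Z_given_U m pz W1 k Q = b"
    using region_test_channel[OF ab(1)] by blast
  have feas: "I_UY1 m pz W1 k Q \<le> R0 Wr" using kQ(3) ab(2) by simp
  have "capacity m pz W1 Wr = log 2 (real m) - H_Z_given_U m pz W1 k Q"
    using upper lower[OF kQ(2) feas] kQ(4) by simp
  then show ?thesis using kQ(1,2) feas lower by blast
qed

end
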